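(* There exist parameters $\lambda_i,\mu_i$ (satisfying the standing conditions) and decision points $(d_1,d_2,d_3)$ such that, for the stochastic model, with positive probability the side sequence $(\mathrm{Side}(\zeta(n)))_{n\ge1}$ is not eventually periodic, and also with positive probability $(\zeta(n))$ converges onto a periodic orbit of the triangle process (so that the side sequence is eventually periodic).
   Context: Triangle process. Fix $\lambda_1,\lambda_2,\lambda_3>0$, $\mu_1,\mu_2,\mu_3>0$ with $\rho_i:=\lambda_i/\mu_i<1$ for each $i$ and $\rho_1+\rho_2+\rho_3>1$. Put $\theta_j:=\mu_j^{-1}(\lambda_1+\lambda_2+\lambda_3)-1$. Let $e_1,e_2,e_3$ be the standard basis of $\mathbb R^3$, $A_i^0:=\{y\in\mathbb R^3: y_1+y_2+y_3=1,\ y_i=0,\ y_l\ge0\ \forall l\}$ and $A^0:=A_1^0\cup A_2^0\cup A_3^0$. For $j$ and $z\in A^0\setminus A_j^0$ let $f_j(z):=\sum_{i\neq j}\frac{(\mu_j-\lambda_j)z_i+\lambda_i z_j}{(\mu_j-\lambda_j)+\mu_j\theta_j z_j}\,e_i$. Let $(\hat i,\hat j,\hat k)$ denote $(1,2,3)$ or a cyclic permutation; $(1-x)e_{\hat j}+xe_{\hat k}\in A^0_{\hat i}$ is written $(x,\hat i)$, $\pi((x,\hat i)):=x$, $\mathrm{Side}((x,\hat i)):=\hat i$. $|z-z'|_1:=\|z-z'\|/\sqrt2$. Decision points $d_1,d_2,d_3\in(0,1)$; switching rule $\mathfrak R((x,\hat i))=\hat j$ if $x<d_{\hat i}$, $\hat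 k$ if $x>d_{\hat i}$, both allowed if $x=d_{\hat i}$; $\varphi(z):=f_{\mathfrak R(z)}(z)$. Periodic orbit: $u_1,\dots,u_m$ with $u_{n+1}\in\varphi(u_n)$, $u_1\in\varphi(u_m)$. A sequence $(w(t))$ converges onto it if there is $n_0$ with $|w(mt+n+n_0)-u_n|_1\to0$ as $t\to\infty$ for each $n$. Stochastic model: three queues; jobs arrive at queue $i$ as independent Poisson processes of rate $\lambda_i$; service times at queue $i$ are i.i.d., independent of everything else, with mean $1/\mu_i$ and finite variance. A single server serves exhaustively; switching takes zero time; if the system is empty the server waits for the next arrival. When the server empties queue $\hat i$ and the queue-length vector $\xi\in\mathbb Z_+^3$ is nonzero, it moves to queue $\hat j$ if $\pi(\xi/(\xi_1+\xi_2+\xi_3))<d_{\hat i}$, to $\hat k$ if $>d_{\hat i}$, either in case of equality. Let $\tau_1<\tau_2<\cdots$ be the successive switching times and $\zeta(n):=\xi(\tau_n)/\sum_i\xi_i(\tau_n)\in A^0$. *)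

theory Defs
  imports "HOL-Probability.Probability"
begin

(* Queues / sides are indexed by the 3-element numeral type 3 (elements 0,1,2, arithmetic mod 3).
   For side i the cyclic triple (i-hat, j-hat, k-hat) is (i, i+1, i+2). *)

definition A0i :: "3 \<Rightarrow> (real^3) set" where
  "A0i i = {y. (\<Sum>l\<in>UNIV. y$l) = 1 \<and> y$i = 0 \<and> (\<forall>l. 0 \<le> y$l)}"

definition A0 :: "(real^3) set" where
  "A0 = (\<Union>i. A0i i)"

definition theta :: "(3 \<Rightarrow> real) \<Rightarrow> (3 \<Rightarrow> real) \<Rightarrow> 3 \<Rightarrow> real" where
  "theta lam mu j = (\<Sum>i\<in>UNIV. lam i) / mu j - 1"

definition fj :: "(3 \<Rightarrow> real) \<Rightarrow> (3 \<Rightarrow> real) \<Rightarrow> 3 \<Rightarrow> real^3 \<Rightarrow> real^3" where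
  "fj lam mu j z = (\<Sum>i\<in>UNIV - {j}.
      (((mu j - lam j) * z$i + lam i * z$j) / ((mu j - lam j) + mu j * theta lam mu j * z$j)) *\<^sub>R axis i 1)"

text \<open>pi((x,i)) = x for the point (1-x) e_(i+1) + x e_(i+2) of side i, i.e. the (i+2)-coordinate.\<close>
definition side_coord :: "3 \<Rightarrow> real^3 \<Rightarrow> real" where
  "side_coord i z = z $ (i+2)"

definition rule_set :: "(3 \<Rightarrow> real) \<Rightarrow> 3 \<Rightarrow> real \<Rightarrow> 3 set" where
  "rule_set d i x = (if x < d i then {i+1} else if x > d i then {i+2} else {i+1, i+2})"

definition phi :: "(3 \<Rightarrow> real) \<Rightarrow> (3 \<Rightarrow> real) \<Rightarrow> (3 \<Rightarrow> real) \<Rightarrow> real^3 \<Rightarrow> (real^3) set" where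
  "phi lam mu d z = {fj lam mu j z | i j. z \<in> A0i i \<and> j \<in> rule_set d i (side_coord i z)}"

definition dist1 :: "real^3 \<Rightarrow> real^3 \<Rightarrow> real" where
  "dist1 z z' = norm (z - z') / sqrt 2"

definition periodic_orbit :: "(3 \<Rightarrow> real) \<Rightarrow> (3 \<Rightarrow> real) \<Rightarrow> (3 \<Rightarrow> real) \<Rightarrow> nat \<Rightarrow> (nat \<Rightarrow> real^3) \<Rightarrow> bool" where
  "periodic_orbit lam mu d m u \<longleftrightarrow> 1 \<le> m \<and> (\<forall>n\<in>{1..m}. u n \<in> A0) \<and>
     (\<forall>n. 1 \<le> n \<and> n < m \<longrightarrow> u (n+1) \<in> phi lam mu d (u n)) \<and> u 1 \<in> phi lam mu d (u m)"

definition converges_onto :: "(nat \<Rightarrow> real^3) \<Rightarrow> nat \<Rightarrow> (nat \<Rightarrow> real^3) \<Rightarrow> bool" where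
  "converges_onto w m u \<longleftrightarrow>
     (\<exists>n0. \<forall>n\<in>{1..m}. (\<lambda>t. dist1 (w (m*t + n + n0)) (u n)) \<longlonglongrightarrow> 0)"

definition eventually_periodic :: "(nat \<Rightarrow> 'b) \<Rightarrow> bool" where
  "eventually_periodic s \<longleftrightarrow> (\<exists>N p. 0 < p \<and> (\<forall>n\<ge>N. s (n+p) = s n))"

text \<open>Sample point: omega (Inl (i,k)) = k-th interarrival time at queue i (k = 0,1,...),
  omega (Inr (i,k)) = service time of the k-th job served at queue i (k = 0,1,...).\<close>
type_synonym smp = "(3 \<times> nat) + (3 \<times> nat) \<Rightarrow> real"

definition exp_meas :: "real \<Rightarrow> real measure" where
  "exp_meas l = density lborel (exponential_density l)"

definition polling_space :: "(3 \<Rightarrow> real) \<Rightarrow> (3 \<Rightarrow> real measure) \<Rightarrow> smp measure" where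
  "polling_space lam D = (\<Pi>\<^sub>M x\<in>UNIV. (case x of Inl (i,k) \<Rightarrow> exp_meas (lam i) | Inr (i,k) \<Rightarrow> D i))"

definition service_law :: "real measure \<Rightarrow> real \<Rightarrow> bool" where
  "service_law D mu \<longleftrightarrow> prob_space D \<and> sets D = sets borel \<and> (AE x in D. 0 \<le> x) \<and>
     integrable D (\<lambda>x. x) \<and> integrable D (\<lambda>x. x^2) \<and> (\<integral>x. x \<partial>D) = 1 / mu"

definition arrival_time :: "smp \<Rightarrow> 3 \<Rightarrow> nat \<Rightarrow> real" where
  "arrival_time \<omega> i k = (\<Sum>l<k. \<omega> (Inl (i,l)))"   (* time of k-th arrival, k \<ge> 1 *)

definition arrivals :: "smp \<Rightarrow> 3 \<Rightarrow> real \<Rightarrow> nat" where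
  "arrivals \<omega> i t = card {k. 1 \<le> k \<and> arrival_time \<omega> i k \<le> t}"

definition service :: "smp \<Rightarrow> 3 \<Rightarrow> nat \<Rightarrow> real" where
  "service \<omega> i k = \<omega> (Inr (i,k))"

definition next_arrival :: "smp \<Rightarrow> 3 \<Rightarrow> real \<Rightarrow> real" where
  "next_arrival \<omega> i t = Inf {arrival_time \<omega> i k | k. 1 \<le> k \<and> t < arrival_time \<omega> i k}"

text \<open>Routing after emptying queue i with queue-length vector xi (xi i = 0, xi nonzero):
  pi(xi/|xi|) is the (i+2)-coordinate of the normalised vector; ties resolved by tb.\<close>
definition route :: "(3 \<Rightarrow> real) \<Rightarrow> ((3 \<Rightarrow> nat) \<Rightarrow> 3 \<Rightarrow> bool) \<Rightarrow> 3 \<Rightarrow> (3 \<Rightarrow> nat) \<Rightarrow> 3" where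
  "route d tb i xi = (let x = real (xi (i+2)) / (\<Sum>l\<in>UNIV. real (xi l)) in
     if x < d i then i+1 else if x > d i then i+2 else (if tb xi i then i+1 else i+2))"

text \<open>One visit + switch. State (t, c, j): time t at which the server starts visiting queue j,
  c l = number of services completed so far at queue l. x0 = initial queue lengths.
  Returns (next state, side = queue just emptied, queue-length vector at the switching time).\<close>
definition polling_step :: "(3 \<Rightarrow> real) \<Rightarrow> ((3 \<Rightarrow> nat) \<Rightarrow> 3 \<Rightarrow> bool) \<Rightarrow> (3 \<Rightarrow> nat) \<Rightarrow> smp \<Rightarrow>
    real \<times> (3 \<Rightarrow> nat) \<times> 3 \<Rightarrow> (real \<times> (3 \<Rightarrow> nat) \<times> 3) \<times> 3 \<times> (3 \<Rightarrow> nat)" where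
  "polling_step d tb x0 \<omega> st = (case st of (t, c, j) \<Rightarrow>
     let T = (\<lambda>r. t + (\<Sum>l<r. service \<omega> j (c j + l)));
         r = (LEAST r. x0 j + arrivals \<omega> j (T r) \<le> c j + r);
         te = T r;
         c' = c(j := c j + r);
         qlen = (\<lambda>s i. x0 i + arrivals \<omega> i s - c' i);
         xi = qlen te
     in if (\<Sum>l\<in>UNIV. xi l) \<noteq> 0 then ((te, c', route d tb j xi), j, xi)
        else (let \<tau> = Min (range (\<lambda>i. next_arrival \<omega> i te));
                  i0 = (SOME i. next_arrival \<omega> i te = \<tau>)
              in ((\<tau>, c', i0), j, qlen \<tau>)))"

definition polling_state :: "(3 \<Rightarrow> real) \<Rightarrow> ((3 \<Rightarrow> nat) \<Rightarrow> 3 \<Rightarrow> bool) \<Rightarrow> (3 \<Rightarrow> nat) \<Rightarrow> 3 \<Rightarrow> smp \<Rightarrow>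
    nat \<Rightarrow> real \<times> (3 \<Rightarrow> nat) \<times> 3" where
  "polling_state d tb x0 j0 \<omega> n = ((\<lambda>p. fst (polling_step d tb x0 \<omega> p)) ^^ n) (0, (\<lambda>_. 0), j0)"

text \<open>n-th switching (n \<ge> 1); the value at n = 0 is irrelevant (equals that at n = 1).\<close>
definition switch_side :: "(3 \<Rightarrow> real) \<Rightarrow> ((3 \<Rightarrow> nat) \<Rightarrow> 3 \<Rightarrow> bool) \<Rightarrow> (3 \<Rightarrow> nat) \<Rightarrow> 3 \<Rightarrow> smp \<Rightarrow> nat \<Rightarrow> 3" where
  "switch_side d tb x0 j0 \<omega> n = fst (snd (polling_step d tb x0 \<omega> (polling_state d tb x0 j0 \<omega> (n - 1))))"

definition switch_xi :: "(3 \<Rightarrow> real) \<Rightarrow> ((3 \<Rightarrow> nat) \<Rightarrow> 3 \<Rightarrow> bool) \<Rightarrow> (3 \<Rightarrow> nat) \<Rightarrow> 3 \<Rightarrow> smp \<Rightarrow> nat \<Rightarrow> (3 \<Rightarrow> nat)" where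
  "switch_xi d tb x0 j0 \<omega> n = snd (snd (polling_step d tb x0 \<omega> (polling_state d tb x0 j0 \<omega> (n - 1))))"

definition zeta :: "(3 \<Rightarrow> real) \<Rightarrow> ((3 \<Rightarrow> nat) \<Rightarrow> 3 \<Rightarrow> bool) \<Rightarrow> (3 \<Rightarrow> nat) \<Rightarrow> 3 \<Rightarrow> smp \<Rightarrow> nat \<Rightarrow> real^3" where
  "zeta d tb x0 j0 \<omega> n = (\<chi> i. real (switch_xi d tb x0 j0 \<omega> n i) / (\<Sum>l\<in>UNIV. real (switch_xi d tb x0 j0 \<omega> n l)))"

end

(*
  With unit arrival rates, service rates 2, and x the coordinate on a side, serving the next queue
  acts by F x = (1 - x) / (2 - x) and serving the other one by B x = 1 / (1 + x).  With decision
  points 2/3 and 5/13 on sides 1 and 2, the forward cycle 1-2-3 is attracting.  There is a second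
  trapping region whose orbits return to side 3 by one of the loops 3-1-2-1-3 and 3-2-1-2-3.  The
  return map has two increasing branches with disjoint images, so it behaves like a rotation of the
  circle, and the decision point on side 3 can be chosen such that its rotation number is
  irrational; then no exact orbit has an eventually periodic word.

  On paths obeying the law of large numbers, the normalised queue lengths at switching times are a
  pseudo-orbit of the triangle process with errors tending to 0.  An eventually periodic side
  sequence would give, by compactness, an exact orbit with a periodic word, which the second region
  excludes.  A burst of arrivals during the first services starts the process near any prescribed
  point of its side, and the errors stay small from then on with positive probability.
*)
theory Submission
  imports Defs "HOL-Library.Discrete_Functions"
begin

section \<open>The triangle process\<close>

text \<open>The decision point on side 3 has no closed form: an orbit with a prescribed rotation
  word is built, and the point is read off from it. The obstacle is the behaviour at that point,
  where both branches are allowed. A limit of queue paths may hit it and continue either way, so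
  aperiodicity is proved for every choice, with orbits defined by weak inequalities, which survive
  limits. Only the frequency of R is compared: all these orbits share an irrational one, whereas a
  periodic word has a rational one. The load 3/2 makes the total queue length grow linearly, so
  deviations of order o(t) vanish after normalising. Two grades of control are needed. A fixed slope
  of 1/1000000 from the start keeps the path in its region; the margins are small because the
  forward cycle near 0.382 and the left loop at 0.385 must lie on different sides of 5/13.
  Arbitrarily small slopes, effective after a long time, make the errors tend to 0. Since
  \<open>measure\<close> is 0 on non-measurable sets, both events must also be shown to be
  measurable.\<close>

definition fwd :: "real \<Rightarrow> real" where "fwd x = (1 - x) / (2 - x)"
definition bwd :: "real \<Rightarrow> real" where "bwd x = 1 / (1 + x)"
text \<open>The Moebius maps of the two loops: \<open>left_return\<close> is BBFF and
  \<open>right_return\<close> is FFBB. The reflection x -> 1 - x exchanges them, and their images of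
  [0,1], 4/7..3/5 and 2/5..3/7, are separated by a gap.\<close>

definition left_return :: "real \<Rightarrow> real" where "left_return x = (4 - x) / (7 - 2 * x)"
definition right_return :: "real \<Rightarrow> real" where "right_return x = (2 + x) / (5 + 2 * x)"

lemma left_return_strict: "x < y \<Longrightarrow> y \<le> 1 \<Longrightarrow> left_return x < left_return y"
  unfolding left_return_def by (simp add: divide_simps) (simp add: algebra_simps)
lemma right_return_strict: "0 \<le> x \<Longrightarrow> x < y \<Longrightarrow> right_return x < right_return y"
  unfolding right_return_def by (simp add: divide_simps) (simp add: algebra_simps)
lemma left_return_mono: "x \<le> y \<Longrightarrow> y \<le> 1 \<Longrightarrow> left_return x \<le> left_return y"
  using left_return_strict[of x y] by (cases "x = y") auto
lemma right_return_mono: "0 \<le> x \<Longrightarrow> x \<le> y \<Longrightarrow> right_return x \<le> right_return y"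
  using right_return_strict[of x y] by (cases "x = y") auto
lemma left_return_range: "0 \<le> x \<Longrightarrow> x \<le> 1 \<Longrightarrow> 4/7 \<le> left_return x \<and> left_return x \<le> 3/5"
  unfolding left_return_def by (simp add: divide_simps)
lemma right_return_range: "0 \<le> x \<Longrightarrow> x \<le> 1 \<Longrightarrow> 2/5 \<le> right_return x \<and> right_return x \<le> 3/7"
  unfolding right_return_def by (simp add: divide_simps)

text \<open>The point whose past word is read off from \<open>b\<close>, \<open>b - a\<close>, \<open>b - 2 a\<close>, ... modulo 1: the
  symbol at \<open>c\<close> is R iff \<open>c \<ge> 1 - a\<close>, that is, iff its successor lies below \<open>a\<close>.\<close>
primrec coding :: "real \<Rightarrow> nat \<Rightarrow> real \<Rightarrow> real" where
  "coding a 0 b = 2/5"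
| "coding a (Suc n) b = (if b < a then right_return (coding a n (b + 1 - a)) else left_return (coding a n (b - a)))"

lemma coding_range: "2/5 \<le> coding a n b \<and> coding a n b \<le> 3/5"
proof (induction n arbitrary: b)
  case (Suc n)
  show ?case using Suc[of "b + 1 - a"] Suc[of "b - a"] left_return_range[of "coding a n (b - a)"]
      right_return_range[of "coding a n (b + 1 - a)"] by auto
qed simp

text \<open>Points below a are images under the right branch and all others under the left branch,
  whose image lies entirely higher. The gap settles b < a \<le> b'; within one branch the order is
  inherited from the predecessors.\<close>

lemma coding_mono: "b \<le> b' \<Longrightarrow> coding a n b \<le> coding a n b'"
proof (induction n arbitrary: b b')
  case (Suc n)
  note r = coding_range[of a n "b + 1 - a"] coding_range[of a n "b' + 1 - a"]
    coding_range[of a n "b - a"] coding_range[of a n "b' - a"]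
  consider "b' < a" | "b < a" "a \<le> b'" | "a \<le> b" using Suc.prems by linarith
  then show ?case
  proof cases
    case 1
    then show ?thesis using Suc.prems Suc.IH[of "b + 1 - a" "b' + 1 - a"] r
      by (auto intro!: right_return_mono)
  next
    case 2
    then show ?thesis using right_return_range[of "coding a n (b + 1 - a)"] left_return_range[of "coding a n (b' - a)"] r
      by auto
  next
    case 3
    then show ?thesis using Suc.prems Suc.IH[of "b - a" "b' - a"] r
      by (auto intro!: left_return_mono)
  qed
qed simp

text \<open>The recursion starts at 2/5, the lower end of the range, so one more application of the
  monotone branches can only raise the value. The approximants therefore increase to a
  limit.\<close>

lemma coding_Suc: "coding a n b \<le> coding a (Suc n) b"
proof (induction n arbitrary: b)
  case 0
  show ?case using left_return_range[of "2/5"] right_return_range[of "2/5"] by auto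
next
  case (Suc n)
  note r = coding_range[of a n "b + 1 - a"] coding_range[of a "Suc n" "b + 1 - a"]
    coding_range[of a n "b - a"] coding_range[of a "Suc n" "b - a"]
  show ?case
  proof (cases "b < a")
    case True
    have "right_return (coding a n (b + 1 - a)) \<le> right_return (coding a (Suc n) (b + 1 - a))"
      by (rule right_return_mono) (use r Suc[of "b + 1 - a"] in linarith)+
    then show ?thesis using True by (simp del: coding.simps add: coding.simps(2)[of a n b] coding.simps(2)[of a "Suc n" b])
  next
    case False
    have "left_return (coding a n (b - a)) \<le> left_return (coding a (Suc n) (b - a))"
      by (rule left_return_mono) (use r Suc[of "b - a"] in linarith)+
    then show ?thesis using False by (simp del: coding.simps add: coding.simps(2)[of a n b] coding.simps(2)[of a "Suc n" b])
  qed
qed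

definition coding_limit :: "real \<Rightarrow> real \<Rightarrow> real" where
  "coding_limit a b = lim (\<lambda>n. coding a n b)"

lemma coding_LIMSEQ: "(\<lambda>n. coding a n b) \<longlonglongrightarrow> coding_limit a b"
proof -
  have "Bseq (\<lambda>n. coding a n b)"
  proof (rule BseqI')
    show "norm (coding a n b) \<le> 1" for n using coding_range[of a n b] by simp
  qed
  moreover have "incseq (\<lambda>n. coding a n b)"
    using coding_Suc by (intro incseq_SucI) auto
  ultimately show ?thesis
    unfolding coding_limit_def by (simp add: Bseq_mono_convergent convergent_LIMSEQ_iff[symmetric] incseq_def)
qed

lemma coding_limit_range: "2/5 \<le> coding_limit a b \<and> coding_limit a b \<le> 3/5"
  using LIMSEQ_le_const[OF coding_LIMSEQ] LIMSEQ_le_const2[OF coding_LIMSEQ] coding_range by blast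

lemma coding_limit_mono: "b \<le> b' \<Longrightarrow> coding_limit a b \<le> coding_limit a b'"
  by (rule LIMSEQ_le[OF coding_LIMSEQ coding_LIMSEQ]) (auto intro: coding_mono)

text \<open>Continuity of the branches carries the recursion to the limit, so that the rotation by a
  on [0,1) is transported to the return map.\<close>

lemma coding_limit_step:
  "coding_limit a b = (if b < a then right_return (coding_limit a (b + 1 - a)) else left_return (coding_limit a (b - a)))"
proof -
  have "(\<lambda>n. right_return (coding a n (b + 1 - a))) \<longlonglongrightarrow> right_return (coding_limit a (b + 1 - a))"
    unfolding right_return_def using coding_limit_range[of a "b + 1 - a"] by (intro tendsto_intros coding_LIMSEQ) auto
  moreover have "(\<lambda>n. left_return (coding a n (b - a))) \<longlonglongrightarrow> left_return (coding_limit a (b - a))"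
    unfolding left_return_def using coding_limit_range[of a "b - a"] by (intro tendsto_intros coding_LIMSEQ) auto
  moreover have "(\<lambda>n. coding a (Suc n) b) \<longlonglongrightarrow> coding_limit a b"
    using LIMSEQ_Suc[OF coding_LIMSEQ] by simp
  ultimately show ?thesis
    by (auto split: if_splits intro: LIMSEQ_unique)
qed

section \<open>Orbits of the two-branch return map and their rotation number\<close>

definition cut_orbit :: "real \<Rightarrow> (nat \<Rightarrow> bool) \<Rightarrow> (nat \<Rightarrow> real) \<Rightarrow> bool" where
  "cut_orbit D r X \<longleftrightarrow> (\<forall>n. 0 \<le> X n \<and> X n \<le> 1 \<and>
     (if r n then D \<le> X n \<and> X (Suc n) = right_return (X n) else X n \<le> D \<and> X (Suc n) = left_return (X n)))"

definition right_count :: "(nat \<Rightarrow> bool) \<Rightarrow> nat \<Rightarrow> int" where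
  "right_count r n = (\<Sum>k<n. of_bool (r k))"

lemma right_count_simps [simp]: "right_count r 0 = 0"
  "right_count r (Suc n) = right_count r n + of_bool (r n)"
  by (simp_all add: right_count_def)

text \<open>X follows the fractional parts of n a, and r marks the steps at which adding a wraps
  past 1, so the number of R's is the number of wraps, the integer part of n a. D is the image of
  the wrapping point 1 - a; monotonicity of the coding then puts the R-points at or above D and the
  L-points at or below it.\<close>

lemma sturmian_cut:
  assumes a: "0 < a" "a < 1"
  obtains D r X where "2/5 \<le> D" "D \<le> 3/5" "cut_orbit D r X" "\<And>n. right_count r n = \<lfloor>real n * a\<rfloor>"
proof -
  define b where "b n = real n * a - real_of_int \<lfloor>real n * a\<rfloor>" for n
  define r where "r n \<longleftrightarrow> 1 - a \<le> b n" for n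
  define D where "D = coding_limit a (1 - a)"
  define X where "X n = coding_limit a (b n)" for n
  have b01: "0 \<le> b n" "b n < 1" for n unfolding b_def by linarith+
  have fl: "\<lfloor>real (Suc n) * a\<rfloor> = \<lfloor>real n * a\<rfloor> + of_bool (r n)" for n
  proof (cases "r n")
    case True
    have "\<lfloor>real (Suc n) * a\<rfloor> = \<lfloor>real n * a\<rfloor> + 1"
      using True a b01[of n] by (intro floor_unique) (auto simp: r_def b_def algebra_simps)
    then show ?thesis using True by simp
  next
    case False
    have "\<lfloor>real (Suc n) * a\<rfloor> = \<lfloor>real n * a\<rfloor>"
    proof (rule floor_unique)
      show "real_of_int \<lfloor>real n * a\<rfloor> \<le> real (Suc n) * a"
      proof -
        have "real (Suc n) * a = real n * a + a" by (simp add: algebra_simps)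
        then show ?thesis using a by linarith
      qed
      show "real (Suc n) * a < real_of_int \<lfloor>real n * a\<rfloor> + 1"
        using False by (simp add: r_def b_def algebra_simps)
    qed
    then show ?thesis using False by simp
  qed
  have bS: "b (Suc n) = b n + a - of_bool (r n)" for n
    using fl[of n] by (simp add: b_def algebra_simps)
  have X01: "2/5 \<le> X n \<and> X n \<le> 3/5" for n unfolding X_def by (rule coding_limit_range)
  have "cut_orbit D r X" unfolding cut_orbit_def
  proof (intro allI conjI)
    fix n
    show "0 \<le> X n" "X n \<le> 1" using X01[of n] by auto
    show "if r n then D \<le> X n \<and> X (Suc n) = right_return (X n) else X n \<le> D \<and> X (Suc n) = left_return (X n)"
    proof (cases "r n")
      case True
      then have "b (Suc n) < a" "b (Suc n) + 1 - a = b n" using bS[of n] b01[of n] by auto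
      then have "X (Suc n) = right_return (X n)" unfolding X_def by (subst coding_limit_step) simp
      then show ?thesis using True by (auto simp: D_def X_def r_def intro: coding_limit_mono)
    next
      case False
      then have "\<not> b (Suc n) < a" "b (Suc n) - a = b n" using bS[of n] b01[of n] by auto
      then have "X (Suc n) = left_return (X n)" unfolding X_def by (subst coding_limit_step) simp
      then show ?thesis using False by (auto simp: D_def X_def r_def intro: coding_limit_mono)
    qed
  qed
  moreover have "right_count r n = \<lfloor>real n * a\<rfloor>" for n
    by (induction n) (auto simp: fl simp del: of_nat_Suc)
  ultimately show ?thesis using coding_limit_range[of a "1 - a"] that[of D r X] by (auto simp: D_def)
qed

text \<open>The strict inequalities make the invariant survive a visit to \<open>D\<close>, where both branches are
  allowed.\<close>
lemma right_count_close:
  assumes "cut_orbit D r X" "cut_orbit D q Y"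
  shows "right_count r n = right_count q n \<or>
     (right_count r n = right_count q n + 1 \<and> X n < Y n) \<or>
     (right_count q n = right_count r n + 1 \<and> Y n < X n)"
proof (induction n)
  case (Suc n)
  have X: "0 \<le> X n" "X n \<le> 1" "r n \<Longrightarrow> D \<le> X n \<and> X (Suc n) = right_return (X n)"
     "\<not> r n \<Longrightarrow> X n \<le> D \<and> X (Suc n) = left_return (X n)"
    and Y: "0 \<le> Y n" "Y n \<le> 1" "q n \<Longrightarrow> D \<le> Y n \<and> Y (Suc n) = right_return (Y n)"
     "\<not> q n \<Longrightarrow> Y n \<le> D \<and> Y (Suc n) = left_return (Y n)"
    using assms unfolding cut_orbit_def by metis+
  \<comment> \<open>Images of R lie below images of L, so from equal counts differing letters give
    the stated strict order. If r is ahead and X n < Y n, an R for r with an L for q would mean D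
    \<le> X n < Y n \<le> D, so the difference never reaches 2; the opposite pair levels the counts,
    and equal letters preserve the order.\<close>
  have lt: "right_return u < left_return v" if "0 \<le> u" "u \<le> 1" "0 \<le> v" "v \<le> 1" for u v
    using right_return_range[OF that(1,2)] left_return_range[OF that(3,4)] by linarith
  show ?case
    using Suc X Y left_return_strict[of "X n" "Y n"] left_return_strict[of "Y n" "X n"]
      right_return_strict[of "X n" "Y n"] right_return_strict[of "Y n" "X n"] lt[of "X n" "Y n"] lt[of "Y n" "X n"]
    by (cases "r n"; cases "q n") auto
qed simp

lemma right_count_periodic:
  assumes "\<And>n. q (n + p) = q n"
  shows "right_count q (n * p) = int n * right_count q p"
proof -
  have "right_count q (m + p) = right_count q m + right_count q p" for m
  proof (induction m)
    case (Suc m)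
    then show ?case using assms[of m] by (simp add: add.commute[of m p])
  qed simp
  then have "right_count q (n * p + p) = right_count q (n * p) + right_count q p" for n .
  then show ?thesis by (induction n) (simp_all add: algebra_simps)
qed

text \<open>With c letters R per period, n periods contain n c of them, within 1 of the integer part
  of n p a. Dividing by n gives a = c / p in the limit.\<close>

lemma irrational_cut_not_periodic:
  assumes X: "cut_orbit D r X" "\<And>n. right_count r n = \<lfloor>real n * a\<rfloor>" and a: "a \<notin> \<rat>"
    and Y: "cut_orbit D q Y" and p: "0 < p" "\<And>n. q (n + p) = q n"
  shows False
proof -
  define c where "c = right_count q p"
  have "\<bar>real_of_int c - real p * a\<bar> \<le> 2 / real n" if "0 < n" for n :: nat
  proof -
    have "right_count q (n * p) = int n * c" using right_count_periodic[of q p n, OF p(2)] by (simp add: c_def)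
    then have "\<bar>int n * c - \<lfloor>real (n * p) * a\<rfloor>\<bar> \<le> 1"
      using right_count_close[OF X(1) Y, of "n * p"] X(2)[of "n * p"] by auto
    moreover have "real_of_int (int n * c) = real n * c" by simp
    ultimately have "\<bar>real n * c - real (n * p) * a\<bar> \<le> 2" by linarith
    then have "real n * \<bar>real_of_int c - real p * a\<bar> \<le> 2"
      by (simp add: abs_mult[symmetric, of "real n", simplified] algebra_simps)
    then show ?thesis using that by (simp add: field_simps)
  qed
  then have "\<bar>real_of_int c - real p * a\<bar> \<le> 0"
    by (intro LIMSEQ_le_const[OF lim_const_over_n[of 2]]) (auto intro!: exI[of _ 1])
  then have "a = real_of_int c / real p" using p by (simp add: field_simps)
  then show False using a by auto
qed

lemma aperiodic_cut_exists:
  obtains D where "2/5 \<le> D" "D \<le> 3/5"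
    "\<And>q Y p. cut_orbit D q Y \<Longrightarrow> 0 < p \<Longrightarrow> (\<And>n. q (n + p) = q n) \<Longrightarrow> False"
proof -
  have "\<not> {0<..<1::real} \<subseteq> \<rat>"
    using countable_subset[OF _ countable_rat, of "{0<..<1::real}"] uncountable_open_interval[of 0 1] by auto
  then obtain a :: real where a: "0 < a" "a < 1" "a \<notin> \<rat>"
    unfolding subset_iff greaterThanLessThan_iff by blast
  obtain D r X where "2/5 \<le> D" "D \<le> 3/5" "cut_orbit D r X" "\<And>n. right_count r n = \<lfloor>real n * a\<rfloor>"
    using sturmian_cut[OF a(1,2)] by blast
  then show thesis using irrational_cut_not_periodic[OF _ _ a(3)] that by metis
qed

section \<open>Pseudo-orbits in side coordinates\<close>

definition tracks :: "(3 \<Rightarrow> real) \<Rightarrow> (nat \<Rightarrow> real) \<Rightarrow> (nat \<Rightarrow> 3) \<Rightarrow> (nat \<Rightarrow> real) \<Rightarrow> bool" where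
  "tracks d e s x \<longleftrightarrow> (\<forall>n.
     (s (Suc n) = s n + 1 \<and> x n \<le> d (s n) \<and> \<bar>x (Suc n) - fwd (x n)\<bar> \<le> e n) \<or>
     (s (Suc n) = s n + 2 \<and> d (s n) \<le> x n \<and> \<bar>x (Suc n) - bwd (x n)\<bar> \<le> e n))"

text \<open>On side 1, 2/3 separates positions up to 0.6165, from which the loops go on to side 2,
  from those above 0.705, which return to side 3. On side 2, 5/13 lies between the forward cycle, at
  most 0.383, and the left loop, at least 0.385. All three values exceed 0.383, so the forward cycle
  never turns back.\<close>

definition thresholds :: "real \<Rightarrow> 3 \<Rightarrow> real" where
  "thresholds D i = (if i = 1 then 2/3 else if i = 2 then 5/13 else D)"

lemma fwd_anti: "a \<le> x \<Longrightarrow> x \<le> 1 \<Longrightarrow> fwd x \<le> fwd a"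
  unfolding fwd_def by (simp add: divide_simps) (simp add: algebra_simps)
lemma bwd_anti: "0 \<le> a \<Longrightarrow> a \<le> x \<Longrightarrow> bwd x \<le> bwd a"
  unfolding bwd_def by (simp add: divide_simps)

lemma fwd_diff: "x \<le> 1 \<Longrightarrow> y \<le> 1 \<Longrightarrow> fwd x - fwd y = (y - x) / ((2 - x) * (2 - y))"
  unfolding fwd_def by (simp add: divide_simps) (simp add: algebra_simps)

text \<open>Lipschitz constant 1 lets the errors of the four steps of a loop simply add up.\<close>

lemma fwd_lip: assumes "0 \<le> x" "x \<le> 1" "0 \<le> y" "y \<le> 1" shows "\<bar>fwd x - fwd y\<bar> \<le> \<bar>x - y\<bar>"
proof -
  have "fwd x - fwd y = (y - x) / ((2 - x) * (2 - y))"
    using assms by (intro fwd_diff) auto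
  moreover have "1 \<le> (2 - x) * (2 - y)" using mult_mono[of 1 "2 - x" 1 "2 - y"] assms by simp
  ultimately show ?thesis
    using divide_left_mono[of 1 "(2 - x) * (2 - y)" "\<bar>y - x\<bar>"] by (simp add: abs_minus_commute)
qed
lemma bwd_lip: assumes "0 \<le> x" "x \<le> 1" "0 \<le> y" "y \<le> 1" shows "\<bar>bwd x - bwd y\<bar> \<le> \<bar>x - y\<bar>"
proof -
  have "bwd x - bwd y = (y - x) / ((1 + x) * (1 + y))"
    using assms unfolding bwd_def by (simp add: divide_simps)
  moreover have "1 \<le> (1 + x) * (1 + y)" using mult_mono[of 1 "1 + x" 1 "1 + y"] assms by simp
  ultimately show ?thesis
    using divide_left_mono[of 1 "(1 + x) * (1 + y)" "\<bar>y - x\<bar>"] by (simp add: abs_minus_commute)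
qed

lemma left_return_eq: "0 \<le> x \<Longrightarrow> x \<le> 1 \<Longrightarrow> bwd (bwd (fwd (fwd x))) = left_return x"
  unfolding left_return_def fwd_def bwd_def by (simp add: divide_simps)
lemma right_return_eq: "0 \<le> x \<Longrightarrow> x \<le> 1 \<Longrightarrow> fwd (fwd (bwd (bwd x))) = right_return x"
  unfolding right_return_def fwd_def bwd_def by (simp add: divide_simps)

lemma fwd_bounds:
  assumes "\<bar>y - fwd x\<bar> \<le> e" "e \<le> 1/2500" "a \<le> x" "x \<le> b" "b \<le> 1"
  shows "fwd b - 1/2500 \<le> y" "y \<le> fwd a + 1/2500"
  using assms fwd_anti[of a x] fwd_anti[of x b] by auto
lemma bwd_bounds:
  assumes "\<bar>y - bwd x\<bar> \<le> e" "e \<le> 1/2500" "a \<le> x" "x \<le> b" "0 \<le> a"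
  shows "bwd b - 1/2500 \<le> y" "y \<le> bwd a + 1/2500"
  using assms bwd_anti[of a x] bwd_anti[of x b] by auto

text \<open>The root in [0,1] of x^2 - 3 x + 1, the fixed point of \<open>fwd\<close>: the forward
  cycle meets every side at this position.\<close>

definition golden :: real where "golden = (3 - sqrt 5) / 2"

lemma golden_bounds: "381/1000 \<le> golden" "golden \<le> 383/1000"
proof -
  have "sqrt 5 \<le> 2238/1000" by (rule real_le_lsqrt) (simp_all add: power2_eq_square)
  moreover have "2234/1000 \<le> sqrt 5" by (rule real_le_rsqrt) (simp add: power2_eq_square)
  ultimately show "381/1000 \<le> golden" "golden \<le> 383/1000" by (simp_all add: golden_def)
qed

lemma fwd_golden: "fwd golden = golden"
  using golden_bounds unfolding fwd_def
  by (simp add: divide_simps) (simp add: golden_def field_simps)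

text \<open>Once the errors are below r/4, the map a -> a/2 + r/4 has the fixed point r/2, and the
  excess over it is halved at each step.\<close>

lemma tendsto_zero_of_half_contraction:
  fixes a e :: "nat \<Rightarrow> real"
  assumes a: "\<And>n. 0 \<le> a n" "\<And>n. a (Suc n) \<le> a n / 2 + e n" and e: "e \<longlonglongrightarrow> 0"
  shows "a \<longlonglongrightarrow> 0"
proof (rule LIMSEQ_I)
  fix r :: real assume r: "0 < r"
  obtain N where N: "\<And>n. N \<le> n \<Longrightarrow> \<bar>e n\<bar> < r / 4"
    using LIMSEQ_D[OF e, of "r/4"] r by auto
  have b: "a (N + k) \<le> a N / 2 ^ k + r / 2" for k
  proof (induction k)
    case (Suc k)
    have "a N / 2 ^ Suc k = a N / 2 ^ k / 2" by simp
    then show ?case using Suc a(2)[of "N + k"] N[of "N + k"] by simp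
  qed (use r in simp)
  have "(\<lambda>k. a N / 2 ^ k) \<longlonglongrightarrow> 0" by (rule LIMSEQ_divide_realpow_zero) simp
  then obtain K where K: "\<And>k. K \<le> k \<Longrightarrow> \<bar>a N / 2 ^ k\<bar> < r / 2"
    using r LIMSEQ_D[of "\<lambda>k. a N / 2 ^ k" 0 "r/2"] by auto
  have "norm (a n - 0) < r" if "N + K \<le> n" for n
  proof -
    have "N + (n - N) = n" "K \<le> n - N" using that by auto
    then have "a n \<le> a N / 2 ^ (n - N) + r / 2" "\<bar>a N / 2 ^ (n - N)\<bar> < r / 2"
      using b[of "n - N"] K by metis+
    then show ?thesis using a(1)[of n] unfolding real_norm_def by linarith
  qed
  then show "\<exists>no. \<forall>n\<ge>no. norm (a n - 0) < r" by blast
qed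

section \<open>Points on the sides of the triangle\<close>

lemma mod3_simps [simp]:
  fixes i :: 3
  shows "i + 1 \<noteq> i" "i + 2 \<noteq> i" "i + 1 \<noteq> i + 2" "i + 2 \<noteq> i + 1" "i \<noteq> i + 1" "i \<noteq> i + 2"
    "i + 1 + 1 = i + 2" "i + 1 + 2 = i" "i + 2 + 1 = i" "i + 2 + 2 = i + 1" "i + 3 = i"
  using exhaust_3[of i] by auto

lemma UNIV_3_cyclic: "(UNIV :: 3 set) = {i, i + 1, i + 2}"
  by (rule sym, rule card_subset_eq) simp_all

lemma sum_3_cyclic: "(\<Sum>l\<in>(UNIV::3 set). f l) = f i + f (i + 1) + (f (i + 2) :: 'a :: comm_monoid_add)"
  by (subst UNIV_3_cyclic[of i]) (simp add: add.assoc)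

lemma all_3_cyclic: "(\<forall>l::3. P l) \<longleftrightarrow> P i \<and> P (i + 1) \<and> P (i + 2)"
  using UNIV_3_cyclic[of i] by (metis (mono_tags) UNIV_I insert_iff empty_iff)

definition side_point :: "3 \<Rightarrow> real \<Rightarrow> real^3" where
  "side_point i x = (1 - x) *\<^sub>R axis (i + 1) 1 + x *\<^sub>R axis (i + 2) 1"

lemma side_point_nth [simp]:
  "side_point i x $ i = 0" "side_point i x $ (i + 1) = 1 - x" "side_point i x $ (i + 2) = x"
  by (simp_all add: side_point_def axis_def)

lemma side_point_A0i: "0 \<le> x \<Longrightarrow> x \<le> 1 \<Longrightarrow> side_point i x \<in> A0i i"
  unfolding A0i_def by (simp add: sum_3_cyclic[of _ i] all_3_cyclic[of _ i])

lemma fj_nth: "fj lam mu j z $ l = (if l = j then 0 else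
    ((mu j - lam j) * z $ l + lam l * z $ j) / ((mu j - lam j) + mu j * theta lam mu j * z $ j))"
proof -
  have "fj lam mu j z $ l = (\<Sum>i\<in>UNIV - {j}. if i = l then
    ((mu j - lam j) * z $ i + lam i * z $ j) / ((mu j - lam j) + mu j * theta lam mu j * z $ j) else 0)"
    unfolding fj_def sum_component by (rule sum.cong[OF refl]) (simp add: axis_def)
  then show ?thesis by simp
qed

lemma theta_unit_rates [simp]: "theta (\<lambda>_. 1) (\<lambda>_. 2) j = 1/2"
  by (simp add: theta_def)

text \<open>With these rates the map reads (z_i + z_j) / (1 + z_j), and the served coordinate of a
  point of side i is 1 - x.\<close>

lemma fj_side_point_fwd:
  assumes "0 \<le> x" "x \<le> 1"
  shows "fj (\<lambda>_. 1) (\<lambda>_. 2) (i + 1) (side_point i x) = side_point (i + 1) (fwd x)"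
proof -
  have "side_point (i + 1) (fwd x) $ i = fwd x" "side_point (i + 1) (fwd x) $ (i + 2) = 1 - fwd x"
    using side_point_nth(2,3)[of "i + 1" "fwd x"] by simp_all
  then show ?thesis
    using assms unfolding vec_eq_iff all_3_cyclic[of _ i] fj_nth
    by (simp add: fwd_def) (simp add: divide_simps)
qed

lemma forward_cycle_periodic_orbit:
  assumes "\<And>i. golden \<le> d i"
  shows "periodic_orbit (\<lambda>_. 1) (\<lambda>_. 2) d 3 (\<lambda>n. side_point (i + of_nat n) golden)"
proof -
  have step: "side_point (j + 1) golden \<in> phi (\<lambda>_. 1) (\<lambda>_. 2) d (side_point j golden)" for j
  proof -
    have "j + 1 \<in> rule_set d j (side_coord j (side_point j golden))"
      using assms[of j] by (auto simp: rule_set_def side_coord_def)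
    moreover have "side_point (j + 1) golden = fj (\<lambda>_. 1) (\<lambda>_. 2) (j + 1) (side_point j golden)"
      using fj_side_point_fwd[of golden j] golden_bounds fwd_golden by simp
    ultimately show ?thesis
      unfolding phi_def using side_point_A0i[of golden j] golden_bounds by auto
  qed
  have "side_point j golden \<in> A0" for j
    using side_point_A0i[of golden j] golden_bounds by (auto simp: A0_def)
  moreover have "side_point (i + of_nat (n + 1)) golden \<in> phi (\<lambda>_. 1) (\<lambda>_. 2) d (side_point (i + of_nat n) golden)" for n
    using step[of "i + of_nat n"] by (simp add: ac_simps)
  ultimately show ?thesis unfolding periodic_orbit_def
    using step[of i] by auto
qed

section \<open>The two trapping regions\<close>

locale cut_tracking =
  fixes D :: real and e s x
  assumes D: "2/5 \<le> D" "D \<le> 3/5"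
    and tr: "tracks (thresholds D) e s x"
    and e: "\<And>n. e n \<le> 1/2500"
begin

lemma step:
  "(s (Suc n) = s n + 1 \<and> x n \<le> thresholds D (s n) \<and> \<bar>x (Suc n) - fwd (x n)\<bar> \<le> e n) \<or>
   (s (Suc n) = s n + 2 \<and> thresholds D (s n) \<le> x n \<and> \<bar>x (Suc n) - bwd (x n)\<bar> \<le> e n)"
  using tr unfolding tracks_def by blast

text \<open>The intervals in the following lemmas are the images of one another under \<open>fwd\<close> and \<open>bwd\<close>,
  enlarged to absorb errors up to 1/2500.\<close>
lemma base_step:
  assumes "s n = 3" "41/100 \<le> x n" "x n \<le> 3/5"
  shows "(s (Suc n) = 1 \<and> 285/1000 \<le> x (Suc n) \<and> x (Suc n) \<le> 372/1000 \<and> x n \<le> D \<and> \<bar>x (Suc n) - fwd (x n)\<bar> \<le> e n)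
    \<or> (s (Suc n) = 2 \<and> 624/1000 \<le> x (Suc n) \<and> x (Suc n) \<le> 71/100 \<and> D \<le> x n \<and> \<bar>x (Suc n) - bwd (x n)\<bar> \<le> e n)"
  using step[of n] assms fwd_bounds[OF _ e, of "x (Suc n)" "x n" n "41/100" "3/5"]
    bwd_bounds[OF _ e, of "x (Suc n)" "x n" n "41/100" "3/5"]
  by (auto simp: thresholds_def fwd_def bwd_def)

lemma left1_step:
  assumes "s n = 1" "285/1000 \<le> x n" "x n \<le> 372/1000"
  shows "s (Suc n) = 2 \<and> 385/1000 \<le> x (Suc n) \<and> x (Suc n) \<le> 4175/10000 \<and> \<bar>x (Suc n) - fwd (x n)\<bar> \<le> e n"
  using step[of n] assms fwd_bounds[OF _ e, of "x (Suc n)" "x n" n "285/1000" "372/1000"]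
  by (auto simp: thresholds_def fwd_def bwd_def)

lemma left2_step:
  assumes "s n = 2" "385/1000 \<le> x n" "x n \<le> 4175/10000"
  shows "s (Suc n) = 1 \<and> 705/1000 \<le> x (Suc n) \<and> x (Suc n) \<le> 7225/10000 \<and> \<bar>x (Suc n) - bwd (x n)\<bar> \<le> e n"
  using step[of n] assms bwd_bounds[OF _ e, of "x (Suc n)" "x n" n "385/1000" "4175/10000"]
  by (auto simp: thresholds_def fwd_def bwd_def)

lemma left3_step:
  assumes "s n = 1" "705/1000 \<le> x n" "x n \<le> 7225/10000"
  shows "s (Suc n) = 3 \<and> 41/100 \<le> x (Suc n) \<and> x (Suc n) \<le> 3/5 \<and> \<bar>x (Suc n) - bwd (x n)\<bar> \<le> e n"
  using step[of n] assms bwd_bounds[OF _ e, of "x (Suc n)" "x n" n "705/1000" "7225/10000"]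
  by (auto simp: thresholds_def fwd_def bwd_def)

lemma right1_step:
  assumes "s n = 2" "624/1000 \<le> x n" "x n \<le> 71/100"
  shows "s (Suc n) = 1 \<and> 584/1000 \<le> x (Suc n) \<and> x (Suc n) \<le> 6165/10000 \<and> \<bar>x (Suc n) - bwd (x n)\<bar> \<le> e n"
  using step[of n] assms bwd_bounds[OF _ e, of "x (Suc n)" "x n" n "624/1000" "71/100"]
  by (auto simp: thresholds_def fwd_def bwd_def)

lemma right2_step:
  assumes "s n = 1" "584/1000 \<le> x n" "x n \<le> 6165/10000"
  shows "s (Suc n) = 2 \<and> 276/1000 \<le> x (Suc n) \<and> x (Suc n) \<le> 295/1000 \<and> \<bar>x (Suc n) - fwd (x n)\<bar> \<le> e n"
  using step[of n] assms fwd_bounds[OF _ e, of "x (Suc n)" "x n" n "584/1000" "6165/10000"]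
  by (auto simp: thresholds_def fwd_def bwd_def)

lemma right3_step:
  assumes "s n = 2" "276/1000 \<le> x n" "x n \<le> 295/1000"
  shows "s (Suc n) = 3 \<and> 41/100 \<le> x (Suc n) \<and> x (Suc n) \<le> 3/5 \<and> \<bar>x (Suc n) - fwd (x n)\<bar> \<le> e n"
  using step[of n] assms fwd_bounds[OF _ e, of "x (Suc n)" "x n" n "276/1000" "295/1000"]
  by (auto simp: thresholds_def fwd_def bwd_def)

text \<open>The side after leaving side 3 decides which loop is run, so the test s (n+1) = 2 names
  the branch. The 1-Lipschitz bounds accumulate the four step errors.\<close>

lemma return_step:
  assumes n: "s n = 3" "41/100 \<le> x n" "x n \<le> 3/5"
  shows "s (n+4) = 3 \<and> 41/100 \<le> x (n+4) \<and> x (n+4) \<le> 3/5 \<and>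
    (if s (n+1) = 2 then D \<le> x n \<and> \<bar>x (n+4) - right_return (x n)\<bar> \<le> e n + e (n+1) + e (n+2) + e (n+3)
     else x n \<le> D \<and> \<bar>x (n+4) - left_return (x n)\<bar> \<le> e n + e (n+1) + e (n+2) + e (n+3))"
proof -
  have f01: "0 \<le> fwd u \<and> fwd u \<le> 1" "0 \<le> bwd u \<and> bwd u \<le> 1" if "0 \<le> u" "u \<le> 1" for u
    using that by (auto simp: fwd_def bwd_def divide_simps)
  consider (L) "s (Suc n) = 1" "285/1000 \<le> x (Suc n)" "x (Suc n) \<le> 372/1000" "x n \<le> D" "\<bar>x (Suc n) - fwd (x n)\<bar> \<le> e n"
   | (R) "s (Suc n) = 2" "624/1000 \<le> x (Suc n)" "x (Suc n) \<le> 71/100" "D \<le> x n" "\<bar>x (Suc n) - bwd (x n)\<bar> \<le> e n"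
    using base_step[OF n] by blast
  then show ?thesis
  proof cases
    case L
    note 1 = left1_step[OF L(1,2,3)]
    note 2 = left2_step[of "Suc (Suc n)"]
    note 3 = left3_step[of "Suc (Suc (Suc n))"]
    define x1 x2 x3 x4 where "x1 = x (Suc n)" "x2 = x (Suc (Suc n))" "x3 = x (Suc (Suc (Suc n)))" "x4 = x (Suc (Suc (Suc (Suc n))))"
    note xd = x1_x2_x3_x4_def
    have "\<bar>x2 - fwd (fwd (x n))\<bar> \<le> e (Suc n) + e n"
      using fwd_lip[of x1 "fwd (x n)"] f01(1)[of "x n"] L 1 n by (auto simp: xd)
    moreover have "0 \<le> fwd (fwd (x n)) \<and> fwd (fwd (x n)) \<le> 1" using f01 n by auto
    ultimately have "\<bar>x3 - bwd (fwd (fwd (x n)))\<bar> \<le> e (Suc (Suc n)) + (e (Suc n) + e n)"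
      using bwd_lip[of x2 "fwd (fwd (x n))"] 1 2 by (auto simp: xd)
    moreover have "0 \<le> bwd (fwd (fwd (x n))) \<and> bwd (fwd (fwd (x n))) \<le> 1" using f01 n by auto
    ultimately have "\<bar>x4 - bwd (bwd (fwd (fwd (x n))))\<bar> \<le> e (Suc (Suc (Suc n))) + (e (Suc (Suc n)) + (e (Suc n) + e n))"
      using bwd_lip[of x3 "bwd (fwd (fwd (x n)))"] 1 2 3 by (auto simp: xd)
    then show ?thesis using L 1 2 3 n left_return_eq[of "x n"] by (auto simp: xd eval_nat_numeral)
  next
    case R
    note 1 = right1_step[OF R(1,2,3)]
    note 2 = right2_step[of "Suc (Suc n)"]
    note 3 = right3_step[of "Suc (Suc (Suc n))"]
    define x1 x2 x3 x4 where "x1 = x (Suc n)" "x2 = x (Suc (Suc n))" "x3 = x (Suc (Suc (Suc n)))" "x4 = x (Suc (Suc (Suc (Suc n))))"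
    note xd = x1_x2_x3_x4_def
    have "\<bar>x2 - bwd (bwd (x n))\<bar> \<le> e (Suc n) + e n"
      using bwd_lip[of x1 "bwd (x n)"] f01(2)[of "x n"] R 1 n by (auto simp: xd)
    moreover have "0 \<le> bwd (bwd (x n)) \<and> bwd (bwd (x n)) \<le> 1" using f01 n by auto
    ultimately have "\<bar>x3 - fwd (bwd (bwd (x n)))\<bar> \<le> e (Suc (Suc n)) + (e (Suc n) + e n)"
      using fwd_lip[of x2 "bwd (bwd (x n))"] 1 2 by (auto simp: xd)
    moreover have "0 \<le> fwd (bwd (bwd (x n))) \<and> fwd (bwd (bwd (x n))) \<le> 1" using f01 n by auto
    ultimately have "\<bar>x4 - fwd (fwd (bwd (bwd (x n))))\<bar> \<le> e (Suc (Suc (Suc n))) + (e (Suc (Suc n)) + (e (Suc n) + e n))"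
      using fwd_lip[of x3 "fwd (bwd (bwd (x n)))"] 1 2 3 by (auto simp: xd)
    then show ?thesis using R 1 2 3 n right_return_eq[of "x n"] by (auto simp: xd eval_nat_numeral)
  qed
qed

lemma returns_forever:
  assumes n: "s n = 3" "41/100 \<le> x n" "x n \<le> 3/5"
  shows "s (n + 4 * k) = 3 \<and> 41/100 \<le> x (n + 4 * k) \<and> x (n + 4 * k) \<le> 3/5"
proof (induction k)
  case (Suc k)
  then show ?case using return_step[of "n + 4 * k"] by (simp add: algebra_simps)
qed (use n in simp)

text \<open>Along a fixed word the limit points of the returns to side 3 form an exact orbit of the
  two-branch return map, with the same word.\<close>
lemma not_eventually_periodic:
  assumes e0: "e \<longlonglongrightarrow> 0" and n: "s n = 3" "41/100 \<le> x n" "x n \<le> 3/5"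
    and D_aper: "\<And>q Y p. cut_orbit D q Y \<Longrightarrow> 0 < p \<Longrightarrow> (\<And>n. q (n + p) = q n) \<Longrightarrow> False"
  shows "\<not> eventually_periodic s"
proof
  assume "eventually_periodic s"
  then obtain N p where p: "0 < p" and per: "\<And>k. N \<le> k \<Longrightarrow> s (k + p) = s k"
    unfolding eventually_periodic_def by blast
  \<comment> \<open>The shift by N moves every index into the periodic range of s. One letter is
    read per four switches, and shifts of s by multiples of 4 p make p a period of q as
    well.\<close>
  define y where "y k = x (n + 4 * (N + k))" for k
  define q where "q k \<longleftrightarrow> s (n + 4 * (N + k) + 1) = 2" for k
  define d where "d k = e (n + 4 * (N + k)) + e (n + 4 * (N + k) + 1) + e (n + 4 * (N + k) + 2) + e (n + 4 * (N + k) + 3)" for k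
  have perm: "s (k + j * p) = s k" if "N \<le> k" for k j
  proof (induction j)
    case (Suc j)
    have "s (k + j * p + p) = s (k + j * p)" using per[of "k + j * p"] that by simp
    then show ?case using Suc by (simp add: algebra_simps)
  qed simp
  have qper: "q (k + p * j) = q k" for k j
    using perm[of "n + 4 * (N + k) + 1" "4 * j"] by (simp add: q_def algebra_simps)
  have yb: "41/100 \<le> y k \<and> y k \<le> 3/5" for k
    unfolding y_def using returns_forever[OF n, of "N + k"] by blast
  have ystep: "if q k then D \<le> y k \<and> \<bar>y (Suc k) - right_return (y k)\<bar> \<le> d k
        else y k \<le> D \<and> \<bar>y (Suc k) - left_return (y k)\<bar> \<le> d k" for k
  proof -
    have "n + 4 * (N + Suc k) = n + 4 * (N + k) + 4" by simp
    then show ?thesis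
      using return_step[of "n + 4 * (N + k)"] returns_forever[OF n, of "N + k"]
      unfolding y_def q_def d_def by presburger
  qed
  have es: "(\<lambda>k. e (n + 4 * (N + k) + c)) \<longlonglongrightarrow> 0" for c
    using LIMSEQ_subseq_LIMSEQ[OF e0, of "\<lambda>k. n + 4 * (N + k) + c"] by (simp add: strict_mono_def o_def)
  have d0: "d \<longlonglongrightarrow> 0"
    using tendsto_add[OF tendsto_add[OF tendsto_add[OF es[of 0] es[of 1]] es[of 2]] es[of 3]]
    by (simp add: d_def[abs_def])
  \<comment> \<open>Returns whose number is a multiple of p all begin the same word. A limit point
    along them can be continued letter by letter, because q (p * f t + k) does not depend on
    t.\<close>
  have "\<forall>t. y (p * t) \<in> {41/100..3/5}" using yb by simp
  then obtain y0 f where y0: "41/100 \<le> y0" "y0 \<le> 3/5" and f: "strict_mono f" and lim0: "(\<lambda>t. y (p * f t)) \<longlonglongrightarrow> y0"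
    using seq_compactE[OF compact_imp_seq_compact[OF compact_Icc[of "41/100::real" "3/5"]], of "\<lambda>t. y (p * t)"]
    unfolding o_def atLeastAtMost_iff by blast
  define Y where "Y = rec_nat y0 (\<lambda>k v. if q k then right_return v else left_return v)"
  have YS: "Y (Suc k) = (if q k then right_return (Y k) else left_return (Y k))" and Y0: "Y 0 = y0" for k
    by (simp_all add: Y_def)
  have dk: "(\<lambda>t. d (p * f t + k)) \<longlonglongrightarrow> 0" for k
    using LIMSEQ_subseq_LIMSEQ[OF d0, of "\<lambda>t. p * f t + k"] f p by (simp add: strict_mono_def o_def)
  have lim: "(\<lambda>t. y (p * f t + k)) \<longlonglongrightarrow> Y k \<and> 0 \<le> Y k \<and> Y k \<le> 1" for k
  proof (induction k)
    case 0
    then show ?case using lim0 y0 Y0 by simp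
  next
    case (Suc k)
    define g where "g = (if q k then right_return else left_return)"
    have "g \<midarrow>Y k\<rightarrow> g (Y k)"
      unfolding g_def right_return_def[abs_def] left_return_def[abs_def] using Suc by (auto intro!: tendsto_intros)
    then have "isCont g (Y k)" by (simp add: isCont_def)
    then have "(\<lambda>t. g (y (p * f t + k))) \<longlonglongrightarrow> g (Y k)"
      using Suc isCont_tendsto_compose by blast
    moreover have "(\<lambda>t. y (p * f t + Suc k) - g (y (p * f t + k))) \<longlonglongrightarrow> 0"
    proof (rule Lim_null_comparison[OF _ dk[of k]])
      have qk: "q (p * f t + k) = q k" for t using qper[of k "f t"] by (simp add: add.commute)
      have "norm (y (p * f t + Suc k) - g (y (p * f t + k))) \<le> d (p * f t + k)" for t
        using ystep[of "p * f t + k"] qk[of t] by (auto simp: g_def split: if_splits)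
      then show "\<forall>\<^sub>F t in sequentially. norm (y (p * f t + Suc k) - g (y (p * f t + k))) \<le> d (p * f t + k)"
        by simp
    qed
    ultimately have "(\<lambda>t. y (p * f t + Suc k)) \<longlonglongrightarrow> g (Y k)"
      using tendsto_add by fastforce
    moreover have "0 \<le> g (Y k) \<and> g (Y k) \<le> 1"
      using Suc left_return_range[of "Y k"] right_return_range[of "Y k"] by (auto simp: g_def)
    ultimately show ?case by (simp add: YS g_def split: if_splits)
  qed
  \<comment> \<open>The limit may equal D with either letter; the weak inequalities of
    \<open>cut_orbit\<close> admit both.\<close>
  have side: "if q k then D \<le> Y k else Y k \<le> D" for k
  proof -
    have qk: "q (p * f t + k) = q k" for t using qper[of k "f t"] by (simp add: add.commute)
    have "if q k then D \<le> y (p * f t + k) else y (p * f t + k) \<le> D" for t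
      using ystep[of "p * f t + k"] qk[of t] by (auto split: if_splits)
    then show ?thesis using lim[of k]
      by (auto intro: LIMSEQ_le_const LIMSEQ_le_const2)
  qed
  have "cut_orbit D q Y"
    unfolding cut_orbit_def using lim side YS by auto
  moreover have "q (k + p) = q k" for k using qper[of k 1] by simp
  ultimately show False using D_aper p by blast
qed

text \<open>One interval for each side, since the side on which the process starts is prescribed.\<close>
definition in_cut_region :: "3 \<Rightarrow> real \<Rightarrow> bool" where
  "in_cut_region i z \<longleftrightarrow> (i = 3 \<and> 41/100 \<le> z \<and> z \<le> 3/5) \<or>
     (i = 1 \<and> 285/1000 \<le> z \<and> z \<le> 372/1000) \<or> (i = 2 \<and> 624/1000 \<le> z \<and> z \<le> 71/100)"

text \<open>The intervals on sides 1 and 2 are the first stops of the two loops, so three more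
  switches lead into the interval on side 3.\<close>

lemma cut_region_aperiodic:
  assumes e0: "e \<longlonglongrightarrow> 0" and n: "in_cut_region (s n) (x n)"
    and D_aper: "\<And>q Y p. cut_orbit D q Y \<Longrightarrow> 0 < p \<Longrightarrow> (\<And>n. q (n + p) = q n) \<Longrightarrow> False"
  shows "\<not> eventually_periodic s"
proof -
  obtain m where m: "s m = 3" "41/100 \<le> x m" "x m \<le> 3/5"
    using n unfolding in_cut_region_def
    using left1_step[of n] left2_step[of "Suc n"] left3_step[of "Suc (Suc n)"]
      right1_step[of n] right2_step[of "Suc n"] right3_step[of "Suc (Suc n)"] by blast
  show ?thesis by (rule not_eventually_periodic[OF e0 m D_aper])
qed

text \<open>All thresholds lie above 383/1000, and \<open>fwd\<close> maps the interval into itself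
  with room for the error, whatever the initial side.\<close>

lemma forward_region:
  assumes "381/1000 \<le> x 0" "x 0 \<le> 383/1000"
  shows "381/1000 \<le> x n \<and> x n \<le> 383/1000 \<and> s (Suc n) = s n + 1 \<and> \<bar>x (Suc n) - fwd (x n)\<bar> \<le> e n"
proof -
  have *: "s (Suc n) = s n + 1 \<and> \<bar>x (Suc n) - fwd (x n)\<bar> \<le> e n" if "x n \<le> 383/1000" for n
    using step[of n] that D by (auto simp: thresholds_def split: if_splits)
  have "381/1000 \<le> x n \<and> x n \<le> 383/1000"
  proof (induction n)
    case (Suc n)
    then show ?case using *[of n] fwd_bounds[OF _ e, of "x (Suc n)" "x n" n "381/1000" "383/1000"]
      by (auto simp: fwd_def)
  qed (use assms in simp)
  then show ?thesis using * by blast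
qed


end


text \<open>Near its fixed point \<open>fwd\<close> contracts by a factor of at most 1/2, so
  vanishing errors force convergence of the positions. The side advances by 1 at each switch, hence
  is constant along indices in one class modulo 3.\<close>

lemma (in cut_tracking) forward_region_converges:
  assumes x0: "381/1000 \<le> x 0" "x 0 \<le> 383/1000" and e0: "e \<longlonglongrightarrow> 0"
    and w: "\<And>n. w (n + c) = side_point (s n) (x n)"
  shows "\<exists>m u. periodic_orbit (\<lambda>_. 1) (\<lambda>_. 2) (thresholds D) m u \<and> converges_onto w m u"
proof -
  note fr = forward_region[OF x0]
  have s: "s n = s 0 + of_nat n" for n
  proof (induction n)
    case (Suc n)
    then show ?case using fr[of n] by (simp add: ac_simps)
  qed simp
  have "(\<lambda>n. \<bar>x n - golden\<bar>) \<longlonglongrightarrow> 0"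
  proof (rule tendsto_zero_of_half_contraction[OF _ _ e0])
    fix n
    have "fwd (x n) - golden = (golden - x n) / ((2 - x n) * (2 - golden))"
      using fwd_diff[of "x n" golden] fr[of n] golden_bounds fwd_golden by simp
    moreover have "2 \<le> (2 - x n) * (2 - golden)"
      using mult_mono[of "3/2" "2 - x n" "3/2" "2 - golden"] fr[of n] golden_bounds by simp
    ultimately have "\<bar>fwd (x n) - golden\<bar> \<le> \<bar>x n - golden\<bar> / 2"
      using divide_left_mono[of 2 "(2 - x n) * (2 - golden)" "\<bar>golden - x n\<bar>"]
      by (simp add: abs_minus_commute)
    then show "\<bar>x (Suc n) - golden\<bar> \<le> \<bar>x n - golden\<bar> / 2 + e n" using fr[of n] by linarith
  qed simp
  then have "(\<lambda>n. x n - golden) \<longlonglongrightarrow> 0" by (simp add: tendsto_rabs_zero_iff)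
  then have xg: "x \<longlonglongrightarrow> golden" using LIM_zero_cancel by blast
  define u where "u n = side_point (s 0 + 2 + of_nat n) golden" for n
  have "(\<lambda>t. dist1 (w (3 * t + n + (c + 2))) (u n)) \<longlonglongrightarrow> 0" for n
  proof -
    have eq: "w (3 * t + n + (c + 2)) = side_point (s 0 + 2 + of_nat n) (x (3 * t + n + 2))" for t
    proof -
      have "w (3 * t + n + (c + 2)) = side_point (s (3 * t + n + 2)) (x (3 * t + n + 2))"
        using w[of "3 * t + n + 2"] by (simp add: ac_simps)
      also have "s (3 * t + n + 2) = s 0 + 2 + of_nat n"
      proof -
        have "(3::3) = 0" by simp
        then have "of_nat t * (3::3) = 0" by (metis mult_zero_right)
        then show ?thesis by (subst s) (simp add: ac_simps)
      qed
      finally show ?thesis .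
    qed
    have "(\<lambda>t. x (3 * t + n + 2)) \<longlonglongrightarrow> golden"
      using LIMSEQ_subseq_LIMSEQ[OF xg, of "\<lambda>t. 3 * t + n + 2"] by (simp add: strict_mono_def o_def)
    then have "(\<lambda>t. norm (side_point (s 0 + 2 + of_nat n) (x (3 * t + n + 2)) - u n) / sqrt 2) \<longlonglongrightarrow>
        norm (side_point (s 0 + 2 + of_nat n) golden - u n) / sqrt 2"
      unfolding side_point_def by (intro tendsto_intros) auto
    then show ?thesis unfolding dist1_def eq by (simp add: u_def)
  qed
  then have "converges_onto w 3 u" unfolding converges_onto_def by blast
  moreover have "periodic_orbit (\<lambda>_. 1) (\<lambda>_. 2) (thresholds D) 3 u"
    unfolding u_def by (rule forward_cycle_periodic_orbit) (use D golden_bounds in \<open>auto simp: thresholds_def\<close>)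
  ultimately show ?thesis by blast
qed

section \<open>Sample paths under a law of large numbers\<close>

text \<open>Here u is one queue length and v the total. A deviation e of that queue disturbs the
  total as well, whence the same e in numerator and denominator. The bound 4 E \<le> v keeps the
  perturbed total above v/2.\<close>

lemma ratio_perturbation:
  fixes u v e f E :: real
  assumes "0 \<le> u" "u \<le> v" "0 < v" "\<bar>e\<bar> \<le> E" "\<bar>f\<bar> \<le> E" "4 * E \<le> v"
  shows "\<bar>(u + e) / (v + e + f) - u / v\<bar> \<le> 2 * E / v"
proof -
  have p: "v / 2 \<le> v + e + f" using assms by linarith
  have "(u + e) / (v + e + f) - u / v = (e * (v - u) - u * f) / (v * (v + e + f))"
    using assms p by (simp add: divide_simps) (simp add: algebra_simps)
  moreover have "\<bar>e * (v - u) - u * f\<bar> \<le> E * v"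
  proof -
    have "\<bar>e * (v - u)\<bar> \<le> E * (v - u)" "\<bar>u * f\<bar> \<le> u * E"
      using assms by (auto simp: abs_mult intro!: mult_mono)
    then show ?thesis by (simp add: algebra_simps)
  qed
  moreover have "0 \<le> E" using assms by linarith
  moreover have "v * (v / 2) \<le> v * (v + e + f)" using assms p by (intro mult_left_mono) auto
  ultimately have "\<bar>(u + e) / (v + e + f) - u / v\<bar> \<le> E * v / (v * (v / 2))"
    using assms p frac_le[of "E * v" "\<bar>e * (v - u) - u * f\<bar>" "v * (v / 2)" "v * (v + e + f)"]
    by (simp add: abs_mult)
  also have "\<dots> = 2 * E / v" using assms by simp
  finally show ?thesis .
qed

text \<open>The weak inequalities hide the tie-breaking by \<open>tb\<close>. The last conjuncts
  express the length of the queue visited next as a share of the total.\<close>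

lemma route_cases:
  assumes "xi i = 0" "0 < (\<Sum>l\<in>UNIV. real (xi l))"
  defines "x \<equiv> real (xi (i + 2)) / (\<Sum>l\<in>UNIV. real (xi l))"
  shows "(route d tb i xi = i + 1 \<and> x \<le> d i \<and> real (xi (i + 1)) = (1 - x) * (\<Sum>l\<in>UNIV. real (xi l))) \<or>
    (route d tb i xi = i + 2 \<and> d i \<le> x \<and> real (xi (i + 2)) = x * (\<Sum>l\<in>UNIV. real (xi l)))"
proof -
  have *: "real (xi (i + 1)) = (1 - x) * (\<Sum>l\<in>UNIV. real (xi l))" "real (xi (i + 2)) = x * (\<Sum>l\<in>UNIV. real (xi l))"
    using assms sum_3_cyclic[of "\<lambda>l. real (xi l)" i] by (auto simp: x_def field_simps)
  have "route d tb i xi = (if x < d i then i + 1 else if x > d i then i + 2 else if tb xi i then i + 1 else i + 2)"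
    by (simp add: route_def Let_def x_def)
  then show ?thesis using * by (simp split: if_splits)
qed

section \<open>Arrivals, services and visits on one sample path\<close>

locale polling_path =
  fixes \<omega> :: smp and d :: "3 \<Rightarrow> real" and tb :: "(3 \<Rightarrow> nat) \<Rightarrow> 3 \<Rightarrow> bool" and x0 :: "3 \<Rightarrow> nat"
  assumes interarrival_pos: "\<And>i k. 0 < \<omega> (Inl (i, k))"
    and service_nonneg: "\<And>i k. 0 \<le> \<omega> (Inr (i, k))"
    and arrival_unbounded: "\<And>i t. \<exists>k. t < arrival_time \<omega> i k"
begin

definition Q :: "3 \<Rightarrow> real \<Rightarrow> nat" where "Q i t = x0 i + arrivals \<omega> i t"
definition S :: "3 \<Rightarrow> nat \<Rightarrow> real" where "S i k = (\<Sum>l<k. service \<omega> i l)"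

lemma arrival_time_strict_mono: "strict_mono (arrival_time \<omega> i)"
  by (rule strict_monoI_Suc) (simp add: arrival_time_def interarrival_pos)

text \<open>Arrival times are strictly increasing and unbounded, so the counted set is a finite
  initial segment ending before m, the first index beyond t. The index 0 is covered because
  \<open>arrival_time\<close> is 0 there and t is nonnegative.\<close>

lemma arrival_time_le_iff:
  assumes "0 \<le> t" shows "arrival_time \<omega> i k \<le> t \<longleftrightarrow> k \<le> arrivals \<omega> i t"
proof -
  define m where "m = (LEAST k. t < arrival_time \<omega> i k)"
  have m: "t < arrival_time \<omega> i m" unfolding m_def by (rule LeastI_ex[OF arrival_unbounded])
  have "arrival_time \<omega> i 0 \<le> t" using assms by (simp add: arrival_time_def)
  then have m0: "0 < m" using m by (cases m) auto
  have iff: "arrival_time \<omega> i k \<le> t \<longleftrightarrow> k < m" for k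
  proof
    show "arrival_time \<omega> i k \<le> t \<Longrightarrow> k < m"
      using m arrival_time_strict_mono[of i] by (metis linorder_not_less order_trans strict_mono_less_eq)
    show "k < m \<Longrightarrow> arrival_time \<omega> i k \<le> t" unfolding m_def using not_less_Least by fastforce
  qed
  have "{k. 1 \<le> k \<and> arrival_time \<omega> i k \<le> t} = {1..<m}" unfolding iff by auto
  then have "arrivals \<omega> i t = m - 1" unfolding arrivals_def by simp
  then have "k \<le> arrivals \<omega> i t \<longleftrightarrow> k < m" using m0 by linarith
  then show ?thesis using iff[of k] by blast
qed

lemma arrivals_mono: "0 \<le> s \<Longrightarrow> s \<le> t \<Longrightarrow> arrivals \<omega> i s \<le> arrivals \<omega> i t"
  using arrival_time_le_iff[of s i "arrivals \<omega> i s"] arrival_time_le_iff[of t i "arrivals \<omega> i s"] by auto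

lemma Q_mono: "0 \<le> s \<Longrightarrow> s \<le> t \<Longrightarrow> Q i s \<le> Q i t"
  using arrivals_mono by (simp add: Q_def)

lemma S_mono: "k \<le> l \<Longrightarrow> S i k \<le> S i l"
  unfolding S_def by (rule sum_mono2) (auto simp: service_def service_nonneg)

lemma S_nonneg: "0 \<le> S i k" using S_mono[of 0 k i] by (simp add: S_def)

lemma sum_service: "(\<Sum>l<r. service \<omega> i (c + l)) = S i (c + r) - S i c"
  unfolding S_def by (induction r) (simp_all add: add.assoc[symmetric])

lemma arrivals_0: "arrivals \<omega> i 0 = 0"
  using arrival_time_le_iff[of 0 i "arrivals \<omega> i 0"] strict_mono_less_eq[OF arrival_time_strict_mono, of i _ 0]
  by (simp add: arrival_time_def)

text \<open>At the least r the completed jobs equal the jobs that have come: at the preceding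
  completion one was still waiting. Hence the truncated subtraction in xi loses nothing. The last
  clause describes the switch when the system is nonempty at the end of the visit.\<close>

lemma visit:
  assumes t: "0 \<le> t" and c: "\<And>i. c i \<le> Q i t" and ex: "\<exists>r. Q j (t + S j (c j + r) - S j (c j)) \<le> c j + r"
  obtains te c' xi where
    "t \<le> te" "c' j = Q j te" "\<And>i. i \<noteq> j \<Longrightarrow> c' i = c i" "\<And>i. c' i \<le> Q i te" "te = t + S j (c' j) - S j (c j)"
    "\<And>i. xi i = Q i te - c' i" "c j \<le> c' j" "c' j = c j \<Longrightarrow> Q j t = c j"
    "(\<Sum>l\<in>UNIV. xi l) \<noteq> 0 \<Longrightarrow> polling_step d tb x0 \<omega> (t, c, j) = ((te, c', route d tb j xi), j, xi)"
proof -
  define T where "T r = t + (S j (c j + r) - S j (c j))" for r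
  define r where "r = (LEAST r. Q j (T r) \<le> c j + r)"
  define c' where "c' = c(j := c j + r)"
  define xi where "xi i = Q i (T r) - c' i" for i
  have ex': "\<exists>r. Q j (T r) \<le> c j + r" using ex by (simp add: T_def algebra_simps)
  have r1: "Q j (T r) \<le> c j + r" unfolding r_def by (rule LeastI_ex[OF ex'])
  have Tt: "t \<le> T k" for k using S_mono[of "c j" "c j + k" j] by (simp add: T_def)
  have r2: "c j + r \<le> Q j (T r)"
  proof (cases r)
    case 0
    then show ?thesis using c[of j] Q_mono[OF t Tt[of 0], of j] by simp
  next
    case (Suc k)
    then have "\<not> Q j (T k) \<le> c j + k" using not_less_Least[of k "\<lambda>r. Q j (T r) \<le> c j + r"] by (simp add: r_def)
    moreover have "T k \<le> T r" using S_mono[of "c j + k" "c j + r" j] Suc by (simp add: T_def)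
    ultimately show ?thesis using Q_mono[of "T k" "T r" j] Tt[of k] t Suc by simp
  qed
  have step: "polling_step d tb x0 \<omega> (t, c, j) = (if (\<Sum>l\<in>UNIV. xi l) \<noteq> 0 then ((T r, c', route d tb j xi), j, xi)
     else (let \<tau> = Min (range (\<lambda>i. next_arrival \<omega> i (T r))) in
        ((\<tau>, c', SOME i. next_arrival \<omega> i (T r) = \<tau>), j, \<lambda>i. Q i \<tau> - c' i)))"
    unfolding polling_step_def Let_def sum_service T_def r_def c'_def xi_def[abs_def] Q_def by simp
  show thesis
  proof (rule that[of "T r" c' xi])
    show "c' i \<le> Q i (T r)" for i
      using c[of i] Q_mono[OF t Tt[of r], of i] r1 r2 by (auto simp: c'_def)
    show "c' j = c j \<Longrightarrow> Q j t = c j"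
      using c[of j] r1 r2 by (simp add: c'_def T_def)
    show "(\<Sum>l\<in>UNIV. xi l) \<noteq> 0 \<Longrightarrow>
        polling_step d tb x0 \<omega> (t, c, j) = ((T r, c', route d tb j xi), j, xi)"
      unfolding step by (rule if_P)
  qed (use Tt r1 r2 in \<open>auto simp: xi_def c'_def T_def\<close>)
qed

text \<open>The number a i is the size of the initial burst at queue i. Arrivals are compared with
  the fluid path a i + s only from time 1/4 on, when the bursts are over. The constant N absorbs
  bounded deviations; a smaller \<epsilon> will require a larger constant.\<close>

definition control :: "(3 \<Rightarrow> real) \<Rightarrow> real \<Rightarrow> real \<Rightarrow> bool" where
  "control a \<epsilon> N \<longleftrightarrow> (\<forall>i s. 1/4 \<le> s \<longrightarrow> \<bar>real (Q i s) - a i - s\<bar> \<le> \<epsilon> * (s + N)) \<and>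
     (\<forall>i k. \<bar>S i k - real k / 2\<bar> \<le> \<epsilon> * (real k + N))"

end

section \<open>Fluid approximation of a visit\<close>

locale controlled_path = polling_path +
  fixes a :: "3 \<Rightarrow> real" and \<epsilon> N :: real
  assumes d: "\<And>i. 1/3 \<le> d i" "\<And>i. d i \<le> 2/3"
    and a: "\<And>i. 0 \<le> a i" "(\<Sum>i\<in>UNIV. a i) = N"
    and eps: "0 < \<epsilon>" "\<epsilon> \<le> 1 / 1000000" and N: "1 \<le> \<epsilon> * N"
    and ctl: "control a \<epsilon> N"
begin

lemma N_pos: "0 < N" using N eps by (metis mult_le_0_iff less_le_not_le linorder_not_le order_less_le_trans zero_less_one)

lemma a_le_N: "a i \<le> N"
  using a(1)[of i] a(1)[of "i+1"] a(1)[of "i+2"] a(2) sum_3_cyclic[of a i] by linarith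

lemma ctlQ: "1/4 \<le> s \<Longrightarrow> \<bar>real (Q i s) - a i - s\<bar> \<le> \<epsilon> * (s + N)"
  using ctl by (auto simp: control_def)
lemma ctlS: "\<bar>S i k - real k / 2\<bar> \<le> \<epsilon> * (real k + N)"
  using ctl by (auto simp: control_def)

lemma Q_le: assumes "1/4 \<le> s" shows "real (Q i s) \<le> 2 * s + 2 * N"
proof -
  have "\<epsilon> * (s + N) \<le> s + N" using eps N_pos assms mult_right_mono[of \<epsilon> 1 "s + N"] by auto
  then show ?thesis using ctlQ[OF assms, of i] a_le_N[of i] N_pos assms by linarith
qed

text \<open>A single queue has load 1/2: by the time of its (c + r)-th service, roughly at most t +
  (c + r)/2, about N + t + (c + r)/2 jobs have come at most. The chosen r makes this smaller than c
  + r despite the errors.\<close>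

lemma visit_ends:
  assumes t: "0 \<le> t" shows "\<exists>r. Q j (t + S j (c + r) - S j c) \<le> c + r"
proof -
  define r where "r = nat \<lceil>3 * (N + t + 1)\<rceil>"
  have r: "3 * (N + t + 1) \<le> real r" unfolding r_def by linarith
  define s where "s = t + 1 + 51/100 * (real c + real r) + N / 100"
  have "\<epsilon> * (real (c + r) + N) \<le> 1/100 * (real (c + r) + N)" using eps N_pos by (intro mult_right_mono) auto
  then have Ts: "t + S j (c + r) - S j c \<le> s"
    using ctlS[of j "c + r"] S_nonneg[of j c] unfolding s_def of_nat_add by argo
  have T0: "0 \<le> t + S j (c + r) - S j c" using S_mono[of c "c + r" j] t by simp
  have s4: "1/4 \<le> s" using t N_pos by (simp add: s_def)
  have "\<epsilon> * (s + N) \<le> 1/100 * (s + N)" using eps N_pos s4 by (intro mult_right_mono) auto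
  then have "real (Q j s) \<le> real (c + r)"
    using ctlQ[OF s4, of j] a_le_N[of j] r N_pos t of_nat_0_le_iff[of c, where ?'a = real]
    unfolding s_def of_nat_add by argo
  then have "Q j (t + S j (c + r) - S j c) \<le> c + r"
    using Q_mono[OF T0 Ts, of j] by linarith
  then show ?thesis by blast
qed

text \<open>The server completes at most about \<open>2 t\<close> services by time \<open>t\<close>, while about \<open>N + 3 t\<close> jobs
  arrive.\<close>
lemma backlog_lower:
  assumes t: "1/4 \<le> t" and c: "\<And>i. c i \<le> Q i t" and S: "(\<Sum>i\<in>UNIV. S i (c i)) \<le> t"
  shows "(t + N) / 2 \<le> (\<Sum>i\<in>UNIV. real (Q i t - c i))"
proof -
  have ineq: "real (c i) \<le> 2 * S i (c i) + 1/100 * (t + N)" for i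
  proof -
    have "real (c i) + N \<le> 3 * t + 3 * N" using c[of i] Q_le[OF t, of i] N_pos t by linarith
    then have "\<epsilon> * (real (c i) + N) \<le> 1 / 1000000 * (3 * t + 3 * N)"
      using eps N_pos t by (intro mult_mono) auto
    then show ?thesis using ctlS[of i "c i"] N_pos t by argo
  qed
  have e: "\<epsilon> * (t + N) \<le> 1/1000000 * (t + N)" using eps N_pos t by (intro mult_right_mono) auto
  have Q: "a i + t - 1/100 * (t + N) \<le> real (Q i t)" for i
    using ctlQ[OF t, of i] e N_pos t by argo
  have diff: "real (Q i t - c i) = real (Q i t) - real (c i)" for i using c[of i] by simp
  show ?thesis unfolding diff sum_3 using ineq[of 1] ineq[of 2] ineq[of 3] Q[of 1] Q[of 2] Q[of 3] S a(2) N_pos t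
    unfolding sum_3 by argo
qed

text \<open>With service rate 2 and arrival rate 1, a queue of length q empties in time about q, and
  meanwhile every queue receives about q jobs. The pair (\<delta>, M) is kept apart from
  (\<epsilon>, N): the latter gives the uniform error bound, small \<delta> the convergence to
  0.\<close>

lemma visit_estimate:
  assumes t: "1/4 \<le> t" "t \<le> te" and c: "c j \<le> Q j t" "c' j = Q j te" and te: "te = t + S j (c' j) - S j (c j)"
    and ctl': "control a \<delta> M" and M: "N \<le> M" and del: "0 < \<delta>" "\<delta> \<le> 1/100"
  shows "\<bar>te - t - (real (Q j t) - real (c j))\<bar> \<le> 56 * (\<delta> * (t + M))"
    "\<bar>real (Q l te) - real (Q l t) - (real (Q j t) - real (c j))\<bar> \<le> 64 * (\<delta> * (t + M))"
proof -
  have cQ: "1/4 \<le> s \<Longrightarrow> \<bar>real (Q i s) - a i - s\<bar> \<le> \<delta> * (s + M)" for i s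
    using ctl' by (auto simp: control_def)
  have cS: "\<bar>S i k - real k / 2\<bar> \<le> \<delta> * (real k + M)" for i k
    using ctl' by (auto simp: control_def)
  have M0: "0 < M" using M N_pos by linarith
  have te4: "1/4 \<le> te" using t by linarith
  have Ql: "real (Q i s) \<le> 2 * s + 2 * M" if "1/4 \<le> s" for i s
    using Q_le[OF that, of i] M by linarith
  define w where "w = \<delta> * (te + M)"
  define z where "z = \<delta> * (t + M)"
  have zw: "z \<le> w" unfolding z_def w_def using t del by (intro mult_left_mono) auto
  have z0: "0 \<le> z" unfolding z_def using t del M0 by auto
  have c1: "\<delta> * (real (c' j) + M) \<le> 3 * w"
  proof -
    have "real (c' j) + M \<le> 3 * te + 3 * M" using Ql[OF te4, of j] c te4 M0 by linarith
    then have "\<delta> * (real (c' j) + M) \<le> \<delta> * (3 * te + 3 * M)" using del by (intro mult_left_mono) auto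
    then show ?thesis by (simp add: w_def algebra_simps)
  qed
  have c2: "\<delta> * (real (c j) + M) \<le> 3 * z"
  proof -
    have "real (c j) + M \<le> 3 * t + 3 * M" using Ql[OF t(1), of j] c t M0 by linarith
    then have "\<delta> * (real (c j) + M) \<le> \<delta> * (3 * t + 3 * M)" using del by (intro mult_left_mono) auto
    then show ?thesis by (simp add: z_def algebra_simps)
  qed
  have Qd: "\<bar>real (Q i te) - real (Q i t) - (te - t)\<bar> \<le> w + z" for i
    using cQ[OF te4, of i] cQ[OF t(1), of i] unfolding w_def z_def by linarith
  \<comment> \<open>Replacing Q j te by Q j t + (te - t) turns the equation for te into (te - t)/2 =
    (Q j t - c j)/2 with error at most 7/2 (w + z).\<close>
  have main: "\<bar>te - t - (real (Q j t) - real (c j))\<bar> \<le> 7 * w + 7 * z"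
  proof -
    have "\<bar>S j (c' j) - real (Q j te) / 2\<bar> \<le> 3 * w" using order_trans[OF cS[of j "c' j"] c1] c(2) by simp
    moreover have "\<bar>S j (c j) - real (c j) / 2\<bar> \<le> 3 * z" by (rule order_trans[OF cS[of j "c j"] c2])
    ultimately show ?thesis using Qd[of j] te by linarith
  qed
  \<comment> \<open>One visit at most quadruples t + M, so errors measured at its end can be
    expressed at its start.\<close>
  have "te + M \<le> 4 * t + 4 * M"
  proof -
    have "w \<le> 1/100 * (te + M)" unfolding w_def using del te4 M0 by (intro mult_right_mono) auto
    then have "w \<le> te / 100 + M / 100" by simp
    then show ?thesis using main zw Ql[OF t(1), of j] t(1) M0 by linarith
  qed
  then have "w \<le> \<delta> * (4 * t + 4 * M)" unfolding w_def using del by (intro mult_left_mono) auto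
  then have w4: "w \<le> 4 * z" by (simp add: z_def algebra_simps)
  show "\<bar>te - t - (real (Q j t) - real (c j))\<bar> \<le> 56 * (\<delta> * (t + M))"
    using main w4 z0 unfolding z_def[symmetric] by linarith
  show "\<bar>real (Q l te) - real (Q l t) - (real (Q j t) - real (c j))\<bar> \<le> 64 * (\<delta> * (t + M))"
    using main w4 z0 Qd[of l] unfolding z_def[symmetric] by linarith
qed

end

context controlled_path begin

text \<open>The second alternative of \<open>late\<close> serves the very first visit: its first
  service runs past time 1/4, so the visit ends where \<open>control\<close> applies. There the
  backlog is positive, which rules out the branch in which the server waits.\<close>

lemma full_visit:
  assumes t: "0 \<le> t" and c: "\<And>i. c i \<le> Q i t" and S: "(\<Sum>i\<in>UNIV. S i (c i)) \<le> t"
    and late: "1/4 \<le> t \<or> (c j = 0 \<and> 1 \<le> Q j t \<and> 1/4 \<le> t + service \<omega> j 0)"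
  obtains te c' xi where
    "polling_step d tb x0 \<omega> (t, c, j) = ((te, c', route d tb j xi), j, xi)"
    "1/4 \<le> te" "t \<le> te" "c' j = Q j te" "\<And>i. i \<noteq> j \<Longrightarrow> c' i = c i" "\<And>i. c' i \<le> Q i te"
    "te = t + S j (c' j) - S j (c j)" "\<And>i. xi i = Q i te - c' i" "(\<Sum>i\<in>UNIV. S i (c' i)) \<le> te"
    "(te + N) / 2 \<le> (\<Sum>l\<in>UNIV. real (xi l))"
proof -
  show thesis
  proof (rule visit[of t c j, OF t c visit_ends[OF t]])
    fix te c' xi
    assume v: "t \<le> te" "c' j = Q j te" "\<And>i. i \<noteq> j \<Longrightarrow> c' i = c i" "\<And>i. c' i \<le> Q i te" "te = t + S j (c' j) - S j (c j)"
      "\<And>i. xi i = Q i te - c' i" "c j \<le> c' j" "c' j = c j \<Longrightarrow> Q j t = c j"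
      "(\<Sum>l\<in>UNIV. xi l) \<noteq> 0 \<Longrightarrow> polling_step d tb x0 \<omega> (t, c, j) = ((te, c', route d tb j xi), j, xi)"
    have te: "1/4 \<le> te"
    proof (cases "1/4 \<le> t")
      case False
      then have l: "c j = 0" "1 \<le> Q j t" "1/4 \<le> t + service \<omega> j 0" using late by auto
      then have "c' j \<noteq> 0" using v(8) by auto
      then have "S j 1 \<le> S j (c' j)" by (intro S_mono) simp
      then show ?thesis using v(5) l by (simp add: S_def)
    qed (use v in linarith)
    have "(\<Sum>i\<in>UNIV. S i (c' i)) = (\<Sum>i\<in>UNIV. S i (c i)) + S j (c' j) - S j (c j)"
      using sum_3_cyclic[of "\<lambda>i. S i (c' i)" j] sum_3_cyclic[of "\<lambda>i. S i (c i)" j] v(3) by simp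
    then have S': "(\<Sum>i\<in>UNIV. S i (c' i)) \<le> te" using S v(5) by simp
    have tot: "(te + N) / 2 \<le> (\<Sum>l\<in>UNIV. real (xi l))"
      using backlog_lower[OF te v(4) S'] by (simp add: v(6))
    moreover have "0 < (te + N) / 2" using te N_pos by simp
    ultimately have "(\<Sum>l\<in>UNIV. xi l) \<noteq> 0" unfolding of_nat_sum[symmetric] by linarith
    then show thesis by (rule that[OF v(9) te v(1-6) S' tot])
  qed
qed

end

section \<open>The pseudo-orbit carried by the queue lengths\<close>

locale started_path = controlled_path +
  fixes j0 j1 :: 3 and n1 :: nat and t1 :: real
  assumes start: "polling_state d tb x0 j0 \<omega> n1 = (t1, (\<lambda>_. 0), j1)"
    and t1: "0 \<le> t1" "t1 \<le> 1/4" "1 \<le> Q j1 t1" "1/4 \<le> t1 + service \<omega> j1 0"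
    and a_j1: "a j1 = 0"
begin

definition st where "st n = polling_state d tb x0 j0 \<omega> (n1 + n)"
definition tt where "tt n = fst (st n)"
definition cc where "cc n = fst (snd (st n))"
definition sd where "sd n = snd (snd (st n))"
definition xi where "xi n = snd (snd (polling_step d tb x0 \<omega> (st n)))"
definition total where "total n = (\<Sum>l\<in>UNIV. real (xi n l))"
definition xx where "xx n = real (xi n (sd n + 2)) / total n"
definition err where
  "err n = (if sd (Suc n) = sd n + 1 then \<bar>xx (Suc n) - fwd (xx n)\<bar> else \<bar>xx (Suc n) - bwd (xx n)\<bar>)"

lemma st_Suc: "st (Suc n) = fst (polling_step d tb x0 \<omega> (st n))"
  by (simp add: st_def polling_state_def)

lemma st_eq: "st n = (tt n, cc n, sd n)"
  by (simp add: tt_def cc_def sd_def)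

lemma init: "tt 0 = t1" "cc 0 = (\<lambda>_. 0)" "sd 0 = j1"
  by (simp_all add: tt_def cc_def sd_def st_def start)

text \<open>One conjunction, since the facts about a visit rest on the state left by the previous
  one. Only visit 0 may begin before time 1/4, which is why its case is treated separately.\<close>

lemma visit_n:
  "(\<forall>i. cc n i \<le> Q i (tt n)) \<and> (\<Sum>i\<in>UNIV. S i (cc n i)) \<le> tt n \<and> 0 \<le> tt n \<and> (0 < n \<longrightarrow> 1/4 \<le> tt n) \<and>
   polling_step d tb x0 \<omega> (st n) = ((tt (Suc n), cc (Suc n), route d tb (sd n) (xi n)), sd n, xi n) \<and>
   1/4 \<le> tt (Suc n) \<and> tt n \<le> tt (Suc n) \<and> cc (Suc n) (sd n) = Q (sd n) (tt (Suc n)) \<and>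
   (\<forall>i. i \<noteq> sd n \<longrightarrow> cc (Suc n) i = cc n i) \<and> (\<forall>i. cc (Suc n) i \<le> Q i (tt (Suc n))) \<and>
   tt (Suc n) = tt n + S (sd n) (cc (Suc n) (sd n)) - S (sd n) (cc n (sd n)) \<and>
   (\<forall>i. xi n i = Q i (tt (Suc n)) - cc (Suc n) i) \<and> (\<Sum>i\<in>UNIV. S i (cc (Suc n) i)) \<le> tt (Suc n) \<and>
   (tt (Suc n) + N) / 2 \<le> total n"
proof (induction n)
  case 0
  have c: "\<And>i. cc 0 i \<le> Q i (tt 0)" "(\<Sum>i\<in>UNIV. S i (cc 0 i)) \<le> tt 0" "0 \<le> tt 0"
    and late: "1/4 \<le> tt 0 \<or> (cc 0 (sd 0) = 0 \<and> 1 \<le> Q (sd 0) (tt 0) \<and> 1/4 \<le> tt 0 + service \<omega> (sd 0) 0)"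
    using t1 by (simp_all add: init S_def)
  show ?case
  proof (rule full_visit[OF c(3) c(1) c(2) late, folded st_eq])
  fix te c' x
  assume v: "polling_step d tb x0 \<omega> (st 0) = ((te, c', route d tb (sd 0) x), sd 0, x)"
    "1/4 \<le> te" "tt 0 \<le> te" "c' (sd 0) = Q (sd 0) te" "\<And>i. i \<noteq> sd 0 \<Longrightarrow> c' i = cc 0 i" "\<And>i. c' i \<le> Q i te"
    "te = tt 0 + S (sd 0) (c' (sd 0)) - S (sd 0) (cc 0 (sd 0))" "\<And>i. x i = Q i te - c' i" "(\<Sum>i\<in>UNIV. S i (c' i)) \<le> te"
    "(te + N) / 2 \<le> (\<Sum>l\<in>UNIV. real (x l))"
  have eqs: "tt (Suc 0) = te" "cc (Suc 0) = c'" "xi 0 = x"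
    using v(1) by (simp_all add: tt_def cc_def xi_def st_Suc)
  show ?case unfolding eqs total_def 
    by (intro conjI allI impI) (erule notE[OF less_irrefl] | rule v(5), assumption | rule c v)+
  qed
next
  case (Suc n)
  have c: "\<And>i. cc (Suc n) i \<le> Q i (tt (Suc n))" "(\<Sum>i\<in>UNIV. S i (cc (Suc n) i)) \<le> tt (Suc n)" "0 \<le> tt (Suc n)" "1/4 \<le> tt (Suc n)"
  proof -
    show "\<And>i. cc (Suc n) i \<le> Q i (tt (Suc n))" "(\<Sum>i\<in>UNIV. S i (cc (Suc n) i)) \<le> tt (Suc n)"
      and t: "1/4 \<le> tt (Suc n)" using Suc.IH by (elim conjE; blast)+
    then show "0 \<le> tt (Suc n)" by linarith
  qed
  show ?case
  proof (rule full_visit[OF c(3) c(1) c(2) disjI1[OF c(4)], where j = "sd (Suc n)", folded st_eq])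
  fix te c' x
  assume v: "polling_step d tb x0 \<omega> (st (Suc n)) = ((te, c', route d tb (sd (Suc n)) x), sd (Suc n), x)"
    "1/4 \<le> te" "tt (Suc n) \<le> te" "c' (sd (Suc n)) = Q (sd (Suc n)) te" "\<And>i. i \<noteq> sd (Suc n) \<Longrightarrow> c' i = cc (Suc n) i" "\<And>i. c' i \<le> Q i te"
    "te = tt (Suc n) + S (sd (Suc n)) (c' (sd (Suc n))) - S (sd (Suc n)) (cc (Suc n) (sd (Suc n)))" "\<And>i. x i = Q i te - c' i" "(\<Sum>i\<in>UNIV. S i (c' i)) \<le> te"
    "(te + N) / 2 \<le> (\<Sum>l\<in>UNIV. real (x l))"
  have eqs: "tt (Suc (Suc n)) = te" "cc (Suc (Suc n)) = c'" "xi (Suc n) = x"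
    using v(1) by (simp_all add: tt_def cc_def xi_def st_Suc)
  show ?case unfolding eqs total_def 
    by (intro conjI allI impI) (erule notE[OF less_irrefl] | rule v(5), assumption | rule c v)+
  qed
qed

lemma tt_late: "1/4 \<le> tt (Suc n)" and cc_le: "cc n i \<le> Q i (tt n)" and tt_mono: "tt n \<le> tt (Suc n)"
  and cc_side: "cc (Suc n) (sd n) = Q (sd n) (tt (Suc n))" and cc_other: "i \<noteq> sd n \<Longrightarrow> cc (Suc n) i = cc n i"
  and tt_eq: "tt (Suc n) = tt n + S (sd n) (cc (Suc n) (sd n)) - S (sd n) (cc n (sd n))"
  and total_ge_half: "(tt (Suc n) + N) / 2 \<le> total n" and xi_nat: "xi n i = Q i (tt (Suc n)) - cc (Suc n) i"
  using visit_n[of n] by (elim conjE; blast)+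

lemma total_ge: "tt (Suc n) + N \<le> 2 * total n"
  using total_ge_half[of n] by simp

lemma xi_eq: "real (xi n i) = real (Q i (tt (Suc n))) - real (cc (Suc n) i)"
  unfolding xi_nat using cc_le[of "Suc n" i] by simp

lemma polling_step_st:
  "polling_step d tb x0 \<omega> (st n) = ((tt (Suc n), cc (Suc n), route d tb (sd n) (xi n)), sd n, xi n)"
  using visit_n[of n] by (elim conjE)

lemma sd_Suc: "sd (Suc n) = route d tb (sd n) (xi n)"
  using polling_step_st[of n] by (metis fst_conv snd_conv sd_def st_Suc)

lemma step_snd: "snd (polling_step d tb x0 \<omega> (st n)) = (sd n, xi n)"
  by (simp add: polling_step_st)

lemma xi_side: "xi n (sd n) = 0"
  by (simp add: xi_nat cc_side)

lemma total_pos: "0 < total n"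
  using total_ge[of n] tt_late[of n] N_pos by linarith

lemma total_eq: "total n = real (xi n (sd n + 1)) + real (xi n (sd n + 2))"
  unfolding total_def by (simp add: sum_3_cyclic[of _ "sd n"] xi_side)

lemma xi_xx: "real (xi n (sd n + 2)) = xx n * total n" "real (xi n (sd n + 1)) = (1 - xx n) * total n"
  using total_pos[of n] total_eq[of n] by (simp_all add: xx_def field_simps)

lemma xx_range: "0 \<le> xx n" "xx n \<le> 1"
  using total_pos[of n] total_eq[of n] by (simp_all add: xx_def)

lemma sd_cases:
  "(sd (Suc n) = sd n + 1 \<and> xx n \<le> d (sd n)) \<or> (sd (Suc n) = sd n + 2 \<and> d (sd n) \<le> xx n)"
  using route_cases[of "xi n" "sd n" d tb, OF xi_side] total_pos[of n] unfolding sd_Suc xx_def total_def by blast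

text \<open>Every other queue gains about the length of the queue served, which is the numerator z_i
  + z_j of the triangle map.\<close>

lemma queue_change:
  assumes "control a \<delta> M" "N \<le> M" "0 < \<delta>" "\<delta> \<le> 1/100" and l: "l \<noteq> sd (Suc n)"
  shows "\<bar>real (xi (Suc n) l) - (real (xi n l) + real (xi n (sd (Suc n))))\<bar> \<le> 64 * (\<delta> * (tt (Suc n) + M))"
  using visit_estimate(2)[where j = "sd (Suc n)" and c = "cc (Suc n)" and c' = "cc (Suc (Suc n))" and l = l,
      OF tt_late[of n] tt_mono[of "Suc n"] cc_le cc_side[of "Suc n"] tt_eq[of "Suc n"] assms(1-4)]
  unfolding xi_eq cc_other[of l "Suc n", OF l] by linarith

lemma step_error:
  assumes "control a \<delta> M" "N \<le> M" "0 < \<delta>" "\<delta> \<le> 1/100"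
    and Z_def: "Z = 64 * (\<delta> * (tt (Suc n) + M))" and Z: "4 * Z \<le> total n"
  shows "err n \<le> 2 * Z / total n"
proof -
  note ch = queue_change[of \<delta> M, OF assms(1-4), of _ n, folded Z_def]
  have Z0: "0 \<le> Z" unfolding Z_def using assms(2-4) tt_late[of n] N_pos by auto
  define i where "i = sd n"
  note xix = xi_xx[of n, folded i_def]
  have x01: "0 \<le> xx n" "xx n \<le> 1" by (rule xx_range)+
  have T: "0 < total n" by (rule total_pos)
  show ?thesis
  proof (cases "sd (Suc n) = i + 1")
    case True
    define e where "e = real (xi (Suc n) i) - real (xi n (i + 1))"
    define f where "f = real (xi (Suc n) (i + 2)) - (real (xi n (i + 2)) + real (xi n (i + 1)))"
    have ef: "\<bar>e\<bar> \<le> Z" "\<bar>f\<bar> \<le> Z" using ch[of i] ch[of "i + 2"] True xi_side[of n] by (simp_all add: e_def f_def i_def[symmetric])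
    \<comment> \<open>Serving the next queue transfers its share 1 - x to each of the other two, of
      shares 0 and x. The new total is 2 - x, and the ratio is \<open>fwd\<close> x.\<close>
    define u where "u = (1 - xx n) * total n"
    define v where "v = (2 - xx n) * total n"
    have uv: "0 \<le> u" "u \<le> v" "total n \<le> v" using x01 T by (simp_all add: u_def v_def algebra_simps mult_left_le)
    have "xx (Suc n) = (u + e) / (v + e + f)"
      unfolding xx_def total_eq True using True xix
      by (simp add: e_def f_def u_def v_def algebra_simps)
    then have "\<bar>xx (Suc n) - u / v\<bar> \<le> 2 * Z / v"
      using ratio_perturbation[of u v e Z f] uv T ef Z by simp
    moreover have "u / v = fwd (xx n)" using T x01 by (simp add: u_def v_def fwd_def)
    moreover have "2 * Z / v \<le> 2 * Z / total n" using uv T Z0 by (intro divide_left_mono) auto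
    ultimately show ?thesis using True by (simp add: err_def i_def)
  next
    case False
    then have s: "sd (Suc n) = i + 2" using sd_cases[of n] by (auto simp: i_def)
    define e where "e = real (xi (Suc n) (i + 1)) - (real (xi n (i + 1)) + real (xi n (i + 2)))"
    define f where "f = real (xi (Suc n) i) - real (xi n (i + 2))"
    have ef: "\<bar>e\<bar> \<le> Z" "\<bar>f\<bar> \<le> Z" using ch[of "i + 1"] ch[of i] s xi_side[of n] by (simp_all add: e_def f_def i_def[symmetric])
    define v where "v = (1 + xx n) * total n"
    have uv: "0 \<le> total n" "total n \<le> v" using x01 T by (simp_all add: v_def algebra_simps)
    have "xx (Suc n) = (total n + e) / (v + e + f)"
      unfolding xx_def[of "Suc n"] total_eq[of "Suc n"] s mod3_simps using s xix
      by (simp add: e_def f_def v_def algebra_simps)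
    then have "\<bar>xx (Suc n) - total n / v\<bar> \<le> 2 * Z / v"
      using ratio_perturbation[of "total n" v e Z f] uv T ef Z by simp
    moreover have "total n / v = bwd (xx n)" using T x01 by (simp add: v_def bwd_def)
    moreover have "2 * Z / v \<le> 2 * Z / total n" using uv T Z0 by (intro divide_left_mono) auto
    ultimately show ?thesis using False by (simp add: err_def i_def)
  qed
qed

lemma tracks_path: "tracks d err sd xx"
  unfolding tracks_def
proof
  fix n
  show "(sd (Suc n) = sd n + 1 \<and> xx n \<le> d (sd n) \<and> \<bar>xx (Suc n) - fwd (xx n)\<bar> \<le> err n) \<or>
    (sd (Suc n) = sd n + 2 \<and> d (sd n) \<le> xx n \<and> \<bar>xx (Suc n) - bwd (xx n)\<bar> \<le> err n)"
    using sd_cases[of n] by (elim disjE) (simp_all add: err_def)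
qed

text \<open>Slope 1/1000000 and t + N \<le> 2 \<open>total\<close> give the error 2 * 64 * 2 /
  1000000, below the 1/2500 that the trapping regions absorb.\<close>

lemma err_small: "err n \<le> 1/2500"
proof -
  have le: "tt (Suc n) + N \<le> 2 * total n" using total_ge[of n] by linarith
  have "\<epsilon> * (tt (Suc n) + N) \<le> 1/1000000 * (2 * total n)"
    using eps le tt_late[of n] N_pos by (intro mult_mono) auto
  then have Z: "64 * (\<epsilon> * (tt (Suc n) + N)) \<le> 128 / 1000000 * total n" by simp
  have "err n \<le> 2 * (64 * (\<epsilon> * (tt (Suc n) + N))) / total n"
    by (rule step_error[OF ctl _ _ _ refl]) (use eps Z total_pos[of n] in auto)
  also have "\<dots> \<le> 2 * (128 / 1000000 * total n) / total n"
    using Z total_pos[of n] by (intro divide_right_mono) auto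
  also have "\<dots> \<le> 1/2500" using total_pos[of n] by simp
  finally show ?thesis .
qed

text \<open>Thresholds in [1/3, 2/3] force the chosen queue to hold at least a third of the total,
  and its visit lasts about that long.\<close>

lemma tt_increment: "N / 10 \<le> tt (Suc (Suc n)) - tt (Suc n)"
proof -
  have est: "\<bar>tt (Suc (Suc n)) - tt (Suc n) - real (xi n (sd (Suc n)))\<bar> \<le> 56 * (\<epsilon> * (tt (Suc n) + N))"
    using visit_estimate(1)[where j = "sd (Suc n)" and c = "cc (Suc n)" and c' = "cc (Suc (Suc n))",
      OF tt_late[of n] tt_mono[of "Suc n"] cc_le cc_side[of "Suc n"] tt_eq[of "Suc n"] ctl] eps
    unfolding xi_eq by simp
  have "1/3 * total n \<le> real (xi n (sd (Suc n)))"
    using sd_cases[of n] xi_xx[of n] d(1)[of "sd n"] d(2)[of "sd n"] total_pos[of n]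
    by (auto intro!: mult_right_mono)
  moreover have "\<epsilon> * (tt (Suc n) + N) \<le> 1/1000000 * (tt (Suc n) + N)"
    using eps tt_late[of n] N_pos by (intro mult_right_mono) auto
  ultimately show ?thesis using est total_ge[of n] tt_late[of n] N_pos by argo
qed

lemma tt_ge: "real n * (N / 10) \<le> tt (Suc n)"
proof (induction n)
  case 0
  then show ?case using tt_late[of 0] by simp
next
  case (Suc n)
  then show ?case using tt_increment[of n] by (simp add: algebra_simps)
qed

text \<open>A slope \<delta> is paid for by a constant M, but once \<open>tt\<close> exceeds M this
  constant is dominated by the total queue length. What remains is at most 512 \<delta>, hence the
  choice r / 1024.\<close>

lemma err_tendsto_0:
  assumes asym: "\<And>\<delta>. 0 < \<delta> \<Longrightarrow> \<exists>M\<ge>N. control a \<delta> M"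
  shows "err \<longlonglongrightarrow> 0"
proof (rule LIMSEQ_I)
  fix r :: real assume r: "0 < r"
  define \<delta> where "\<delta> = min (1/1024) (r / 1024)"
  have del: "0 < \<delta>" "\<delta> \<le> 1/1024" "\<delta> \<le> r / 1024" using r by (auto simp: \<delta>_def)
  obtain M where M: "N \<le> M" "control a \<delta> M" using asym del(1) by blast
  obtain n0 where n0: "M < real n0 * (N / 10)" using reals_Archimedean3[of "N / 10"] N_pos by auto
  have "norm (err n - 0) < r" if n: "n0 \<le> n" for n
  proof -
    have "real n0 * (N / 10) \<le> real n * (N / 10)" using n N_pos by (intro mult_right_mono) auto
    then have tM: "M \<le> tt (Suc n)" using n0 tt_ge[of n] by linarith
    then have "tt (Suc n) + M \<le> 4 * total n" using total_ge[of n] N_pos by linarith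
    then have "\<delta> * (tt (Suc n) + M) \<le> \<delta> * (4 * total n)" using del by (intro mult_left_mono) auto
    then have Z: "64 * (\<delta> * (tt (Suc n) + M)) \<le> 256 * \<delta> * total n" by simp
    have "1024 * \<delta> * total n \<le> 1 * total n" using del total_pos[of n] by (intro mult_right_mono) auto
    then have "4 * (64 * (\<delta> * (tt (Suc n) + M))) \<le> total n" using Z by linarith
    then have "err n \<le> 2 * (64 * (\<delta> * (tt (Suc n) + M))) / total n"
      by (intro step_error[OF M(2,1) _ _ refl]) (use del in auto)
    also have "\<dots> \<le> 2 * (256 * \<delta> * total n) / total n"
      using Z total_pos[of n] by (intro divide_right_mono) auto
    also have "\<dots> < r" using total_pos[of n] del r by simp
    finally show ?thesis by (simp add: err_def)
  qed
  then show "\<exists>no. \<forall>n\<ge>no. norm (err n - 0) < r" by blast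
qed

text \<open>The burst leaves j1 out, so the first visit lasts at most 6 \<epsilon> N. At its end the
  other queues are still within 8 \<epsilon> N of their burst sizes, and the position is close to
  the prescribed ratio.\<close>

lemma initial_coordinate: "\<bar>xx 0 - a (j1 + 2) / N\<bar> \<le> 1/2500"
proof -
  define te where "te = tt (Suc 0)"
  define q where "q = real (Q j1 te)"
  have te4: "1/4 \<le> te" using tt_late[of 0] by (simp add: te_def)
  have cj: "cc (Suc 0) j1 = Q j1 te" using cc_side[of 0] by (simp add: init te_def)
  have te: "te = t1 + S j1 (Q j1 te)"
    using tt_eq[of 0] cj by (simp add: init te_def S_def)
  have E: "\<epsilon> * (te + N) \<le> te / 1000000 + \<epsilon> * N"
    using mult_right_mono[of \<epsilon> "1/1000000" te] eps te4 by (simp add: distrib_left)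
  have q: "q \<le> te + \<epsilon> * (te + N)" using ctlQ[OF te4, of j1] a_j1 by (simp add: q_def)
  have "\<bar>S j1 (Q j1 te) - q / 2\<bar> \<le> \<epsilon> * (q + N)" using ctlS[of j1 "Q j1 te"] by (simp add: q_def)
  moreover have "\<epsilon> * (q + N) \<le> q / 1000000 + \<epsilon> * N"
    using mult_right_mono[of \<epsilon> "1/1000000" q] eps by (simp add: distrib_left q_def)
  ultimately have te6: "te \<le> 6 * (\<epsilon> * N)"
    using te t1(2) q E N te4 by linarith
  define Z where "Z = 8 * (\<epsilon> * N)"
  have xi: "\<bar>real (xi 0 l) - a l\<bar> \<le> Z" if "l \<noteq> j1" for l
  proof -
    have "cc (Suc 0) l = 0" using cc_other[of l 0] that by (simp add: init)
    then have "real (xi 0 l) = real (Q l te)" using xi_eq[of 0 l] by (simp add: te_def)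
    then show ?thesis using ctlQ[OF te4, of l] E te6 te4 N unfolding Z_def by linarith
  qed
  have "\<epsilon> * N \<le> 1/1000000 * N" using eps N_pos by (intro mult_right_mono) auto
  then have Z4: "4 * Z \<le> N" using N_pos by (simp add: Z_def)
  define e where "e = real (xi 0 (j1 + 2)) - a (j1 + 2)"
  define f where "f = real (xi 0 (j1 + 1)) - a (j1 + 1)"
  have aN: "a (j1 + 1) + a (j1 + 2) = N" using a(2) a_j1 sum_3_cyclic[of a j1] by simp
  have "xx 0 = (a (j1 + 2) + e) / (N + e + f)"
    unfolding xx_def total_eq init aN[symmetric] by (simp add: e_def f_def algebra_simps)
  then have "\<bar>xx 0 - a (j1 + 2) / N\<bar> \<le> 2 * Z / N"
    using ratio_perturbation[of "a (j1 + 2)" N e Z f] a(1) a_le_N N_pos xi[of "j1 + 1"] xi[of "j1 + 2"] Z4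
    by (simp add: e_def f_def)
  also have "\<dots> \<le> 1/2500" using N_pos eps by (simp add: Z_def)
  finally show ?thesis .
qed

text \<open>Switch n is computed from state n - 1, whence the successor of n1.\<close>

lemma switch_side_eq: "switch_side d tb x0 j0 \<omega> (n + Suc n1) = sd n"
  unfolding switch_side_def using step_snd[of n] by (simp add: st_def add.commute)

lemma zeta_eq: "zeta d tb x0 j0 \<omega> (n + Suc n1) = side_point (sd n) (xx n)"
proof -
  have "switch_xi d tb x0 j0 \<omega> (n + Suc n1) = xi n"
    unfolding switch_xi_def using step_snd[of n] by (simp add: st_def add.commute)
  then have "zeta d tb x0 j0 \<omega> (n + Suc n1) $ l = real (xi n l) / total n" for l
    by (simp add: zeta_def total_def)
  then show ?thesis
    using total_pos[of n] xi_side[of n] xi_xx[of n]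
    by (simp add: vec_eq_iff all_3_cyclic[of _ "sd n"])
qed

end

section \<open>The start from an arbitrary initial state\<close>

definition first_served :: "(3 \<Rightarrow> real) \<Rightarrow> ((3 \<Rightarrow> nat) \<Rightarrow> 3 \<Rightarrow> bool) \<Rightarrow> (3 \<Rightarrow> nat) \<Rightarrow> 3 \<Rightarrow> 3" where
  "first_served d tb x0 j0 = (if x0 j0 \<noteq> 0 then j0 else if x0 = (\<lambda>_. 0) then 3 else route d tb j0 x0)"

context polling_path begin

lemma next_arrival_0: "next_arrival \<omega> i 0 = \<omega> (Inl (i, 0))"
  unfolding next_arrival_def
proof (rule cInf_eq_minimum)
  have V1: "arrival_time \<omega> i 1 = \<omega> (Inl (i, 0))" by (simp add: arrival_time_def)
  then show "\<omega> (Inl (i, 0)) \<in> {arrival_time \<omega> i k | k. 1 \<le> k \<and> 0 < arrival_time \<omega> i k}"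
    using interarrival_pos[of i 0] by (metis (mono_tags, lifting) mem_Collect_eq order_refl)
  show "\<omega> (Inl (i, 0)) \<le> y" if "y \<in> {arrival_time \<omega> i k | k. 1 \<le> k \<and> 0 < arrival_time \<omega> i k}" for y
    using that strict_mono_less_eq[OF arrival_time_strict_mono, of i 1] V1 by auto
qed

lemma empty_visit:
  assumes "x0 j0 = 0"
  shows "polling_step d tb x0 \<omega> (0, (\<lambda>_. 0), j0) =
    (if (\<Sum>l\<in>UNIV. x0 l) \<noteq> 0 then ((0, (\<lambda>_. 0), route d tb j0 x0), j0, x0)
     else (let \<tau> = Min (range (\<lambda>i. \<omega> (Inl (i, 0)))) in
       ((\<tau>, (\<lambda>_. 0), SOME i. \<omega> (Inl (i, 0)) = \<tau>), j0, \<lambda>i. Q i \<tau>)))"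
proof -
  have r0: "(LEAST r. x0 j0 + arrivals \<omega> j0 (0 + (\<Sum>l<r. service \<omega> j0 (0 + l))) \<le> 0 + r) = (0::nat)"
    by (rule Least_eq_0) (simp add: assms arrivals_0)
  have "(\<lambda>_. 0)(j0 := 0 + (0::nat)) = (\<lambda>_. 0)" by auto
  then show ?thesis
    unfolding polling_step_def Let_def prod.case r0 by (simp add: arrivals_0 next_arrival_0 Q_def)
qed

text \<open>If j0 holds jobs, its visit is the first real one and n1 is 0. Otherwise j0 is left at
  once and n1 is 1: the server goes to a nonempty queue, as thresholds strictly between 0 and 1
  prevent a move to an empty one, or in an empty system waits for the first arrival, which
  \<open>first\<close> places at j1.\<close>

lemma initial_start:
  assumes d: "\<And>i. 0 < d i" "\<And>i. d i < 1"
    and j1_def: "j1 = first_served d tb x0 j0"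
    and first: "\<omega> (Inl (j1, 0)) \<le> 1/16" "\<And>l. l \<noteq> j1 \<Longrightarrow> 1/16 < \<omega> (Inl (l, 0))"
  obtains n1 t1 where "polling_state d tb x0 j0 \<omega> n1 = (t1, (\<lambda>_. 0), j1)"
    "0 \<le> t1" "t1 \<le> 1/4" "1 \<le> Q j1 t1"
proof -
  consider "x0 j0 \<noteq> 0" | "x0 j0 = 0" "x0 \<noteq> (\<lambda>_. 0)" | "x0 = (\<lambda>_. 0)" by blast
  then show thesis
  proof cases
    case 1
    then show thesis using that[of 0 0] by (simp add: polling_state_def j1_def first_served_def Q_def)
  next
    case 2
    have tot: "(\<Sum>l\<in>UNIV. x0 l) \<noteq> 0" using 2 by auto
    then have "0 < (\<Sum>l\<in>UNIV. real (x0 l))" by (metis of_nat_0_less_iff of_nat_sum neq0_conv)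
    note rc = route_cases[OF 2(1) this, of d tb] this
    have j1: "j1 = route d tb j0 x0" using 2 by (simp add: j1_def first_served_def)
    have "0 < real (x0 j1)"
      using rc(1)
    proof (elim disjE conjE)
      assume "route d tb j0 x0 = j0 + 1" "real (x0 (j0 + 2)) / (\<Sum>l\<in>UNIV. real (x0 l)) \<le> d j0"
        "real (x0 (j0 + 1)) = (1 - real (x0 (j0 + 2)) / (\<Sum>l\<in>UNIV. real (x0 l))) * (\<Sum>l\<in>UNIV. real (x0 l))"
      then show ?thesis unfolding j1 using d(2)[of j0] rc(2) by (metis diff_gt_0_iff_gt mult_pos_pos order_le_less_trans)
    next
      assume "route d tb j0 x0 = j0 + 2" "d j0 \<le> real (x0 (j0 + 2)) / (\<Sum>l\<in>UNIV. real (x0 l))"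
        "real (x0 (j0 + 2)) = real (x0 (j0 + 2)) / (\<Sum>l\<in>UNIV. real (x0 l)) * (\<Sum>l\<in>UNIV. real (x0 l))"
      then show ?thesis unfolding j1 using d(1)[of j0] rc(2) by (metis mult_pos_pos order_less_le_trans)
    qed
    then have "1 \<le> Q j1 0" by (simp add: Q_def)
    moreover have "polling_state d tb x0 j0 \<omega> 1 = (0, (\<lambda>_. 0), j1)"
      using empty_visit[OF 2(1)] tot by (simp add: polling_state_def j1)
    ultimately show thesis using that[of 1 0] by simp
  next
    case 3
    then have z: "x0 j0 = 0" "(\<Sum>l\<in>UNIV. x0 l) = 0" by auto
    have less: "\<omega> (Inl (j1, 0)) < \<omega> (Inl (l, 0))" if "l \<noteq> j1" for l using first(1) first(2)[OF that] by linarith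
    have min: "Min (range (\<lambda>i. \<omega> (Inl (i, 0)))) = \<omega> (Inl (j1, 0))"
    proof (rule Min_eqI)
      fix y assume "y \<in> range (\<lambda>i. \<omega> (Inl (i, 0)))"
      then show "\<omega> (Inl (j1, 0)) \<le> y"
      proof -
        obtain i where "y = \<omega> (Inl (i, 0))" using \<open>y \<in> _\<close> by (rule imageE)
        then show ?thesis using less[of i] by (cases "i = j1") (simp_all add: less_imp_le)
      qed
    qed auto
    have "(SOME i. \<omega> (Inl (i, 0)) = \<omega> (Inl (j1, 0))) = j1"
      by (rule some_equality) (use less in \<open>force+\<close>)
    then have "polling_state d tb x0 j0 \<omega> 1 = (\<omega> (Inl (j1, 0)), (\<lambda>_. 0), j1)"
      using empty_visit[OF z(1)] z(2) min by (simp add: polling_state_def Let_def)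
    moreover have "1 \<le> arrivals \<omega> j1 (\<omega> (Inl (j1, 0)))"
      using arrival_time_le_iff[of "\<omega> (Inl (j1, 0))" j1 1] interarrival_pos[of j1 0]
      by (simp add: arrival_time_def)
    ultimately show thesis using that[of 1 "\<omega> (Inl (j1, 0))"] first(1) interarrival_pos[of j1 0]
      by (simp add: Q_def)
  qed
qed

lemma control_mono:
  assumes "control a \<delta> M" "\<delta> \<le> \<delta>'" "M \<le> M'" "0 \<le> M" "0 \<le> \<delta>"
  shows "control a \<delta>' M'"
proof -
  have "\<delta> * (s + M) \<le> \<delta>' * (s + M')" if "0 \<le> s" for s
    using assms that by (intro mult_mono) auto
  then show ?thesis using assms(1) unfolding control_def
    by (meson of_nat_0_le_iff order_trans zero_le_divide_1_iff zero_le_numeral)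
qed

text \<open>Linear bounds for the partial sums of interarrival times are inverted into bounds for
  arrival counts, at the price of doubling the slope. The bounded terms go into \<delta> M: the
  offsets K, the first service, whose size B is prescribed separately, and the deviation R of the
  burst from a.\<close>

lemma control_from_tails:
  fixes n :: "3 \<Rightarrow> nat"
  assumes head: "\<And>i. arrival_time \<omega> i (n i) \<le> 1/4" "\<And>i. \<omega> (Inr (i, 0)) \<le> B"
    and arr: "\<And>i k. \<bar>(\<Sum>l<k. \<omega> (Inl (i, n i + l))) - real k\<bar> \<le> \<delta> * real k + K"
    and srv: "\<And>i k. \<bar>(\<Sum>l<k. \<omega> (Inr (i, Suc l))) - real k / 2\<bar> \<le> \<delta> * real k + K"
    and off: "\<And>i. \<bar>real (x0 i + n i) - a i\<bar> \<le> R"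
    and del: "0 < \<delta>" "\<delta> \<le> 1/4" and M: "2 * K + B + R + 3 \<le> \<delta> * M"
  shows "control a (2 * \<delta>) M"
proof -
  have K0: "0 \<le> K" using arr[of 1 0] by simp
  have R0: "0 \<le> R" using off[of 1] by linarith
  have B0: "0 \<le> B" using head(2)[of 1] service_nonneg[of 1 0] by linarith
  have "\<bar>real (Q i s) - a i - s\<bar> \<le> (2 * \<delta>) * (s + M)" if s: "1/4 \<le> s" for i s
  proof -
    have s0: "0 \<le> s" using s by simp
    have "n i \<le> arrivals \<omega> i s" using arrival_time_le_iff[OF s0, of i "n i"] head(1)[of i] s by simp
    then obtain k where k: "arrivals \<omega> i s = n i + k" using le_Suc_ex by blast
    have V: "arrival_time \<omega> i (n i + k) = arrival_time \<omega> i (n i) + (\<Sum>l<k. \<omega> (Inl (i, n i + l)))" for k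
      unfolding arrival_time_def by (induction k) auto
    have V0: "0 \<le> arrival_time \<omega> i (n i)"
      unfolding arrival_time_def using interarrival_pos by (intro sum_nonneg) (simp add: less_imp_le)
    have "arrival_time \<omega> i (n i + k) \<le> s" using arrival_time_le_iff[OF s0, of i "n i + k"] k by simp
    then have up: "real k \<le> s + K + \<delta> * real k" using V[of k] V0 arr[of i k] by linarith
    have "\<not> arrival_time \<omega> i (n i + Suc k) \<le> s" using arrival_time_le_iff[OF s0, of i "n i + Suc k"] k by simp
    then have "s < 1/4 + real (Suc k) + \<delta> * real (Suc k) + K" using V[of "Suc k"] head(1)[of i] arr[of i "Suc k"] by linarith
    then have lo: "s < 5/4 + real k + \<delta> * real k + \<delta> + K" by (simp add: algebra_simps)
    have k1: "real k \<le> s + 2 * \<delta> * s + 2 * K"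
    proof -
      have "(1 - \<delta>) * real k \<le> s + K" using up by (simp add: algebra_simps)
      \<comment> \<open>For \<delta> \<le> 1/4 the factor 1 + 2 \<delta> compensates 1 -
        \<delta>.\<close>
      also have "s + K \<le> ((1 - \<delta>) * (1 + 2 * \<delta>)) * (s + K)"
      proof -
        have "\<delta> * \<delta> \<le> \<delta> * (1/4)" using del by (intro mult_left_mono) auto
        then have "1 \<le> (1 - \<delta>) * (1 + 2 * \<delta>)" using del by (simp add: algebra_simps)
        then show ?thesis using mult_right_mono[of 1 _ "s + K"] s0 K0 by simp
      qed
      finally have "(1 - \<delta>) * real k \<le> (1 - \<delta>) * ((1 + 2 * \<delta>) * (s + K))" by (simp add: mult.assoc)
      then have "real k \<le> (1 + 2 * \<delta>) * (s + K)" using del by simp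
      also have "\<dots> \<le> s + 2 * \<delta> * s + 2 * K"
        using mult_right_mono[of \<delta> "1/4" K] del K0 by (simp add: algebra_simps)
      finally show ?thesis .
    qed
    have "\<delta> * real k \<le> \<delta> * (s + 2 * \<delta> * s + 2 * K)" using k1 del by (intro mult_left_mono) auto
    also have "\<dots> \<le> \<delta> * s + \<delta> * (1/2 * s) + K"
    proof -
      have "2 * \<delta> * s \<le> 1/2 * s" using del s0 by (intro mult_right_mono) auto
      then have "\<delta> * (2 * \<delta> * s) \<le> \<delta> * (1/2 * s)" using del by (intro mult_left_mono) auto
      moreover have "\<delta> * (2 * K) \<le> K" using mult_right_mono[of \<delta> "1/4" K] del K0 by simp
      ultimately show ?thesis by (simp add: distrib_left)
    qed
    finally have dk: "\<delta> * real k \<le> \<delta> * s + \<delta> * (1/2 * s) + K" .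
    have "real (Q i s) - a i - s = (real (x0 i + n i) - a i) + (real k - s)" by (simp add: Q_def k)
    moreover have "0 \<le> \<delta> * s" using del s0 by simp
    ultimately have "\<bar>real (Q i s) - a i - s\<bar> \<le> R + 2 * (\<delta> * s) + 2 * K + 3"
      using k1 lo dk off[of i] del by (simp add: algebra_simps abs_le_iff)
    also have "\<dots> \<le> 2 * (\<delta> * s) + 2 * (\<delta> * M)" using M K0 R0 B0 by linarith
    finally show ?thesis by (simp add: algebra_simps)
  qed
  moreover have "\<bar>S i k - real k / 2\<bar> \<le> (2 * \<delta>) * (real k + M)" for i k
  proof (cases k)
    case 0
    moreover have "0 \<le> \<delta> * M" using M K0 R0 B0 by linarith
    ultimately show ?thesis by (simp add: S_def mult.commute)
  next
    case (Suc m)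
    have "S i k = \<omega> (Inr (i, 0)) + (\<Sum>l<m. \<omega> (Inr (i, Suc l)))"
      unfolding S_def Suc service_def by (rule sum.lessThan_Suc_shift)
    then have "\<bar>S i k - real k / 2\<bar> \<le> B + 1 + (\<delta> * real m + K)"
    proof -
      have "real k / 2 = real m / 2 + 1/2" by (simp add: Suc)
      then show ?thesis
        using \<open>S i k = _\<close> srv[of i m] head(2)[of i] service_nonneg[of i 0] by linarith
    qed
    moreover have "0 \<le> \<delta> * real m" using del by simp
    ultimately have "\<bar>S i k - real k / 2\<bar> \<le> 2 * (\<delta> * real m) + 2 * \<delta> + 2 * (\<delta> * M)"
      using M K0 R0 B0 del by linarith
    then show ?thesis by (simp add: Suc algebra_simps)
  qed
  ultimately show ?thesis unfolding control_def by blast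
qed

end

text \<open>The slope 1/2000000 is half the control constant 1/1000000 required by \<open>controlled_path\<close>.\<close>
definition tail_ok :: "real \<Rightarrow> real \<Rightarrow> (nat \<Rightarrow> real) \<Rightarrow> bool" where
  "tail_ok m K y \<longleftrightarrow> (\<forall>k. \<bar>(\<Sum>l<k. y l) - real k * m\<bar> \<le> 1/2000000 * real k + K) \<and>
     (\<lambda>k. (\<Sum>l<k. y l) / real k) \<longlonglongrightarrow> m"

text \<open>The finitely many deviations before the average settles are summed into K.\<close>

lemma linear_bound_of_average:
  fixes y :: "nat \<Rightarrow> real"
  assumes y: "(\<lambda>k. (\<Sum>l<k. y l) / real k) \<longlonglongrightarrow> m" and del: "0 < \<delta>"
  shows "\<exists>K. \<forall>k. \<bar>(\<Sum>l<k. y l) - real k * m\<bar> \<le> \<delta> * real k + K"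
proof -
  obtain n0 where n0: "\<And>k. n0 \<le> k \<Longrightarrow> \<bar>(\<Sum>l<k. y l) / real k - m\<bar> < \<delta>"
    using LIMSEQ_D[OF y del] by auto
  define K where "K = (\<Sum>k\<le>n0. \<bar>(\<Sum>l<k. y l) - real k * m\<bar>)"
  have "\<bar>(\<Sum>l<k. y l) - real k * m\<bar> \<le> \<delta> * real k + K" for k
  proof (cases "k \<le> n0")
    case True
    then have "\<bar>(\<Sum>l<k. y l) - real k * m\<bar> \<le> K"
      unfolding K_def by (intro member_le_sum) auto
    then show ?thesis using mult_nonneg_nonneg[of \<delta> "real k"] del by linarith
  next
    case False
    then have k: "0 < real k" by simp
    have "\<bar>(\<Sum>l<k. y l) - real k * m\<bar> = \<bar>(\<Sum>l<k. y l) / real k - m\<bar> * real k"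
    proof -
      have "(\<Sum>l<k. y l) - real k * m = ((\<Sum>l<k. y l) / real k - m) * real k" using k by (simp add: field_simps)
      then show ?thesis by (simp add: abs_mult)
    qed
    also have "\<dots> \<le> \<delta> * real k" using n0[of k] False k by (intro mult_right_mono) auto
    finally have "\<bar>(\<Sum>l<k. y l) - real k * m\<bar> \<le> \<delta> * real k" .
    moreover have "0 \<le> K" unfolding K_def by (intro sum_nonneg) simp
    ultimately show ?thesis by linarith
  qed
  then show ?thesis by blast
qed

text \<open>The hypotheses split into a head of finitely many coordinates, which produces the burst,
  and tails beyond it. The extra 1 in n i gives even a queue with target 0 a first arrival in the
  head. N is so large that its small multiples dominate all bounded quantities.\<close>

lemma good_path:
  fixes n :: "3 \<Rightarrow> nat" and N p :: real
  assumes d: "\<And>i. 1/3 \<le> d i" "\<And>i. d i \<le> 2/3"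
    and pos: "\<And>i k. 0 < \<omega> (Inl (i, k))" "\<And>i k. 0 \<le> \<omega> (Inr (i, k))"
    and p: "0 \<le> p" "p \<le> 1"
    and j1_def: "j1 = first_served d tb x0 j0"
    and n: "\<And>i. n i = nat \<lfloor>(if i = j1 + 1 then 1 - p else if i = j1 + 2 then p else 0) * N\<rfloor> + 1"
    and first: "\<omega> (Inl (j1, 0)) \<le> 1/16" "\<And>l. l \<noteq> j1 \<Longrightarrow> 1/16 < \<omega> (Inl (l, 0))"
    and head: "\<And>i. arrival_time \<omega> i (n i) \<le> 1/4" "\<And>i. 1/4 \<le> \<omega> (Inr (i, 0))" "\<And>i. \<omega> (Inr (i, 0)) \<le> B"
    and tails: "\<And>i. tail_ok 1 K (\<lambda>l. \<omega> (Inl (i, n i + l)))" "\<And>i. tail_ok (1/2) K (\<lambda>l. \<omega> (Inr (i, Suc l)))"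
    and N: "2 * K + B + (1 + (\<Sum>i\<in>UNIV. real (x0 i))) + 3 \<le> 1/2000000 * N"
  obtains s x e n1 where "tracks d e s x" "\<And>k. e k \<le> 1/2500" "e \<longlonglongrightarrow> 0" "s 0 = j1" "\<bar>x 0 - p\<bar> \<le> 1/2500"
    "\<And>k. switch_side d tb x0 j0 \<omega> (k + Suc n1) = s k" "\<And>k. zeta d tb x0 j0 \<omega> (k + Suc n1) = side_point (s k) (x k)"
proof -
  define R where "R = 1 + (\<Sum>i\<in>UNIV. real (x0 i))"
  define a where "a i = (if i = j1 + 1 then 1 - p else if i = j1 + 2 then p else 0) * N" for i
  have K0: "0 \<le> K" using tails(1)[of 1] unfolding tail_ok_def by (auto dest: spec[of _ 0])
  have B0: "0 \<le> B" using head(2,3)[of 1] by linarith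
  have R1: "1 \<le> R" unfolding R_def by (simp add: sum_nonneg)
  have N0: "0 < N" using N K0 B0 R1 unfolding R_def[symmetric] by linarith
  have arr: "\<bar>(\<Sum>l<k. \<omega> (Inl (i, n i + l))) - real k\<bar> \<le> 1/2000000 * real k + K" for i k
    using tails(1)[of i] unfolding tail_ok_def by auto
  have srv: "\<bar>(\<Sum>l<k. \<omega> (Inr (i, Suc l))) - real k / 2\<bar> \<le> 1/2000000 * real k + K" for i k
    using tails(2)[of i] unfolding tail_ok_def by auto
  have unb: "\<exists>k. t < arrival_time \<omega> i k" for i t
  proof -
    obtain k :: nat where k: "2 * \<bar>t\<bar> + 2 * K + 2 < real k" using reals_Archimedean2 by blast
    have "arrival_time \<omega> i (n i + k) = arrival_time \<omega> i (n i) + (\<Sum>l<k. \<omega> (Inl (i, n i + l)))"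
      unfolding arrival_time_def by (induction k) auto
    moreover have "0 \<le> arrival_time \<omega> i (n i)"
      unfolding arrival_time_def using pos by (intro sum_nonneg) (simp add: less_imp_le)
    ultimately have "t < arrival_time \<omega> i (n i + k)" using arr[where i = i and k = k] k by linarith
    then show ?thesis by blast
  qed
  interpret polling_path \<omega> d tb x0 by unfold_locales (use pos unb in auto)
  have a0: "0 \<le> a i" for i using p N0 by (simp add: a_def)
  have off: "\<bar>real (x0 i + n i) - a i\<bar> \<le> R" for i
  proof -
    have "real (x0 i) \<le> (\<Sum>i\<in>UNIV. real (x0 i))" by (intro member_le_sum) auto
    moreover have "real (nat \<lfloor>a i\<rfloor>) \<le> a i" "a i - 1 \<le> real (nat \<lfloor>a i\<rfloor>)" using a0[of i] by linarith+
    moreover have "real (n i) = real (nat \<lfloor>a i\<rfloor>) + 1" by (simp add: n a_def)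
    ultimately show ?thesis unfolding R_def of_nat_add by linarith
  qed
  have aN: "(\<Sum>i\<in>UNIV. a i) = N" unfolding sum_3_cyclic[of a j1] by (simp add: a_def) (simp add: algebra_simps)
  have ctl: "control a (1/1000000) N"
    using control_from_tails[OF head(1,3) arr srv off, of N] N unfolding R_def by simp
  obtain n1 t1 where st: "polling_state d tb x0 j0 \<omega> n1 = (t1, (\<lambda>_. 0), j1)" "0 \<le> t1" "t1 \<le> 1/4" "1 \<le> Q j1 t1"
  proof (rule initial_start)
    show "0 < d i" "d i < 1" for i using d(1)[of i] d(2)[of i] by linarith+
  qed (use first in \<open>auto simp: j1_def\<close>)
  interpret started_path \<omega> d tb x0 a "1/1000000" N j0 j1 n1 t1
  proof unfold_locales
    show "1/4 \<le> t1 + service \<omega> j1 0" using st(2) head(2)[of j1] by (simp add: service_def)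
    show "1 \<le> 1/1000000 * N" using N K0 B0 R1 unfolding R_def[symmetric] by linarith
  qed (use d a0 aN ctl st in \<open>auto simp: a_def\<close>)
  \<comment> \<open>Convergence of the averages yields every slope \<eta> with some constants; M is
    enlarged until \<eta> M dominates them.\<close>
  have asym: "\<exists>M\<ge>N. control a \<delta> M" if del: "0 < \<delta>" for \<delta>
  proof -
    define \<eta> where "\<eta> = min (\<delta> / 2) (1/4)"
    have eta: "0 < \<eta>" "\<eta> \<le> 1/4" "2 * \<eta> \<le> \<delta>" using del by (auto simp: \<eta>_def)
    have "\<forall>i. \<exists>K. \<forall>k. \<bar>(\<Sum>l<k. \<omega> (Inl (i, n i + l))) - real k * 1\<bar> \<le> \<eta> * real k + K"
      using linear_bound_of_average[OF conjunct2[OF tails(1)[unfolded tail_ok_def]] eta(1)] by blast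
    from choice[OF this] obtain K1 where
      K1: "\<And>i k. \<bar>(\<Sum>l<k. \<omega> (Inl (i, n i + l))) - real k * 1\<bar> \<le> \<eta> * real k + K1 i" by blast
    have "\<forall>i. \<exists>K. \<forall>k. \<bar>(\<Sum>l<k. \<omega> (Inr (i, Suc l))) - real k * (1/2)\<bar> \<le> \<eta> * real k + K"
      using linear_bound_of_average[OF conjunct2[OF tails(2)[unfolded tail_ok_def]] eta(1)] by blast
    from choice[OF this] obtain K2 where
      K2: "\<And>i k. \<bar>(\<Sum>l<k. \<omega> (Inr (i, Suc l))) - real k * (1/2)\<bar> \<le> \<eta> * real k + K2 i" by blast
    define K' where "K' = (\<Sum>i\<in>UNIV. \<bar>K1 i\<bar>) + (\<Sum>i\<in>UNIV. \<bar>K2 i\<bar>)"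
    have K': "K1 i \<le> K'" "K2 i \<le> K'" for i
    proof -
      have "\<bar>K1 i\<bar> \<le> (\<Sum>i\<in>UNIV. \<bar>K1 i\<bar>)" "\<bar>K2 i\<bar> \<le> (\<Sum>i\<in>UNIV. \<bar>K2 i\<bar>)" by (intro member_le_sum; simp)+
      then show "K1 i \<le> K'" "K2 i \<le> K'" unfolding K'_def by linarith+
    qed
    define M where "M = max N ((2 * K' + B + R + 3) / \<eta>)"
    have "control a (2 * \<eta>) M"
    proof (rule control_from_tails[OF head(1,3) _ _ off eta(1,2)])
      show "\<bar>(\<Sum>l<k. \<omega> (Inl (i, n i + l))) - real k\<bar> \<le> \<eta> * real k + K'" for i k
        using K1[of i k] K'(1)[of i] by simp
      show "\<bar>(\<Sum>l<k. \<omega> (Inr (i, Suc l))) - real k / 2\<bar> \<le> \<eta> * real k + K'" for i k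
        using K2[of i k] K'(2)[of i] by simp
      have "(2 * K' + B + R + 3) / \<eta> \<le> M" by (simp add: M_def)
      then show "2 * K' + B + R + 3 \<le> \<eta> * M" using eta(1) by (simp add: divide_le_eq mult.commute)
    qed
    then have "control a \<delta> M"
      by (rule control_mono) (use eta N0 in \<open>auto simp: M_def\<close>)
    moreover have "N \<le> M" by (simp add: M_def)
    ultimately show ?thesis by blast
  qed
  show thesis
  proof (rule that[of err sd xx n1])
    show "sd 0 = j1" by (rule init)
    have "a (j1 + 2) / N = p" using N0 by (simp add: a_def)
    then show "\<bar>xx 0 - p\<bar> \<le> 1/2500" using initial_coordinate by simp
  qed (use tracks_path err_small err_tendsto_0[OF asym] switch_side_eq zeta_eq in auto)
qed

section \<open>The strong law of large numbers\<close>

lemma (in prob_space) second_moment_indep_sum: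
  fixes Y :: "nat \<Rightarrow> 'a \<Rightarrow> real"
  assumes indep: "indep_vars (\<lambda>_. borel) Y UNIV" and int: "\<And>l. integrable M (Y l)"
    and mean: "\<And>l. expectation (Y l) = 0"
    and sq: "\<And>l. integrable M (\<lambda>x. (Y l x)\<^sup>2)" "\<And>l. expectation (\<lambda>x. (Y l x)\<^sup>2) = v"
  shows "integrable M (\<lambda>x. (\<Sum>l<k. Y l x)\<^sup>2)" "expectation (\<lambda>x. (\<Sum>l<k. Y l x)\<^sup>2) = real k * v"
proof -
  have prod: "integrable M (\<lambda>x. Y i x * Y j x) \<and> expectation (\<lambda>x. Y i x * Y j x) = (if i = j then v else 0)" for i j
  proof (cases "i = j")
    case True
    then show ?thesis using sq[of j] by (simp add: power2_eq_square)
  next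
    case False
    have ind: "indep_vars (\<lambda>_. borel) Y {i, j}" by (rule indep_vars_subset[OF indep]) simp
    have "integrable M (\<lambda>x. \<Prod>l\<in>{i, j}. Y l x)"
      by (rule indep_vars_integrable[OF _ ind]) (use int in auto)
    moreover have "expectation (\<lambda>x. \<Prod>l\<in>{i, j}. Y l x) = (\<Prod>l\<in>{i, j}. expectation (Y l))"
      by (rule indep_vars_lebesgue_integral[OF _ ind]) (use int in auto)
    ultimately show ?thesis using False mean by simp
  qed
  have eq: "(\<Sum>l<k. Y l x)\<^sup>2 = (\<Sum>i<k. \<Sum>j<k. Y i x * Y j x)" for x
    by (simp add: power2_eq_square sum_product)
  show "integrable M (\<lambda>x. (\<Sum>l<k. Y l x)\<^sup>2)"
    unfolding eq using prod by (intro Bochner_Integration.integrable_sum) auto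
  have "expectation (\<lambda>x. \<Sum>i<k. \<Sum>j<k. Y i x * Y j x) = (\<Sum>i<k. \<Sum>j<k. if i = j then v else 0)"
    using prod by (simp add: Bochner_Integration.integral_sum)
  also have "\<dots> = real k * v" by simp
  finally show "expectation (\<lambda>x. (\<Sum>l<k. Y l x)\<^sup>2) = real k * v" unfolding eq .
qed

text \<open>Nonnegative terms make the partial sums monotone, and consecutive squares have ratio
  tending to 1. An average at k is thus squeezed between those at the squares around k.\<close>

lemma average_tendsto_of_squares:
  fixes y :: "nat \<Rightarrow> real"
  assumes nn: "\<And>l. 0 \<le> y l"
    and sq: "(\<lambda>n. (\<Sum>l<(Suc n)\<^sup>2. y l) / real ((Suc n)\<^sup>2)) \<longlonglongrightarrow> m"
  shows "(\<lambda>k. (\<Sum>l<k. y l) / real k) \<longlonglongrightarrow> m"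
proof -
  define r where "r n = (\<Sum>l<n\<^sup>2. y l) / real (n\<^sup>2)" for n
  have rS: "(\<lambda>n. r (Suc n)) \<longlonglongrightarrow> m" using sq by (simp add: r_def)
  then have r: "r \<longlonglongrightarrow> m" by (rule LIMSEQ_imp_Suc)
  have "(\<lambda>n. r n * (real n / real (Suc n))\<^sup>2) \<longlonglongrightarrow> m * 1\<^sup>2"
    by (intro tendsto_intros r LIMSEQ_n_over_Suc_n)
  then have lo: "(\<lambda>n. r n * (real n / real (Suc n))\<^sup>2) \<longlonglongrightarrow> m" by simp
  have "(\<lambda>n. r (Suc n) * (real (Suc n) / real n)\<^sup>2) \<longlonglongrightarrow> m * 1\<^sup>2"
    by (intro tendsto_intros rS LIMSEQ_Suc_n_over_n)
  then have up: "(\<lambda>n. r (Suc n) * (real (Suc n) / real n)\<^sup>2) \<longlonglongrightarrow> m" by simp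
  have fs: "filterlim floor_sqrt at_top sequentially"
    unfolding filterlim_at_top eventually_sequentially
    by (metis le_floor_sqrt_iff)
  have mono: "(\<Sum>l<j. y l) \<le> (\<Sum>l<k. y l)" if "j \<le> k" for j k
    using that nn by (intro sum_mono2) auto
  have bounds: "r n * (real n / real (Suc n))\<^sup>2 \<le> (\<Sum>l<k. y l) / real k \<and>
      (\<Sum>l<k. y l) / real k \<le> r (Suc n) * (real (Suc n) / real n)\<^sup>2"
    if n: "n = floor_sqrt k" and k: "0 < k" for n k
  proof -
    have n0: "0 < n" using n k by simp
    have nk: "n\<^sup>2 \<le> k" "k \<le> (Suc n)\<^sup>2" using n Suc_floor_sqrt_power2_gt[of k] by auto
    have rn: "real (n\<^sup>2) \<le> real k" "real k \<le> real ((Suc n)\<^sup>2)" using nk of_nat_le_iff by blast+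
    have pos: "0 < real (n\<^sup>2)" "0 < real k" using n0 k by auto
    have "r n * (real n / real (Suc n))\<^sup>2 = (\<Sum>l<n\<^sup>2. y l) / real ((Suc n)\<^sup>2)"
      using n0 unfolding r_def by (simp add: power_divide del: of_nat_Suc)
    also have "\<dots> \<le> (\<Sum>l<k. y l) / real k"
      using mono[OF nk(1)] rn pos nn by (intro frac_le sum_nonneg) auto
    finally have 1: "r n * (real n / real (Suc n))\<^sup>2 \<le> (\<Sum>l<k. y l) / real k" .
    have "(\<Sum>l<k. y l) / real k \<le> (\<Sum>l<(Suc n)\<^sup>2. y l) / real (n\<^sup>2)"
      using mono[OF nk(2)] rn pos nn by (intro frac_le sum_nonneg) auto
    also have "\<dots> = r (Suc n) * (real (Suc n) / real n)\<^sup>2"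
      using n0 unfolding r_def by (simp add: power_divide del: of_nat_Suc)
    finally show ?thesis using 1 by blast
  qed
  show ?thesis
  proof (rule tendsto_sandwich[OF _ _ filterlim_compose[OF lo fs] filterlim_compose[OF up fs]])
    show "\<forall>\<^sub>F k in sequentially. r (floor_sqrt k) * (real (floor_sqrt k) / real (Suc (floor_sqrt k)))\<^sup>2 \<le> (\<Sum>l<k. y l) / real k"
      by (rule eventually_mono[OF eventually_gt_at_top[of 0]]) (use bounds[OF refl] in blast)
    show "\<forall>\<^sub>F k in sequentially. (\<Sum>l<k. y l) / real k \<le> r (Suc (floor_sqrt k)) * (real (Suc (floor_sqrt k)) / real (floor_sqrt k))\<^sup>2"
      by (rule eventually_mono[OF eventually_gt_at_top[of 0]]) (use bounds[OF refl] in blast)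
  qed
qed

text \<open>Along squares, Chebyshev's inequality bounds the probability of a deviation e by v /
  (e^2 (n+1)^2). This is summable, so the Borel-Cantelli lemma applies, and monotonicity fills in
  the remaining indices.\<close>

lemma (in prob_space) strong_law_nonneg:
  fixes X :: "nat \<Rightarrow> 'a \<Rightarrow> real"
  assumes indep: "indep_vars (\<lambda>_. borel) (\<lambda>l x. X l x - m) UNIV"
    and nn: "\<And>l. AE x in M. 0 \<le> X l x"
    and int: "\<And>l. integrable M (X l)" and mean: "\<And>l. expectation (X l) = m"
    and sq: "\<And>l. integrable M (\<lambda>x. (X l x - m)\<^sup>2)" "\<And>l. expectation (\<lambda>x. (X l x - m)\<^sup>2) = v"
  shows "AE x in M. (\<lambda>k. (\<Sum>l<k. X l x) / real k) \<longlonglongrightarrow> m"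
proof -
  define Z where "Z n x = (\<Sum>l<(Suc n)\<^sup>2. X l x - m)" for n x
  have [measurable]: "X l \<in> borel_measurable M" for l using int by auto
  have v0: "0 \<le> v" unfolding sq(2)[of 0, symmetric] by (rule integral_nonneg_AE) auto
  have int0: "integrable M (\<lambda>x. X l x - m)" for l using int by auto
  have mean0: "expectation (\<lambda>x. X l x - m) = 0" for l using int mean[of l] by (simp add: prob_space)
  have Z2: "integrable M (\<lambda>x. (Z n x)\<^sup>2)" "expectation (\<lambda>x. (Z n x)\<^sup>2) = real ((Suc n)\<^sup>2) * v" for n
    unfolding Z_def by (rule second_moment_indep_sum[OF indep int0 mean0 sq])+
  have Zm [measurable]: "Z n \<in> borel_measurable M" for n unfolding Z_def by measurable
  have EZ: "expectation (Z n) = 0" for n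
    unfolding Z_def using int0 mean0 by (subst Bochner_Integration.integral_sum) auto
  have ev: "AE x in M. \<forall>\<^sub>F n in sequentially. \<bar>Z n x\<bar> < e * real ((Suc n)\<^sup>2)" if e: "0 < e" for e
  proof -
    define A where "A n = {x \<in> space M. e * real ((Suc n)\<^sup>2) \<le> \<bar>Z n x\<bar>}" for n
    have Am: "A n \<in> sets M" for n unfolding A_def by measurable
    have bound: "measure M (A n) \<le> v / e\<^sup>2 * (1 / real (Suc n) ^ 2)" for n
    proof -
      have "measure M (A n) \<le> expectation (\<lambda>x. (Z n x)\<^sup>2) / (e * real ((Suc n)\<^sup>2))\<^sup>2"
        using Chebyshev_inequality[OF Zm Z2(1), of "e * real ((Suc n)\<^sup>2)" n] e
        unfolding A_def EZ by simp
      also have "\<dots> = v / e\<^sup>2 * (1 / real (Suc n) ^ 2)"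
        unfolding Z2(2) of_nat_power using e by (simp add: field_simps power2_eq_square del: of_nat_Suc)
      finally show ?thesis .
    qed
    have "summable (\<lambda>n. 1 / real (Suc n) ^ 2)"
      using inverse_power_summable[of 2, where 'a = real] by (subst summable_Suc_iff) (simp add: inverse_eq_divide)
    then have "summable (\<lambda>n. v / e\<^sup>2 * (1 / real (Suc n) ^ 2))" by (rule summable_mult)
    then have "summable (\<lambda>n. measure M (A n))"
      by (rule summable_comparison_test') (use bound in auto)
    then have "AE x in M. \<forall>\<^sub>F n in sequentially. x \<in> space M - A n"
      by (intro borel_cantelli_AE1 Am) (auto simp: emeasure_eq_measure)
    then show ?thesis
      by (rule AE_mp) (auto intro!: AE_I2 elim!: eventually_mono simp: A_def not_le)
  qed
  \<comment> \<open>Only tolerances 1 / Suc j are used, so that countably many null sets are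
    discarded.\<close>
  have "AE x in M. \<forall>j::nat. \<forall>\<^sub>F n in sequentially. \<bar>Z n x\<bar> < 1 / real (Suc j) * real ((Suc n)\<^sup>2)"
    unfolding AE_all_countable by (intro allI ev) simp
  moreover have "AE x in M. \<forall>l. 0 \<le> X l x" unfolding AE_all_countable using nn by simp
  ultimately show ?thesis
  proof eventually_elim
    case (elim x)
    have "(\<lambda>n. (\<Sum>l<(Suc n)\<^sup>2. X l x) / real ((Suc n)\<^sup>2)) \<longlonglongrightarrow> m"
    proof (rule LIMSEQ_I)
      fix e :: real assume "0 < e"
      then obtain j where j: "1 / real (Suc j) < e" using nat_approx_posE by blast
      obtain n0 where n0: "\<And>n. n0 \<le> n \<Longrightarrow> \<bar>Z n x\<bar> < 1 / real (Suc j) * real ((Suc n)\<^sup>2)"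
        using elim(1) unfolding eventually_sequentially by blast
      have "norm ((\<Sum>l<(Suc n)\<^sup>2. X l x) / real ((Suc n)\<^sup>2) - m) < e" if "n0 \<le> n" for n
      proof -
        have pos: "0 < real ((Suc n)\<^sup>2)" by simp
        have "(\<Sum>l<(Suc n)\<^sup>2. X l x) / real ((Suc n)\<^sup>2) - m = Z n x / real ((Suc n)\<^sup>2)"
          using pos unfolding Z_def by (simp add: sum_subtractf diff_divide_distrib del: of_nat_power of_nat_Suc)
        then have "norm ((\<Sum>l<(Suc n)\<^sup>2. X l x) / real ((Suc n)\<^sup>2) - m) = \<bar>Z n x\<bar> / real ((Suc n)\<^sup>2)"
          by simp
        also have "\<dots> < 1 / real (Suc j)" using n0[OF that] pos by (subst pos_divide_less_eq)
        finally show ?thesis using j by linarith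
      qed
      then show "\<exists>no. \<forall>n\<ge>no. norm ((\<Sum>l<(Suc n)\<^sup>2. X l x) / real ((Suc n)\<^sup>2) - m) < e" by blast
    qed
    then show ?case using elim(2) by (intro average_tendsto_of_squares) auto
  qed
qed

text \<open>The joint law of the coordinates is the product of their marginals, which characterises
  independence.\<close>

lemma indep_vars_PiM_coordinates:
  assumes M: "\<And>i. i \<in> I \<Longrightarrow> prob_space (M i)" and "I \<noteq> {}"
  shows "prob_space.indep_vars (PiM I M) M (\<lambda>i \<omega>. \<omega> i) I"
proof -
  interpret prob_space "PiM I M" by (rule prob_space_PiM[OF M])
  have "distr (PiM I M) (PiM I M) (\<lambda>x. \<lambda>i\<in>I. x i) = distr (PiM I M) (PiM I M) (\<lambda>x. x)"
    by (rule distr_cong) (auto simp: space_PiM PiE_restrict)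
  also have "\<dots> = PiM I (\<lambda>i. distr (PiM I M) (M i) (\<lambda>\<omega>. \<omega> i))"
    by (subst distr_id) (intro PiM_cong refl distr_PiM_component[OF M, symmetric], auto)
  finally show ?thesis using assms(2) by (subst indep_vars_iff_distr_eq_PiM') auto
qed

lemma strong_law_PiM:
  assumes D: "prob_space D" "sets D = sets borel" "AE x in D. 0 \<le> x"
    "integrable D (\<lambda>x. x)" "integrable D (\<lambda>x. x^2)" "(\<integral>x. x \<partial>D) = (m::real)"
  shows "AE y in PiM (UNIV::nat set) (\<lambda>_. D). (\<lambda>k. (\<Sum>l<k. y l) / real k) \<longlonglongrightarrow> m"
proof -
  interpret D: prob_space D by fact
  interpret Q: prob_space "PiM (UNIV::nat set) (\<lambda>_. D)" by (rule prob_space_PiM) (rule D(1))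
  let ?Q = "PiM (UNIV::nat set) (\<lambda>_. D)"
  have mD: "f \<in> borel_measurable D" if "f \<in> borel_measurable borel" for f :: "real \<Rightarrow> real"
    using that measurable_cong_sets[OF D(2) refl] by auto
  have comp: "distr ?Q D (\<lambda>y. y l) = D" for l by (rule distr_PiM_component) (use D(1) in auto)
  have int: "integrable ?Q (\<lambda>y. f (y l)) \<and> (\<integral>y. f (y l) \<partial>?Q) = (\<integral>x. f x \<partial>D)"
    if "integrable D f" for f :: "real \<Rightarrow> real" and l
  proof -
    have "integrable (distr ?Q D (\<lambda>y. y l)) f" using that by (simp add: comp)
    then have "integrable ?Q (\<lambda>y. f (y l))" by (rule integrable_distr[rotated]) simp
    moreover have "integral\<^sup>L (distr ?Q D (\<lambda>y. y l)) f = (\<integral>y. f (y l) \<partial>?Q)"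
      by (rule integral_distr) (use that in auto)
    ultimately show ?thesis by (simp add: comp)
  qed
  have sq: "integrable D (\<lambda>x. (x - m)\<^sup>2)"
    using D(4,5) by (simp add: power2_diff)
  show ?thesis
  proof (rule Q.strong_law_nonneg)
    show "Q.indep_vars (\<lambda>_. borel) (\<lambda>l x. x l - m) UNIV"
    proof (rule Q.indep_vars_compose2[where X = "\<lambda>l x. x l" and M' = "\<lambda>_. D" and Y = "\<lambda>l x. x - m"])
      show "Q.indep_vars (\<lambda>_. D) (\<lambda>l x. x l) UNIV"
        by (rule indep_vars_PiM_coordinates) (simp_all add: D(1))
      show "(\<lambda>x. x - m) \<in> D \<rightarrow>\<^sub>M borel" by (rule mD) simp
    qed
    show "AE x in ?Q. 0 \<le> x l" for l by (rule AE_PiM_component) (use D(1,3) in auto)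
    show "integrable ?Q (\<lambda>x. x l)" "Q.expectation (\<lambda>x. x l) = m" for l using int[OF D(4), of l] D(6) by auto
    show "integrable ?Q (\<lambda>x. (x l - m)\<^sup>2)" "Q.expectation (\<lambda>x. (x l - m)\<^sup>2) = (\<integral>x. (x - m)\<^sup>2 \<partial>D)" for l
      using int[OF sq, of l] by auto
  qed
qed

lemma measurable_tail_ok [measurable]:
  assumes [measurable]: "\<And>l. (\<lambda>y. f y l) \<in> borel_measurable M"
  shows "Measurable.pred M (\<lambda>y. tail_ok m K (f y))"
proof -
  \<comment> \<open>Convergence is split into the Cauchy property and the value of
    \<open>lim\<close>, each of them measurable.\<close>
  have lim: "(\<lambda>k. (\<Sum>l<k. g l) / real k) \<longlonglongrightarrow> m \<longleftrightarrow>
     Cauchy (\<lambda>k. (\<Sum>l<k. g l) / real k) \<and> lim (\<lambda>k. (\<Sum>l<k. g l) / real k) = m" for g :: "nat \<Rightarrow> real"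
    using LIMSEQ_imp_Cauchy limI Cauchy_convergent convergent_LIMSEQ_iff by blast
  have [measurable]: "Measurable.pred M (\<lambda>y. Cauchy (\<lambda>k. (\<Sum>l<k. f y l) / real k))"
    unfolding pred_def by (rule sets_Collect_Cauchy) measurable
  have [measurable]: "(\<lambda>y. lim (\<lambda>k. (\<Sum>l<k. f y l) / real k)) \<in> borel_measurable M"
    by (rule borel_measurable_lim_metric) measurable
  show ?thesis unfolding tail_ok_def lim by measurable
qed

lemma tail_ok_mono: "tail_ok m K y \<Longrightarrow> K \<le> K' \<Longrightarrow> tail_ok m K' y"
  unfolding tail_ok_def by (auto intro: order_trans[OF _ add_left_mono])

text \<open>By the strong law almost every sequence satisfies \<open>tail_ok\<close> for some K, and
  the events increase with K. The level 9/10 anticipates a union bound over six tails.\<close>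

lemma tail_ok_likely:
  assumes D: "service_law D mu"
  shows "\<exists>K0. \<forall>K\<ge>K0. 9/10 \<le> measure (PiM (UNIV::nat set) (\<lambda>_. D)) {y \<in> space (PiM UNIV (\<lambda>_. D)). tail_ok (1/mu) K y}"
proof -
  have D': "prob_space D" "sets D = sets borel" "AE x in D. 0 \<le> x"
    "integrable D (\<lambda>x. x)" "integrable D (\<lambda>x. x^2)" "(\<integral>x. x \<partial>D) = 1/mu"
    using D by (auto simp: service_law_def)
  let ?Q = "PiM (UNIV::nat set) (\<lambda>_. D)"
  interpret Q: prob_space ?Q by (rule prob_space_PiM) (rule D'(1))
  have [measurable]: "(\<lambda>y. y l) \<in> borel_measurable ?Q" for l
    using measurable_component_singleton[of l UNIV "\<lambda>_. D"] measurable_cong_sets[OF refl D'(2), of ?Q] by auto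
  define A where "A n = {y \<in> space ?Q. tail_ok (1/mu) (real n) y}" for n :: nat
  have Am: "A n \<in> sets ?Q" for n unfolding A_def by measurable
  have inc: "incseq A" unfolding A_def by (rule incseq_SucI) (auto intro: tail_ok_mono)
  have "AE y in ?Q. y \<in> (\<Union>n. A n)"
    using strong_law_PiM[OF D'] AE_space
  proof eventually_elim
    case (elim y)
    obtain K where K: "\<forall>k. \<bar>(\<Sum>l<k. y l) - real k * (1/mu)\<bar> \<le> 1/2000000 * real k + K"
      using linear_bound_of_average[OF elim(1), of "1/2000000"] by auto
    obtain n :: nat where "K \<le> real n" using real_arch_simple by blast
    then have "tail_ok (1/mu) (real n) y"
      using K elim(1) unfolding tail_ok_def by (auto intro: order_trans[OF _ add_left_mono])
    then show ?case using elim(2) by (auto simp: A_def)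
  qed
  then have "Q.prob (\<Union>n. A n) = 1" using Am by (subst Q.prob_eq_1) auto
  then have "(\<lambda>n. Q.prob (A n)) \<longlonglongrightarrow> 1" using Q.finite_Lim_measure_incseq[OF _ inc] Am by auto
  then have "\<forall>\<^sub>F n in sequentially. 9/10 < Q.prob (A n)" by (rule order_tendstoD) simp
  then obtain n where n: "9/10 < Q.prob (A n)" using eventually_happens' sequentially_bot by blast
  have "9/10 \<le> Q.prob {y \<in> space ?Q. tail_ok (1/mu) K y}" if "real n \<le> K" for K
  proof -
    have "Q.prob (A n) \<le> Q.prob {y \<in> space ?Q. tail_ok (1/mu) K y}"
      by (rule Q.finite_measure_mono) (use that in \<open>auto simp: A_def intro: tail_ok_mono\<close>)
    then show ?thesis using n by linarith
  qed
  then show ?thesis by blast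
qed

section \<open>Measurability\<close>

lemma measurable_count_space_combine:
  fixes f :: "'a \<Rightarrow> 'b :: countable" and g :: "'a \<Rightarrow> 'c"
  assumes f: "f \<in> M \<rightarrow>\<^sub>M count_space UNIV" and g: "g \<in> M \<rightarrow>\<^sub>M count_space UNIV"
  shows "(\<lambda>x. h (f x) (g x)) \<in> M \<rightarrow>\<^sub>M count_space UNIV"
  by (rule measurable_compose_countable[OF _ f]) (rule measurable_compose[OF g], simp)

lemma measurable_fun_count_space:
  fixes f :: "'a \<Rightarrow> 'i :: finite \<Rightarrow> 'b :: countable"
  assumes "\<And>i. (\<lambda>x. f x i) \<in> M \<rightarrow>\<^sub>M count_space UNIV"
  shows "f \<in> M \<rightarrow>\<^sub>M count_space UNIV"
proof (subst measurable_count_space_eq2_countable)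
  have "f -` {g} \<inter> space M = {x \<in> space M. \<forall>i\<in>UNIV. f x i = g i}" for g by auto
  moreover have "{x \<in> space M. \<forall>i\<in>UNIV. f x i = g i} \<in> sets M" for g
  proof (rule sets.sets_Collect_finite_All)
    fix i show "{x \<in> space M. f x i = g i} \<in> sets M"
      using measurable_sets[OF assms[of i], of "{g i}"] by (simp add: vimage_def Int_def conj_commute)
  qed simp
  ultimately show "f \<in> space M \<rightarrow> UNIV \<and> (\<forall>a\<in>UNIV. f -` {a} \<inter> space M \<in> sets M)" by simp
qed

text \<open>The choice is a fixed function of the truth values of P, a point of a finite space on
  which every function is measurable.\<close>

lemma measurable_some_finite:
  fixes P :: "'i :: finite \<Rightarrow> 'a \<Rightarrow> bool"
  assumes "\<And>i. Measurable.pred M (P i)"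
  shows "(\<lambda>x. SOME i. P i x) \<in> M \<rightarrow>\<^sub>M count_space UNIV"
proof -
  have "(\<lambda>x i. P i x) \<in> M \<rightarrow>\<^sub>M count_space UNIV"
    by (rule measurable_fun_count_space) (rule assms)
  from measurable_compose[OF this, of "\<lambda>p. SOME i. p i" "count_space UNIV"] show ?thesis by simp
qed

locale coordinate_measurable =
  fixes M :: "smp measure"
  assumes coordinate: "\<And>x. (\<lambda>\<omega>. \<omega> x) \<in> borel_measurable M"
begin

lemma arrival_time_measurable [measurable]: "(\<lambda>\<omega>. arrival_time \<omega> i k) \<in> borel_measurable M"
  unfolding arrival_time_def by (intro borel_measurable_sum coordinate)

lemma service_measurable [measurable]: "(\<lambda>\<omega>. service \<omega> i k) \<in> borel_measurable M"
  unfolding service_def by (rule coordinate)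

lemma arrivals_measurable [measurable (raw)]:
  assumes [measurable]: "g \<in> borel_measurable M"
  shows "(\<lambda>\<omega>. arrivals \<omega> i (g \<omega>)) \<in> M \<rightarrow>\<^sub>M count_space UNIV"
  unfolding arrivals_def
proof (rule measurable_card)
  fix k
  have "{\<omega> \<in> space M. arrival_time \<omega> i k \<le> g \<omega>} \<in> sets M"
    by (rule borel_measurable_le[OF arrival_time_measurable assms])
  then show "{\<omega> \<in> space M. k \<in> {k. 1 \<le> k \<and> arrival_time \<omega> i k \<le> g \<omega>}} \<in> sets M"
    by (cases "1 \<le> k") simp_all
qed

lemma next_arrival_measurable [measurable (raw)]:
  assumes [measurable]: "g \<in> borel_measurable M"
  shows "(\<lambda>\<omega>. next_arrival \<omega> i (g \<omega>)) \<in> borel_measurable M"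
proof (rule borel_measurableI_less)
  fix a
  \<comment> \<open>Without a later arrival the infimum is the unspecified constant
    \<open>Inf {}\<close>, which gives the second disjunct.\<close>
  have "next_arrival \<omega> i (g \<omega>) < a \<longleftrightarrow> (\<exists>k. 1 \<le> k \<and> g \<omega> < arrival_time \<omega> i k \<and> arrival_time \<omega> i k < a) \<or>
     ((\<forall>k. \<not> (1 \<le> k \<and> g \<omega> < arrival_time \<omega> i k)) \<and> Inf ({} :: real set) < a)" for \<omega>
  proof -
    define A where "A = {arrival_time \<omega> i k | k. 1 \<le> k \<and> g \<omega> < arrival_time \<omega> i k}"
    have "bdd_below A" by (rule bdd_belowI[of _ "g \<omega>"]) (auto simp: A_def)
    then have "A \<noteq> {} \<Longrightarrow> Inf A < a \<longleftrightarrow> (\<exists>x\<in>A. x < a)" by (intro cInf_less_iff)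
    then have "Inf A < a \<longleftrightarrow> (\<exists>x\<in>A. x < a) \<or> (A = {} \<and> Inf ({} :: real set) < a)"
      by (cases "A = {}") simp_all
    moreover have "(\<exists>x\<in>A. x < a) \<longleftrightarrow> (\<exists>k. 1 \<le> k \<and> g \<omega> < arrival_time \<omega> i k \<and> arrival_time \<omega> i k < a)"
      unfolding A_def by blast
    moreover have "A = {} \<longleftrightarrow> (\<forall>k. \<not> (1 \<le> k \<and> g \<omega> < arrival_time \<omega> i k))"
      unfolding A_def by blast
    moreover have "next_arrival \<omega> i (g \<omega>) = Inf A" unfolding next_arrival_def A_def ..
    ultimately show ?thesis by (simp only:)
  qed
  then show "{\<omega> \<in> space M. next_arrival \<omega> i (g \<omega>) < a} \<in> sets M" by (simp only:) measurable
qed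

text \<open>The discrete part (c, j) of the state is frozen and only the time varies with \<omega>;
  the general case glues countably many such pieces. Time and discrete data have different target
  spaces, hence the separate claims.\<close>

lemma polling_step_measurable_const:
  assumes [measurable]: "t \<in> borel_measurable M"
  shows "(\<lambda>\<omega>. fst (fst (polling_step d tb x0 \<omega> (t \<omega>, c, j)))) \<in> borel_measurable M"
    "(\<lambda>\<omega>. snd (fst (polling_step d tb x0 \<omega> (t \<omega>, c, j)))) \<in> M \<rightarrow>\<^sub>M count_space UNIV"
    "(\<lambda>\<omega>. snd (polling_step d tb x0 \<omega> (t \<omega>, c, j))) \<in> M \<rightarrow>\<^sub>M count_space UNIV"
proof -
  define T where "T r \<omega> = t \<omega> + (\<Sum>l<r. service \<omega> j (c j + l))" for r :: nat and \<omega>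
  define r where "r \<omega> = (LEAST r. x0 j + arrivals \<omega> j (T r \<omega>) \<le> c j + r)" for \<omega>
  define te where "te \<omega> = T (r \<omega>) \<omega>" for \<omega>
  define c' where "c' \<omega> = c(j := c j + r \<omega>)" for \<omega>
  define xi where "xi \<omega> = (\<lambda>i. x0 i + arrivals \<omega> i (te \<omega>) - c' \<omega> i)" for \<omega>
  define \<tau> where "\<tau> \<omega> = Min (range (\<lambda>i. next_arrival \<omega> i (te \<omega>)))" for \<omega>
  define i0 where "i0 \<omega> = (SOME i. next_arrival \<omega> i (te \<omega>) = \<tau> \<omega>)" for \<omega>
  define xi' where "xi' \<omega> = (\<lambda>i. x0 i + arrivals \<omega> i (\<tau> \<omega>) - c' \<omega> i)" for \<omega>
  have step: "polling_step d tb x0 \<omega> (t \<omega>, c, j) =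
     (if (\<Sum>l\<in>UNIV. xi \<omega> l) \<noteq> 0 then ((te \<omega>, c' \<omega>, route d tb j (xi \<omega>)), j, xi \<omega>)
      else ((\<tau> \<omega>, c' \<omega>, i0 \<omega>), j, xi' \<omega>))" for \<omega>
    unfolding polling_step_def Let_def T_def r_def te_def c'_def xi_def \<tau>_def i0_def xi'_def by simp
  have T [measurable]: "T r \<in> borel_measurable M" for r unfolding T_def by measurable
  have r [measurable]: "r \<in> M \<rightarrow>\<^sub>M count_space UNIV" unfolding r_def by (rule measurable_Least) measurable
  have te [measurable]: "te \<in> borel_measurable M"
    unfolding te_def by (rule measurable_compose_countable[OF T r])
  have \<tau> [measurable]: "\<tau> \<in> borel_measurable M"
    unfolding \<tau>_def by (rule borel_measurable_Min) auto
  have i0: "i0 \<in> M \<rightarrow>\<^sub>M count_space UNIV"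
    unfolding i0_def
    by (rule measurable_some_finite) (unfold pred_def, rule borel_measurable_eq[OF next_arrival_measurable[OF te] \<tau>])
  have c': "c' \<in> M \<rightarrow>\<^sub>M count_space UNIV"
    unfolding c'_def by (rule measurable_compose[OF r]) simp
  have q: "(\<lambda>\<omega> i. x0 i + arrivals \<omega> i (s \<omega>) - c' \<omega> i) \<in> M \<rightarrow>\<^sub>M count_space UNIV"
    if [measurable]: "s \<in> borel_measurable M" for s
  proof (rule measurable_fun_count_space)
    fix i show "(\<lambda>\<omega>. x0 i + arrivals \<omega> i (s \<omega>) - c' \<omega> i) \<in> M \<rightarrow>\<^sub>M count_space UNIV"
      by (rule measurable_count_space_combine[OF arrivals_measurable[OF that] c', of "\<lambda>a c. x0 i + a - c i"])
  qed
  have xi: "xi \<in> M \<rightarrow>\<^sub>M count_space UNIV" unfolding xi_def by (rule q) measurable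
  have xi': "xi' \<in> M \<rightarrow>\<^sub>M count_space UNIV" unfolding xi'_def by (rule q) measurable
  have "Measurable.pred M (\<lambda>\<omega>. (\<Sum>l\<in>UNIV. xi \<omega> l) \<noteq> 0)"
    by (rule measurable_compose[OF xi]) simp
  then have P: "{\<omega> \<in> space M. (\<Sum>l\<in>UNIV. xi \<omega> l) \<noteq> 0} \<in> sets M" unfolding pred_def .
  show "(\<lambda>\<omega>. fst (fst (polling_step d tb x0 \<omega> (t \<omega>, c, j)))) \<in> borel_measurable M"
  proof -
    have eq: "(\<lambda>\<omega>. fst (fst (polling_step d tb x0 \<omega> (t \<omega>, c, j)))) =
      (\<lambda>\<omega>. if (\<Sum>l\<in>UNIV. xi \<omega> l) \<noteq> 0 then te \<omega> else \<tau> \<omega>)"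
      unfolding step by auto
    show ?thesis unfolding eq by (rule measurable_If[OF te \<tau> P])
  qed
  have ci: "(\<lambda>\<omega>. (c' \<omega>, i0 \<omega>)) \<in> M \<rightarrow>\<^sub>M count_space UNIV"
    by (rule measurable_count_space_combine[OF c' i0])
  have cx: "(\<lambda>\<omega>. (c' \<omega>, route d tb j (xi \<omega>))) \<in> M \<rightarrow>\<^sub>M count_space UNIV"
    by (rule measurable_count_space_combine[OF c' xi])
  show "(\<lambda>\<omega>. snd (fst (polling_step d tb x0 \<omega> (t \<omega>, c, j)))) \<in> M \<rightarrow>\<^sub>M count_space UNIV"
  proof -
    have eq: "(\<lambda>\<omega>. snd (fst (polling_step d tb x0 \<omega> (t \<omega>, c, j)))) =
      (\<lambda>\<omega>. if (\<Sum>l\<in>UNIV. xi \<omega> l) \<noteq> 0 then (c' \<omega>, route d tb j (xi \<omega>)) else (c' \<omega>, i0 \<omega>))"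
      unfolding step by auto
    show ?thesis unfolding eq by (rule measurable_If[OF cx ci P])
  qed
  have jx: "(\<lambda>\<omega>. (j, xi \<omega>)) \<in> M \<rightarrow>\<^sub>M count_space UNIV" "(\<lambda>\<omega>. (j, xi' \<omega>)) \<in> M \<rightarrow>\<^sub>M count_space UNIV"
    by (rule measurable_compose[OF xi], simp) (rule measurable_compose[OF xi'], simp)
  show "(\<lambda>\<omega>. snd (polling_step d tb x0 \<omega> (t \<omega>, c, j))) \<in> M \<rightarrow>\<^sub>M count_space UNIV"
  proof -
    have eq: "(\<lambda>\<omega>. snd (polling_step d tb x0 \<omega> (t \<omega>, c, j))) =
      (\<lambda>\<omega>. if (\<Sum>l\<in>UNIV. xi \<omega> l) \<noteq> 0 then (j, xi \<omega>) else (j, xi' \<omega>))"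
      unfolding step by auto
    show ?thesis unfolding eq by (rule measurable_If[OF jx P])
  qed
qed

lemma polling_step_measurable:
  assumes t: "(\<lambda>\<omega>. fst (s \<omega>)) \<in> borel_measurable M" and c: "(\<lambda>\<omega>. snd (s \<omega>)) \<in> M \<rightarrow>\<^sub>M count_space UNIV"
  shows "(\<lambda>\<omega>. fst (fst (polling_step d tb x0 \<omega> (s \<omega>)))) \<in> borel_measurable M"
    "(\<lambda>\<omega>. snd (fst (polling_step d tb x0 \<omega> (s \<omega>)))) \<in> M \<rightarrow>\<^sub>M count_space UNIV"
    "(\<lambda>\<omega>. snd (polling_step d tb x0 \<omega> (s \<omega>))) \<in> M \<rightarrow>\<^sub>M count_space UNIV"
  using measurable_compose_countable[OF _ c, of "\<lambda>p \<omega>. fst (fst (polling_step d tb x0 \<omega> (fst (s \<omega>), p)))" borel]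
    measurable_compose_countable[OF _ c, of "\<lambda>p \<omega>. snd (fst (polling_step d tb x0 \<omega> (fst (s \<omega>), p)))" "count_space UNIV"]
    measurable_compose_countable[OF _ c, of "\<lambda>p \<omega>. snd (polling_step d tb x0 \<omega> (fst (s \<omega>), p))" "count_space UNIV"]
    polling_step_measurable_const[OF t] by auto

lemma polling_state_measurable:
  "(\<lambda>\<omega>. fst (polling_state d tb x0 j0 \<omega> n)) \<in> borel_measurable M \<and>
   (\<lambda>\<omega>. snd (polling_state d tb x0 j0 \<omega> n)) \<in> M \<rightarrow>\<^sub>M count_space UNIV"
proof (induction n)
  case 0
  then show ?case by (simp add: polling_state_def)
next
  case (Suc n)
  have S: "polling_state d tb x0 j0 \<omega> (Suc n) = fst (polling_step d tb x0 \<omega> (polling_state d tb x0 j0 \<omega> n))" for \<omega>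
    by (simp add: polling_state_def)
  show ?case unfolding S
    by (intro conjI polling_step_measurable(1,2) conjunct1[OF Suc.IH] conjunct2[OF Suc.IH])
qed

lemma switch_measurable:
  "(\<lambda>\<omega>. snd (polling_step d tb x0 \<omega> (polling_state d tb x0 j0 \<omega> n))) \<in> M \<rightarrow>\<^sub>M count_space UNIV"
  by (intro polling_step_measurable(3) conjunct1[OF polling_state_measurable] conjunct2[OF polling_state_measurable])

lemma switch_side_measurable: "(\<lambda>\<omega>. switch_side d tb x0 j0 \<omega> n) \<in> M \<rightarrow>\<^sub>M count_space UNIV"
  unfolding switch_side_def by (rule measurable_compose[OF switch_measurable]) simp

lemma zeta_measurable: "(\<lambda>\<omega>. zeta d tb x0 j0 \<omega> n) \<in> borel_measurable M"
  unfolding zeta_def switch_xi_def by (rule measurable_compose[OF switch_measurable]) simp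

lemma eventually_periodic_measurable:
  "{\<omega> \<in> space M. \<not> eventually_periodic (switch_side d tb x0 j0 \<omega>)} \<in> sets M"
proof -
  have [measurable]: "Measurable.pred M (\<lambda>\<omega>. switch_side d tb x0 j0 \<omega> m = switch_side d tb x0 j0 \<omega> n)" for m n
    by (rule measurable_count_space_combine[OF switch_side_measurable switch_side_measurable])
  show ?thesis unfolding eventually_periodic_def by measurable
qed

end

section \<open>Measurability of convergence onto a periodic orbit\<close>

lemma vec_nth_measurable: "(\<lambda>z::real^3. z $ i) \<in> borel_measurable borel"
  by (intro borel_measurable_continuous_onI continuous_intros)

lemma fj_measurable: "fj lam mu j \<in> borel_measurable borel"
proof -
  have "(\<lambda>z. (((mu j - lam j) * z $ i + lam i * z $ j) / ((mu j - lam j) + mu j * theta lam mu j * z $ j)) *\<^sub>R (axis i 1 :: real^3)) \<in> borel_measurable borel" for i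
    by (intro borel_measurable_scaleR borel_measurable_divide borel_measurable_add borel_measurable_times
        borel_measurable_diff borel_measurable_const vec_nth_measurable)
  then show ?thesis unfolding fj_def[abs_def] by (intro borel_measurable_sum)
qed

lemma A0i_measurable: "A0i i \<in> sets borel"
proof -
  note [measurable] = vec_nth_measurable
  have "A0i i = {z \<in> space borel. (\<Sum>l\<in>UNIV. z $ l) = 1 \<and> z $ i = 0 \<and> (\<forall>l\<in>UNIV. 0 \<le> z $ l)}"
    by (auto simp: A0i_def)
  also have "\<dots> \<in> sets borel" by measurable
  finally show ?thesis .
qed

lemma phi_measurable:
  assumes f [measurable]: "f \<in> borel_measurable M" "g \<in> borel_measurable M"
  shows "Measurable.pred M (\<lambda>x. g x \<in> phi lam mu d (f x))"
proof -
  note [measurable] = vec_nth_measurable fj_measurable A0i_measurable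
  have [measurable]: "Measurable.pred M (\<lambda>x. j \<in> rule_set d i (side_coord i (f x)))" for i j
    unfolding rule_set_def side_coord_def by measurable
  have "g x \<in> phi lam mu d (f x) \<longleftrightarrow> (\<exists>i\<in>UNIV. \<exists>j\<in>UNIV. f x \<in> A0i i \<and> j \<in> rule_set d i (side_coord i (f x)) \<and> g x = fj lam mu j (f x))" for x
    unfolding phi_def by auto
  then show ?thesis by (simp only:) measurable
qed

lemma periodic_orbit_cong:
  assumes "\<And>n. n \<in> {1..m} \<Longrightarrow> u n = v n"
  shows "periodic_orbit lam mu d m u \<longleftrightarrow> periodic_orbit lam mu d m v"
proof -
  have "1 \<le> m \<Longrightarrow> u 1 = v 1" "1 \<le> m \<Longrightarrow> u m = v m" "\<forall>n\<in>{1..m}. u n = v n"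
    "\<And>n. 1 \<le> n \<Longrightarrow> n < m \<Longrightarrow> u n = v n \<and> u (n + 1) = v (n + 1)" using assms by auto
  then show ?thesis unfolding periodic_orbit_def by (metis (no_types, lifting))
qed

text \<open>The quantifier over orbits u is uncountable. Convergence determines u on 1..m as limits
  of subsequences, so u is replaced by these limits and only the countable quantifiers over m and n0
  remain.\<close>

lemma (in coordinate_measurable) converges_measurable:
  "{\<omega> \<in> space M. \<exists>m u. periodic_orbit lam mu d m u \<and> converges_onto (zeta d tb x0 j0 \<omega>) m u} \<in> sets M"
proof -
  let ?w = "\<lambda>\<omega>. zeta d tb x0 j0 \<omega>"
  define v where "v \<omega> m n0 n = lim (\<lambda>t. ?w \<omega> (m * t + n + n0))" for \<omega> m n0 n
  have dist1: "(\<lambda>t. dist1 (w t) l) \<longlonglongrightarrow> 0 \<longleftrightarrow> w \<longlonglongrightarrow> l" for w :: "nat \<Rightarrow> real^3" and l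
  proof
    assume "(\<lambda>t. dist1 (w t) l) \<longlonglongrightarrow> 0"
    from tendsto_mult_right[OF this, of "sqrt 2"] have "(\<lambda>t. norm (w t - l)) \<longlonglongrightarrow> 0"
      by (simp add: dist1_def)
    then show "w \<longlonglongrightarrow> l" by (simp add: tendsto_norm_zero_iff LIM_zero_iff)
  next
    assume "w \<longlonglongrightarrow> l"
    then have "(\<lambda>t. norm (w t - l) / sqrt 2) \<longlonglongrightarrow> norm (l - l) / sqrt 2" by (intro tendsto_intros) auto
    then show "(\<lambda>t. dist1 (w t) l) \<longlonglongrightarrow> 0" by (simp add: dist1_def)
  qed
  have eq: "(\<exists>m u. periodic_orbit lam mu d m u \<and> converges_onto (?w \<omega>) m u) \<longleftrightarrow>
     (\<exists>m n0. (\<forall>n\<in>{1..m}. Cauchy (\<lambda>t. ?w \<omega> (m * t + n + n0))) \<and> periodic_orbit lam mu d m (v \<omega> m n0))" for \<omega>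
  proof
    assume "\<exists>m u. periodic_orbit lam mu d m u \<and> converges_onto (?w \<omega>) m u"
    then obtain m u n0 where u: "periodic_orbit lam mu d m u"
      "\<And>n. n \<in> {1..m} \<Longrightarrow> (\<lambda>t. ?w \<omega> (m * t + n + n0)) \<longlonglongrightarrow> u n"
      unfolding converges_onto_def dist1 by blast
    have "v \<omega> m n0 n = u n" if "n \<in> {1..m}" for n unfolding v_def by (rule limI[OF u(2)[OF that]])
    then have "periodic_orbit lam mu d m (v \<omega> m n0)" using periodic_orbit_cong u(1) by metis
    moreover have "\<forall>n\<in>{1..m}. Cauchy (\<lambda>t. ?w \<omega> (m * t + n + n0))" using u(2) LIMSEQ_imp_Cauchy by blast
    ultimately show "\<exists>m n0. (\<forall>n\<in>{1..m}. Cauchy (\<lambda>t. ?w \<omega> (m * t + n + n0))) \<and> periodic_orbit lam mu d m (v \<omega> m n0)"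
      by blast
  next
    assume "\<exists>m n0. (\<forall>n\<in>{1..m}. Cauchy (\<lambda>t. ?w \<omega> (m * t + n + n0))) \<and> periodic_orbit lam mu d m (v \<omega> m n0)"
    then obtain m n0 where m: "\<forall>n\<in>{1..m}. Cauchy (\<lambda>t. ?w \<omega> (m * t + n + n0))" "periodic_orbit lam mu d m (v \<omega> m n0)"
      by blast
    have "(\<lambda>t. ?w \<omega> (m * t + n + n0)) \<longlonglongrightarrow> v \<omega> m n0 n" if "n \<in> {1..m}" for n
      unfolding v_def using m(1) that Cauchy_convergent convergent_LIMSEQ_iff by blast
    then have "converges_onto (?w \<omega>) m (v \<omega> m n0)"
      unfolding converges_onto_def dist1 by blast
    then show "\<exists>m u. periodic_orbit lam mu d m u \<and> converges_onto (?w \<omega>) m u" using m(2) by blast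
  qed
  note [measurable] = zeta_measurable A0i_measurable
  have [measurable]: "Measurable.pred M (\<lambda>\<omega>. Cauchy (\<lambda>t. ?w \<omega> (m * t + n + n0)))" for m n n0
    unfolding pred_def by (rule sets_Collect_Cauchy) measurable
  have v [measurable]: "(\<lambda>\<omega>. v \<omega> m n0 n) \<in> borel_measurable M" for m n0 n
    unfolding v_def by (rule borel_measurable_lim_metric) measurable
  have [measurable]: "A0 \<in> sets borel" unfolding A0_def by (intro sets.finite_UN) (auto simp: A0i_measurable)
  have [measurable]: "Measurable.pred M (\<lambda>\<omega>. v \<omega> m n0 k \<in> phi lam mu d (v \<omega> m n0 n))" for m n0 n k
    by (rule phi_measurable) measurable
  show ?thesis unfolding eq unfolding periodic_orbit_def by measurable
qed

section \<open>Positive probability\<close>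

lemma exp_meas_facts:
  shows "service_law (exp_meas 1) 1" "AE x in exp_meas 1. 0 < x"
    "0 \<le> a \<Longrightarrow> a < b \<Longrightarrow> 0 < measure (exp_meas 1) {a<..b}"
proof -
  interpret prob_space "exp_meas 1" unfolding exp_meas_def by (rule prob_space_exponential_density) simp
  have sets [measurable_cong, simp]: "sets (exp_meas 1) = sets borel" by (simp add: exp_meas_def)
  have space [simp]: "space (exp_meas 1) = UNIV" by (simp add: exp_meas_def)
  have "distr (exp_meas 1) lborel (\<lambda>x. x) = exp_meas 1" by (rule distr_id2) simp
  then have dist: "distributed (exp_meas 1) lborel (\<lambda>x. x) (\<lambda>x. ennreal (exponential_density 1 x))"
    by (simp add: distributed_def exp_meas_def)
  have E: "expectation (\<lambda>x. x) = 1" using exponential_distributed_expectation[OF _ dist] by simp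
  have V: "expectation (\<lambda>x. (x - 1)\<^sup>2) = 1" using exponential_distributed_variance[OF _ dist] E by simp
  \<comment> \<open>A non-integrable function has Bochner integral 0, so a nonzero value proves
    integrability.\<close>
  have int: "integrable (exp_meas 1) (\<lambda>x. x)" using E not_integrable_integral_eq by fastforce
  have "integrable (exp_meas 1) (\<lambda>x. (x - 1)\<^sup>2)" using V not_integrable_integral_eq by fastforce
  then have "integrable (exp_meas 1) (\<lambda>x. (x - 1)\<^sup>2 + 2 * x - 1)" using int by auto
  moreover have "(\<lambda>x::real. (x - 1)\<^sup>2 + 2 * x - 1) = (\<lambda>x. x\<^sup>2)" by (auto simp: power2_diff)
  ultimately have int2: "integrable (exp_meas 1) (\<lambda>x. x\<^sup>2)" by simp
  have le: "prob {x. x \<le> a} = 1 - exp (- a)" if "0 \<le> a" for a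
    using exponential_distributedD_le[OF dist that] by simp
  have "prob {x \<in> space (exp_meas 1). x \<le> 0} = 0" using le[of 0] by simp
  then show AE0: "AE x in exp_meas 1. 0 < x" by (subst (asm) prob_Collect_eq_0) (auto simp: not_le)
  then have "AE x in exp_meas 1. 0 \<le> x" by (rule AE_mp) (auto intro: AE_I2)
  then show "service_law (exp_meas 1) 1"
    unfolding service_law_def using E int int2 prob_space_axioms by simp
  show "0 < measure (exp_meas 1) {a<..b}" if "0 \<le> a" "a < b"
  proof -
    have eq: "{a<..b} = {..b} - {..a}" by auto
    have "prob {a<..b} = prob {..b} - prob {..a}"
      unfolding eq by (rule finite_measure_Diff) (use that in auto)
    then show ?thesis using le[of a] le[of b] that by (simp add: atMost_def)
  qed
qed

text \<open>A law carried by values up to 1/4 could not have mean 1/2; the mass beyond 1/4 is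
  exhausted by bounded intervals.\<close>

lemma service_head_likely:
  assumes "service_law D 2"
  shows "\<exists>B0. \<forall>B\<ge>B0. 0 < measure D {1/4<..B}"
proof -
  have D: "prob_space D" and s [measurable_cong, simp]: "sets D = sets borel" and int: "integrable D (\<lambda>x. x)" and m: "(\<integral>x. x \<partial>D) = 1/2"
    using assms by (auto simp: service_law_def)
  interpret prob_space D by fact
  have [simp]: "space D = UNIV" using sets_eq_imp_space_eq[OF s] by simp
  have "prob {1/4<..} \<noteq> 0"
  proof
    assume z: "prob {1/4<..} = 0"
    have eq: "{x \<in> space D. 1/4 < x} = {1/4<..}" by auto
    have "prob {x \<in> space D. 1/4 < x} = 0" unfolding eq by (rule z)
    then have "AE x in D. x \<le> 1/4" by (subst (asm) prob_Collect_eq_0) (auto simp: not_less)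
    then have "(\<integral>x. x \<partial>D) \<le> (\<integral>x. 1/4 \<partial>D)" by (intro integral_mono_AE int) auto
    moreover have "prob UNIV = 1" using prob_space by simp
    ultimately show False using m by simp
  qed
  then have pos: "0 < prob {1/4<..}" using measure_nonneg[of D "{1/4<..}"] by linarith
  have "(\<lambda>n. prob {1/4<..real n}) \<longlonglongrightarrow> prob (\<Union>n. {1/4<..real n})"
    by (rule finite_Lim_measure_incseq) (auto simp: incseq_def)
  moreover have "(\<Union>n. {1/4<..real n}) = {1/4<..}" using real_arch_simple by auto
  ultimately have "(\<lambda>n. prob {1/4<..real n}) \<longlonglongrightarrow> prob {1/4<..}" by simp
  then have "\<forall>\<^sub>F n in sequentially. 0 < prob {1/4<..real n}" using pos by (rule order_tendstoD)
  then obtain n where n: "0 < prob {1/4<..real n}" using eventually_happens' sequentially_bot by blast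
  have "0 < prob {1/4<..B}" if "real n \<le> B" for B
  proof -
    have "prob {1/4<..real n} \<le> prob {1/4<..B}" by (rule finite_measure_mono) (use that in auto)
    then show ?thesis using n by linarith
  qed
  then show ?thesis by blast
qed

lemma ex_uniform_bound:
  fixes P :: "'i :: finite \<Rightarrow> real \<Rightarrow> bool"
  assumes "\<And>i. \<exists>b. \<forall>x\<ge>b. P i x"
  shows "\<exists>b. \<forall>x\<ge>b. \<forall>i. P i x"
proof -
  obtain b where b: "\<And>i x. b i \<le> x \<Longrightarrow> P i x" using assms by metis
  have "P i x" if "(\<Sum>i\<in>UNIV. \<bar>b i\<bar>) \<le> x" for i x
  proof (rule b)
    have "\<bar>b i\<bar> \<le> (\<Sum>i\<in>UNIV. \<bar>b i\<bar>)" by (rule member_le_sum) auto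
    then show "b i \<le> x" using that by linarith
  qed
  then show ?thesis by blast
qed

lemma (in prob_space) prob_Int_finite_ge:
  assumes "finite J" "\<And>j. j \<in> J \<Longrightarrow> A j \<in> events" "\<And>j. j \<in> J \<Longrightarrow> 1 - c \<le> prob (A j)"
  shows "1 - real (card J) * c \<le> prob {x \<in> space M. \<forall>j\<in>J. x \<in> A j}"
proof -
  have set: "{x \<in> space M. \<forall>j\<in>J. x \<in> A j} \<in> events" using assms(1,2) by measurable
  have "space M - {x \<in> space M. \<forall>j\<in>J. x \<in> A j} = (\<Union>j\<in>J. space M - A j)" by auto
  then have "1 - prob {x \<in> space M. \<forall>j\<in>J. x \<in> A j} = prob (\<Union>j\<in>J. space M - A j)"
    using prob_compl[OF set] by simp
  also have "\<dots> \<le> (\<Sum>j\<in>J. prob (space M - A j))"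
    by (rule finite_measure_subadditive_finite) (use assms in auto)
  also have "\<dots> \<le> (\<Sum>j\<in>J. c)"
  proof (rule sum_mono)
    fix j assume "j \<in> J"
    then show "prob (space M - A j) \<le> c" using prob_compl[OF assms(2)] assms(3)[of j] by simp
  qed
  finally show ?thesis by simp
qed

text \<open>Coordinates picked by an injection and sharing one law form an i.i.d. sequence again, so
  estimates on sequence space apply to the tails of a sample point.\<close>

lemma measure_PiM_reindex:
  fixes M :: "'i \<Rightarrow> 'a measure" and f :: "'j \<Rightarrow> 'i"
  assumes M: "\<And>x. prob_space (M x)" and f: "inj f" "\<And>l. M (f l) = N"
    and P: "{y \<in> space (PiM UNIV (\<lambda>_. N)). P y} \<in> sets (PiM UNIV (\<lambda>_. N))"
  shows "measure (PiM UNIV M) {\<omega> \<in> space (PiM UNIV M). P (\<lambda>l. \<omega> (f l))} =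
    measure (PiM UNIV (\<lambda>_. N)) {y \<in> space (PiM UNIV (\<lambda>_. N)). P y}"
proof -
  have distr: "distr (PiM UNIV M) (PiM UNIV (\<lambda>_. N)) (\<lambda>\<omega> l. \<omega> (f l)) = PiM UNIV (\<lambda>_. N)"
    using distr_PiM_reindex[of UNIV M f UNIV] M f by (simp add: restrict_def)
  have meas: "(\<lambda>\<omega> l. \<omega> (f l)) \<in> PiM UNIV M \<rightarrow>\<^sub>M PiM UNIV (\<lambda>_. N)"
  proof (rule measurable_PiM_single')
    show "(\<lambda>\<omega>. \<omega> (f l)) \<in> PiM UNIV M \<rightarrow>\<^sub>M N" for l
      using measurable_component_singleton[of "f l" UNIV M] f(2)[of l] by simp
  qed (auto simp: space_PiM PiE_def extensional_def Pi_def, metis f(2))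
  have "measure (PiM UNIV (\<lambda>_. N)) {y \<in> space (PiM UNIV (\<lambda>_. N)). P y} =
    measure (distr (PiM UNIV M) (PiM UNIV (\<lambda>_. N)) (\<lambda>\<omega> l. \<omega> (f l))) {y \<in> space (PiM UNIV (\<lambda>_. N)). P y}"
    by (simp only: distr)
  also have "\<dots> = measure (PiM UNIV M) ((\<lambda>\<omega> l. \<omega> (f l)) -` {y \<in> space (PiM UNIV (\<lambda>_. N)). P y} \<inter> space (PiM UNIV M))"
    by (rule measure_distr[OF meas P])
  also have "(\<lambda>\<omega> l. \<omega> (f l)) -` {y \<in> space (PiM UNIV (\<lambda>_. N)). P y} \<inter> space (PiM UNIV M) =
    {\<omega> \<in> space (PiM UNIV M). P (\<lambda>l. \<omega> (f l))}"
    using measurable_space[OF meas] by auto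
  finally show ?thesis by simp
qed

text \<open>Events that depend on the disjoint coordinate sets F and - F are independent. Dependence
  is expressed as invariance under \<open>restrict\<close>.\<close>

lemma prob_PiM_split:
  fixes M :: "'i \<Rightarrow> 'a measure"
  assumes M: "\<And>x. prob_space (M x)"
    and A: "{z \<in> space (PiM F M). P z} \<in> sets (PiM F M)"
    and B: "{z \<in> space (PiM (- F) M). R z} \<in> sets (PiM (- F) M)"
    and P: "\<And>\<omega>. P (restrict \<omega> F) = P \<omega>" and R: "\<And>\<omega>. R (restrict \<omega> (- F)) = R \<omega>"
  shows "measure (PiM UNIV M) {\<omega> \<in> space (PiM UNIV M). P \<omega> \<and> R \<omega>} =
    measure (PiM UNIV M) {\<omega> \<in> space (PiM UNIV M). P \<omega>} * measure (PiM UNIV M) {\<omega> \<in> space (PiM UNIV M). R \<omega>}"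
proof -
  interpret prob_space "PiM UNIV M" by (rule prob_space_PiM) (rule M)
  define K where "K b = (if b then F else - F)" for b
  define E where "E b = (if b then {z \<in> space (PiM F M). P z} else {z \<in> space (PiM (- F) M). R z})" for b
  have ind: "indep_vars (\<lambda>b. PiM (K b) M) (\<lambda>b \<omega>. \<lambda>i\<in>K b. \<omega> i) UNIV"
    by (rule indep_vars_restrict[OF indep_vars_PiM_coordinates])
      (use M in \<open>auto simp: K_def disjoint_family_on_def\<close>)
  have "prob (\<Inter>b\<in>UNIV. (\<lambda>\<omega>. \<lambda>i\<in>K b. \<omega> i) -` E b \<inter> space (PiM UNIV M)) =
    (\<Prod>b\<in>UNIV. prob ((\<lambda>\<omega>. \<lambda>i\<in>K b. \<omega> i) -` E b \<inter> space (PiM UNIV M)))"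
    by (rule indep_varsD[OF ind]) (use A B in \<open>auto simp: K_def E_def\<close>)
  moreover have "(\<lambda>\<omega>. \<lambda>i\<in>K True. \<omega> i) -` E True \<inter> space (PiM UNIV M) = {\<omega> \<in> space (PiM UNIV M). P \<omega>}"
    by (auto simp: K_def E_def P space_PiM)
  moreover have "(\<lambda>\<omega>. \<lambda>i\<in>K False. \<omega> i) -` E False \<inter> space (PiM UNIV M) = {\<omega> \<in> space (PiM UNIV M). R \<omega>}"
    by (auto simp: K_def E_def R space_PiM)
  moreover have "{\<omega> \<in> space (PiM UNIV M). R \<omega>} \<inter> {\<omega> \<in> space (PiM UNIV M). P \<omega>} = {\<omega> \<in> space (PiM UNIV M). P \<omega> \<and> R \<omega>}"
    by auto
  ultimately show ?thesis by (simp add: UNIV_bool mult.commute)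
qed

section \<open>The event of a prescribed start\<close>

definition coordinate_law :: "(3 \<Rightarrow> real measure) \<Rightarrow> (3 \<times> nat) + (3 \<times> nat) \<Rightarrow> real measure" where
  "coordinate_law D x = (case x of Inl (i, k) \<Rightarrow> exp_meas 1 | Inr (i, k) \<Rightarrow> D i)"

lemma coordinate_law_simps [simp]:
  "coordinate_law D (Inl p) = exp_meas 1" "coordinate_law D (Inr p) = D (fst p)"
  by (auto simp: coordinate_law_def split: prod.split)

lemma polling_space_eq: "polling_space (\<lambda>_. 1) D = PiM UNIV (coordinate_law D)"
  unfolding polling_space_def coordinate_law_def[abs_def] by simp

lemma coordinate_law_cases:
  assumes "\<And>i. service_law (D i) 2"
  shows "prob_space (coordinate_law D x)" "sets (coordinate_law D x) = sets borel"
  using assms exp_meas_facts(1) by (cases x; auto simp: service_law_def)+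

lemma component_measurable:
  assumes "\<And>i. service_law (D i) 2" "x \<in> J"
  shows "(\<lambda>z. z x) \<in> borel_measurable (PiM J (coordinate_law D))"
proof -
  have "(\<lambda>z. z x) \<in> PiM J (coordinate_law D) \<rightarrow>\<^sub>M coordinate_law D x"
    by (rule measurable_component_singleton[OF assms(2)])
  then show ?thesis
    by (simp only: measurable_cong_sets[OF refl coordinate_law_cases(2)[OF assms(1)]])
qed

lemma coordinate_measurable_polling_space:
  assumes "\<And>i. service_law (D i) 2"
  shows "coordinate_measurable (polling_space (\<lambda>_. 1) D)"
  by unfold_locales (simp add: polling_space_eq component_measurable assms)

definition tracked :: "(3 \<Rightarrow> real) \<Rightarrow> ((3 \<Rightarrow> nat) \<Rightarrow> 3 \<Rightarrow> bool) \<Rightarrow> (3 \<Rightarrow> nat) \<Rightarrow> 3 \<Rightarrow> real \<Rightarrow> smp \<Rightarrow> bool" where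
  "tracked d tb x0 j0 p \<omega> \<longleftrightarrow> (\<exists>s x e n1. tracks d e s x \<and> (\<forall>k. e k \<le> 1/2500) \<and> e \<longlonglongrightarrow> 0 \<and>
     s 0 = first_served d tb x0 j0 \<and> \<bar>x 0 - p\<bar> \<le> 1/2500 \<and>
     (\<forall>k. switch_side d tb x0 j0 \<omega> (k + Suc n1) = s k) \<and> (\<forall>k. zeta d tb x0 j0 \<omega> (k + Suc n1) = side_point (s k) (x k)))"

text \<open>A head event confines finitely many independent coordinates to sets of positive
  probability; the tail event has positive probability by the strong law. They use disjoint
  coordinates, so their probabilities multiply.\<close>

lemma tracking_event:
  fixes D :: "3 \<Rightarrow> real measure" and p :: real
  assumes D: "\<And>i. service_law (D i) 2" and d: "\<And>i. 1/3 \<le> d i" "\<And>i. d i \<le> 2/3"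
    and p: "0 \<le> p" "p \<le> 1"
  shows "\<exists>A\<in>sets (polling_space (\<lambda>_. 1) D). 0 < measure (polling_space (\<lambda>_. 1) D) A \<and>
    (\<forall>\<omega>\<in>A. tracked d tb x0 j0 p \<omega>)"
proof -
  define j1 where "j1 = first_served d tb x0 j0"
  let ?M = "coordinate_law D"
  let ?\<Omega> = "PiM UNIV ?M"
  let ?R = "\<lambda>N. PiM (UNIV :: nat set) (\<lambda>_. N :: real measure)"
  note law = coordinate_law_cases[OF D]
  interpret product_prob_space ?M UNIV by (rule product_prob_spaceI) (rule law(1))
  interpret prob_space ?\<Omega> by (rule prob_space_PiM) (rule law(1))
  obtain K1 where K1: "\<forall>K\<ge>K1. 9/10 \<le> measure (?R (exp_meas 1)) {y \<in> space (?R (exp_meas 1)). tail_ok (1/1) K y}"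
    using tail_ok_likely[OF exp_meas_facts(1)] by blast
  have "\<exists>K2. \<forall>K\<ge>K2. \<forall>i. 9/10 \<le> measure (?R (D i)) {y \<in> space (?R (D i)). tail_ok (1/2) K y}"
    by (rule ex_uniform_bound) (rule tail_ok_likely[OF D])
  then obtain K2 where K2: "\<forall>K\<ge>K2. \<forall>i. 9/10 \<le> measure (?R (D i)) {y \<in> space (?R (D i)). tail_ok (1/2) K y}"
    by blast
  define K where "K = max K1 K2"
  have "\<exists>B0. \<forall>B\<ge>B0. \<forall>i. 0 < measure (D i) {1/4<..B}"
    by (rule ex_uniform_bound) (rule service_head_likely[OF D])
  then obtain B where B: "\<And>i. 0 < measure (D i) {1/4<..B}" by blast
  \<comment> \<open>K and B are fixed before N, which is possible since the law of a tail does not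
    depend on where the tail begins. The factor 2000000 is the inverse of the slope in
    \<open>tail_ok\<close>.\<close>
  define N where "N = 2000000 * (2 * K + B + (1 + (\<Sum>i\<in>UNIV. real (x0 i))) + 3)"
  define n :: "3 \<Rightarrow> nat" where "n i = nat \<lfloor>(if i = j1 + 1 then 1 - p else if i = j1 + 2 then p else 0) * N\<rfloor> + 1" for i
  \<comment> \<open>First arrivals come by 1/8, and the other n i - 1 interarrival times add at most
    1/8, so the burst is complete at 1/4. The bound 1/16 makes j1 the queue of the first arrival,
    and the first services outlast the burst.\<close>
  define box where "box x = (case x of Inl (i, k) \<Rightarrow>
      if k = 0 then (if i = j1 then {0<..1/16} else {1/16<..1/8}) else {0<..1 / (8 * real (n i))}
    | Inr _ \<Rightarrow> {1/4<..B})" for x :: "(3 \<times> nat) + (3 \<times> nat)"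
  define F where "F = Inl ` (SIGMA i:UNIV. {..<n i}) \<union> range (\<lambda>i :: 3. Inr (i, 0 :: nat))"
  have F_iff [simp]: "Inl (i, k) \<in> F \<longleftrightarrow> k < n i" "Inr (i, k) \<in> F \<longleftrightarrow> k = 0" for i k
    by (auto simp: F_def)
  have finF: "finite F" unfolding F_def by (intro finite_UnI finite_imageI finite_SigmaI) auto
  define P where "P \<omega> \<longleftrightarrow> (\<forall>x\<in>F. \<omega> x \<in> box x)" for \<omega> :: smp
  define T where "T \<omega> \<longleftrightarrow> (\<forall>i. tail_ok 1 K (\<lambda>l. \<omega> (Inl (i, n i + l))) \<and> tail_ok (1/2) K (\<lambda>l. \<omega> (Inr (i, Suc l))))" for \<omega> :: smp
  define pos where "pos \<omega> \<longleftrightarrow> (\<forall>i k. 0 < \<omega> (Inl (i, k)) \<and> 0 \<le> \<omega> (Inr (i, k)))" for \<omega> :: smp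
  have box_borel: "box x \<in> sets borel" for x by (auto simp: box_def split: sum.split prod.split)
  have box_pos: "0 < measure (?M x) (box x)" if "x \<in> F" for x
    using exp_meas_facts(3) B that by (auto simp: box_def coordinate_law_def n_def split: sum.split prod.split)
  have P_sets: "{z \<in> space (PiM J ?M). P z} \<in> sets (PiM J ?M)" if "F \<subseteq> J" for J
    unfolding P_def
  proof (rule sets.sets_Collect_finite_All'[OF _ finF])
    fix x assume "x \<in> F"
    then have "(\<lambda>z. z x) \<in> borel_measurable (PiM J ?M)"
      by (intro component_measurable[OF D] subsetD[OF that])
    from measurable_sets[OF this box_borel[of x]] show "{z \<in> space (PiM J ?M). z x \<in> box x} \<in> sets (PiM J ?M)"
      by (simp add: vimage_def Int_def conj_commute)
  qed (simp add: F_def)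
  have tail_sets: "Measurable.pred (PiM J ?M) (\<lambda>z. tail_ok 1 K (\<lambda>l. z (Inl (i, n i + l))))"
    "Measurable.pred (PiM J ?M) (\<lambda>z. tail_ok (1/2) K (\<lambda>l. z (Inr (i, Suc l))))" if "- F \<subseteq> J" for J i
    by (intro measurable_tail_ok component_measurable[OF D] subsetD[OF that]; simp)+
  have T_sets: "{z \<in> space (PiM J ?M). T z} \<in> sets (PiM J ?M)" if "- F \<subseteq> J" for J
  proof -
    note [measurable] = tail_sets[OF that]
    show ?thesis unfolding T_def by measurable
  qed
  have "emeasure ?\<Omega> {\<omega> \<in> space ?\<Omega>. P \<omega>} = (\<Prod>x\<in>F. emeasure (?M x) (box x))"
    unfolding P_def by (rule emeasure_PiM_Collect) (use finF law(2) box_borel in auto)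
  also have "\<dots> \<noteq> 0"
  proof -
    have "emeasure (?M x) (box x) \<noteq> 0" if "x \<in> F" for x using box_pos[OF that] by (auto simp: measure_def)
    then show ?thesis using finF by (simp add: prod_zero_iff)
  qed
  finally have P_pos: "0 < measure ?\<Omega> {\<omega> \<in> space ?\<Omega>. P \<omega>}"
    unfolding emeasure_eq_measure by (simp add: zero_less_measure_iff)
  define G where "G j = (case j of (b, i) \<Rightarrow> if b then {\<omega> \<in> space ?\<Omega>. tail_ok 1 K (\<lambda>l. \<omega> (Inl (i, n i + l)))}
    else {\<omega> \<in> space ?\<Omega>. tail_ok (1/2) K (\<lambda>l. \<omega> (Inr (i, Suc l)))})" for j :: "bool \<times> 3"
  have G_sets: "G j \<in> sets ?\<Omega>" for j
    using tail_sets[of UNIV "snd j"] by (auto simp: G_def pred_def split: prod.split)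
  have tail_R: "{y \<in> space (?R N'). tail_ok m K y} \<in> sets (?R N')" if "sets N' = sets borel" for m N'
  proof -
    have "(\<lambda>y. y l) \<in> borel_measurable (?R N')" for l
      using measurable_component_singleton[of l UNIV "\<lambda>_. N'"] by (simp only: measurable_cong_sets[OF refl that] UNIV_I)
    then have "Measurable.pred (?R N') (\<lambda>y. tail_ok m K y)" by (rule measurable_tail_ok)
    then show ?thesis by (simp add: pred_def)
  qed
  have G_prob: "1 - 1/10 \<le> measure ?\<Omega> (G j)" for j
  proof -
    obtain b i where j: "j = (b, i)" by (cases j)
    show ?thesis
    proof (cases b)
      case True
      have "measure ?\<Omega> {\<omega> \<in> space ?\<Omega>. tail_ok 1 K (\<lambda>l. \<omega> (Inl (i, n i + l)))} =
        measure (?R (exp_meas 1)) {y \<in> space (?R (exp_meas 1)). tail_ok 1 K y}"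
        by (rule measure_PiM_reindex[OF law(1)])
          (auto simp: inj_def intro!: tail_R simp: exp_meas_def)
      moreover have "9/10 \<le> measure (?R (exp_meas 1)) {y \<in> space (?R (exp_meas 1)). tail_ok 1 K y}"
        using K1 by (simp add: K_def)
      ultimately show ?thesis using True by (simp add: G_def j)
    next
      case False
      have "measure ?\<Omega> {\<omega> \<in> space ?\<Omega>. tail_ok (1/2) K (\<lambda>l. \<omega> (Inr (i, Suc l)))} =
        measure (?R (D i)) {y \<in> space (?R (D i)). tail_ok (1/2) K y}"
      proof (rule measure_PiM_reindex[OF law(1)])
        show "{y \<in> space (?R (D i)). tail_ok (1/2) K y} \<in> sets (?R (D i))"
          by (rule tail_R) (use D[of i] in \<open>simp add: service_law_def\<close>)
      qed (auto simp: inj_def)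
      moreover have "9/10 \<le> measure (?R (D i)) {y \<in> space (?R (D i)). tail_ok (1/2) K y}"
        using K2 by (simp add: K_def)
      ultimately show ?thesis using False by (simp add: G_def j)
    qed
  qed
  \<comment> \<open>Two tails for each of three queues, each failing with probability at most
    1/10.\<close>
  have "1 - real (card (UNIV :: (bool \<times> 3) set)) * (1/10) \<le> measure ?\<Omega> {\<omega> \<in> space ?\<Omega>. \<forall>j\<in>UNIV. \<omega> \<in> G j}"
    by (rule prob_Int_finite_ge) (use G_sets G_prob in auto)
  moreover have "{\<omega> \<in> space ?\<Omega>. \<forall>j\<in>UNIV. \<omega> \<in> G j} = {\<omega> \<in> space ?\<Omega>. T \<omega>}"
    by (auto simp: G_def T_def)
  moreover have "card (UNIV :: (bool \<times> 3) set) = 6" by simp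
  ultimately have T_pos: "0 < measure ?\<Omega> {\<omega> \<in> space ?\<Omega>. T \<omega>}" by simp
  have PT: "0 < measure ?\<Omega> {\<omega> \<in> space ?\<Omega>. P \<omega> \<and> T \<omega>}"
    using P_pos T_pos
    by (subst prob_PiM_split[OF law(1) P_sets[OF order_refl] T_sets[OF order_refl]])
      (simp_all add: P_def T_def)
  have "AE \<omega> in ?\<Omega>. 0 < \<omega> (Inl q)" for q
    by (rule AE_PiM_component[OF law(1) UNIV_I]) (unfold coordinate_law_simps, rule exp_meas_facts(2))
  moreover have "AE \<omega> in ?\<Omega>. 0 \<le> \<omega> (Inr q)" for q
    by (rule AE_PiM_component[OF law(1) UNIV_I])
      (use D[of "fst q"] in \<open>unfold coordinate_law_simps service_law_def, blast\<close>)
  ultimately have AE_pos: "AE \<omega> in ?\<Omega>. pos \<omega>"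
    unfolding pos_def AE_all_countable by simp
  define A where "A = {\<omega> \<in> space ?\<Omega>. (P \<omega> \<and> T \<omega>) \<and> pos \<omega>}"
  have PT_sets: "{\<omega> \<in> space ?\<Omega>. P \<omega> \<and> T \<omega>} \<in> sets ?\<Omega>"
    by (rule sets.sets_Collect_conj[OF T_sets P_sets]) simp_all
  have pos_sets: "{\<omega> \<in> space ?\<Omega>. pos \<omega>} \<in> sets ?\<Omega>"
  proof -
    have [measurable]: "(\<lambda>\<omega>. \<omega> (Inl q)) \<in> borel_measurable ?\<Omega>" "(\<lambda>\<omega>. \<omega> (Inr q)) \<in> borel_measurable ?\<Omega>" for q
      by (rule component_measurable[OF D], simp)+
    show ?thesis unfolding pos_def by measurable
  qed
  have A_sets: "A \<in> sets ?\<Omega>"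
    unfolding A_def by (rule sets.sets_Collect_conj[OF pos_sets PT_sets])
  have "measure ?\<Omega> A = measure ?\<Omega> {\<omega> \<in> space ?\<Omega>. P \<omega> \<and> T \<omega>}"
    by (rule finite_measure_eq_AE[OF _ A_sets PT_sets]) (use AE_pos in \<open>auto simp: A_def\<close>)
  then have A_pos: "0 < measure ?\<Omega> A" using PT by simp
  have "tracked d tb x0 j0 p \<omega>" if \<omega>: "\<omega> \<in> A" for \<omega>
  proof -
    have inl: "\<omega> (Inl (i, k)) \<in> box (Inl (i, k))" if "k < n i" for i k
      using \<omega> that by (auto simp: A_def P_def)
    have inr: "\<omega> (Inr (i, 0)) \<in> {1/4<..B}" for i
    proof -
      have "\<omega> (Inr (i, 0)) \<in> box (Inr (i, 0))"
        using \<omega> F_iff(2)[of i 0] unfolding A_def P_def by blast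
      then show ?thesis by (simp add: box_def)
    qed
    have n0: "0 < n i" for i by (simp add: n_def)
    have first: "\<omega> (Inl (i, 0)) \<in> (if i = j1 then {0<..1/16} else {1/16<..1/8})" for i
      using inl[of 0 i] n0[of i] by (simp add: box_def)
    have arr: "arrival_time \<omega> i (n i) \<le> 1/4" for i
    proof -
      obtain m where m: "n i = Suc m" using n0[of i] gr0_implies_Suc by blast
      have "\<omega> (Inl (i, Suc l)) \<le> 1 / (8 * real (n i))" if "l < m" for l
        using inl[of "Suc l" i] that m by (simp add: box_def)
      then have "(\<Sum>l<m. \<omega> (Inl (i, Suc l))) \<le> (\<Sum>l<m. 1 / (8 * real (n i)))" by (intro sum_mono) auto
      also have "\<dots> \<le> 1/8" using m by (simp add: field_simps)
      finally have "(\<Sum>l<m. \<omega> (Inl (i, Suc l))) \<le> 1/8" .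
      moreover have "\<omega> (Inl (i, 0)) \<le> 1/8" using first[of i] by (auto split: if_splits)
      ultimately show ?thesis unfolding arrival_time_def m sum.lessThan_Suc_shift by simp
    qed
    show ?thesis
    proof (rule good_path[where \<omega> = \<omega> and d = d and tb = tb and ?x0.0 = x0 and ?j0.0 = j0 and p = p and n = n and N = N and K = K and B = B])
      show "0 < \<omega> (Inl (i, k))" "0 \<le> \<omega> (Inr (i, k))" for i k using \<omega> by (auto simp: A_def pos_def)
      show "j1 = first_served d tb x0 j0" by (rule j1_def)
      show "\<omega> (Inl (j1, 0)) \<le> 1/16" using first[of j1] by simp
      show "1/16 < \<omega> (Inl (l, 0))" if "l \<noteq> j1" for l using first[of l] that by simp
      show "1/4 \<le> \<omega> (Inr (i, 0))" "\<omega> (Inr (i, 0)) \<le> B" for i using inr[of i] by auto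
      show "tail_ok 1 K (\<lambda>l. \<omega> (Inl (i, n i + l)))" "tail_ok (1/2) K (\<lambda>l. \<omega> (Inr (i, Suc l)))" for i
        using \<omega> by (auto simp: A_def T_def)
      show "2 * K + B + (1 + (\<Sum>i\<in>UNIV. real (x0 i))) + 3 \<le> 1/2000000 * N" by (simp add: N_def)
      show "n i = nat \<lfloor>(if i = j1 + 1 then 1 - p else if i = j1 + 2 then p else 0) * N\<rfloor> + 1" for i
        by (rule n_def)
      fix s x e n1
      assume "tracks d e s x" "\<And>k. e k \<le> 1/2500" "e \<longlonglongrightarrow> 0" "s 0 = j1" "\<bar>x 0 - p\<bar> \<le> 1/2500"
        "\<And>k. switch_side d tb x0 j0 \<omega> (k + Suc n1) = s k" "\<And>k. zeta d tb x0 j0 \<omega> (k + Suc n1) = side_point (s k) (x k)"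
      then show ?thesis unfolding tracked_def j1_def by blast
    qed (rule d p arr)+
  qed
  then show ?thesis unfolding polling_space_eq using A_sets A_pos by blast
qed

lemma thresholds_bounds:
  assumes "2/5 \<le> D" "D \<le> 3/5"
  shows "1/3 \<le> thresholds D i" "thresholds D i \<le> 2/3"
  using assms by (auto simp: thresholds_def)

lemma eventually_periodic_shift:
  assumes "\<And>k. f (k + c) = g k" "eventually_periodic f"
  shows "eventually_periodic g"
proof -
  obtain N p where "0 < p" "\<And>n. N \<le> n \<Longrightarrow> f (n + p) = f n"
    using assms(2) unfolding eventually_periodic_def by blast
  then have "g (n + p) = g n" if "N \<le> n" for n
    using that assms(1)[of n] assms(1)[of "n + p"] by (metis add.assoc add.commute trans_le_add1)
  then show ?thesis using \<open>0 < p\<close> unfolding eventually_periodic_def by blast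
qed

theorem theorem3p5:
  shows "\<exists>(lam::3 \<Rightarrow> real) (mu::3 \<Rightarrow> real) (d::3 \<Rightarrow> real).
    (\<forall>i. 0 < lam i \<and> 0 < mu i \<and> lam i / mu i < 1) \<and> (\<Sum>i\<in>UNIV. lam i / mu i) > 1 \<and>
    (\<forall>i. 0 < d i \<and> d i < 1) \<and>
    (\<forall>(D::3 \<Rightarrow> real measure) (x0::3 \<Rightarrow> nat) (j0::3) (tb::(3 \<Rightarrow> nat) \<Rightarrow> 3 \<Rightarrow> bool).
       (\<forall>i. service_law (D i) (mu i)) \<longrightarrow>
       measure (polling_space lam D)
         {\<omega> \<in> space (polling_space lam D). \<not> eventually_periodic (switch_side d tb x0 j0 \<omega>)} > 0 \<and>
       measure (polling_space lam D)
         {\<omega> \<in> space (polling_space lam D). \<exists>m u. periodic_orbit lam mu d m u \<and>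
             converges_onto (zeta d tb x0 j0 \<omega>) m u} > 0)"
proof -
  obtain D0 where D0: "2/5 \<le> D0" "D0 \<le> 3/5"
    and aper: "\<And>q Y p. cut_orbit D0 q Y \<Longrightarrow> 0 < p \<Longrightarrow> (\<And>n. q (n + p) = q n) \<Longrightarrow> False"
    using aperiodic_cut_exists by blast
  define d where "d = thresholds D0"
  have d: "1/3 \<le> d i" "d i \<le> 2/3" for i unfolding d_def by (rule thresholds_bounds[OF D0])+
  have main: "0 < measure (polling_space (\<lambda>_. 1) D)
         {\<omega> \<in> space (polling_space (\<lambda>_. 1) D). \<not> eventually_periodic (switch_side d tb x0 j0 \<omega>)} \<and>
       0 < measure (polling_space (\<lambda>_. 1) D)
         {\<omega> \<in> space (polling_space (\<lambda>_. 1) D). \<exists>m u. periodic_orbit (\<lambda>_. 1) (\<lambda>_. 2) d m u \<and>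
             converges_onto (zeta d tb x0 j0 \<omega>) m u}"
    if D: "\<And>i. service_law (D i) 2" for D :: "3 \<Rightarrow> real measure" and x0 j0 tb
  proof
    let ?\<Omega> = "polling_space (\<lambda>_. 1) D"
    interpret coordinate_measurable ?\<Omega> by (rule coordinate_measurable_polling_space[OF D])
    interpret prob_space ?\<Omega>
      unfolding polling_space_eq by (rule prob_space_PiM) (rule coordinate_law_cases(1)[OF D])
    have mono: "0 < measure ?\<Omega> E" if "A \<in> sets ?\<Omega>" "0 < measure ?\<Omega> A" "E \<in> sets ?\<Omega>" "A \<subseteq> E" for A E
      using finite_measure_mono[OF that(4,3)] that(2) by linarith
    define j1 where "j1 = first_served d tb x0 j0"
    \<comment> \<open>The values 1/3 and 2/3 are the images of 1/2 under \<open>fwd\<close> and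
      \<open>bwd\<close>; each lies in the interval of its side with a margin above 1/2500.\<close>
    define p :: real where "p = (if j1 = 3 then 1/2 else if j1 = 1 then 1/3 else 2/3)"
    have p: "0 \<le> p" "p \<le> 1" by (auto simp: p_def)
    obtain A where A: "A \<in> sets ?\<Omega>" "0 < measure ?\<Omega> A" and trk: "\<And>\<omega>. \<omega> \<in> A \<Longrightarrow> tracked d tb x0 j0 p \<omega>"
      using tracking_event[of D d p tb x0 j0, OF D d p] by blast
    show "0 < measure ?\<Omega> {\<omega> \<in> space ?\<Omega>. \<not> eventually_periodic (switch_side d tb x0 j0 \<omega>)}"
    proof (rule mono[OF A eventually_periodic_measurable], rule subsetI)
      fix \<omega> assume \<omega>: "\<omega> \<in> A"
      obtain s x e n1 where t: "tracks d e s x" "\<forall>k. e k \<le> 1/2500" "e \<longlonglongrightarrow> 0"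
        "s 0 = j1" "\<bar>x 0 - p\<bar> \<le> 1/2500" "\<forall>k. switch_side d tb x0 j0 \<omega> (k + Suc n1) = s k"
        using trk[OF \<omega>] unfolding tracked_def j1_def by blast
      interpret cut_tracking D0 e s x
        by unfold_locales (use D0 t(1,2) in \<open>simp_all add: d_def\<close>)
      have "p - 1/2500 \<le> x 0" "x 0 \<le> p + 1/2500" using t(5) by linarith+
      then have "in_cut_region (s 0) (x 0)"
        using exhaust_3[of j1] t(4) by (auto simp: in_cut_region_def p_def)
      then have "\<not> eventually_periodic s" by (rule cut_region_aperiodic[OF t(3) _ aper])
      then have "\<not> eventually_periodic (switch_side d tb x0 j0 \<omega>)"
        using eventually_periodic_shift[of "switch_side d tb x0 j0 \<omega>" "Suc n1" s] t(6) by blast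
      then show "\<omega> \<in> {\<omega> \<in> space ?\<Omega>. \<not> eventually_periodic (switch_side d tb x0 j0 \<omega>)}"
        using \<omega> sets.sets_into_space[OF A(1)] by blast
    qed
    \<comment> \<open>The forward cycle has the same position on every side, so one target near
      \<open>golden\<close> serves all j1.\<close>
    obtain A' where A': "A' \<in> sets ?\<Omega>" "0 < measure ?\<Omega> A'" and trk': "\<And>\<omega>. \<omega> \<in> A' \<Longrightarrow> tracked d tb x0 j0 (382/1000) \<omega>"
      using tracking_event[of D d "382/1000" tb x0 j0, OF D d] by auto
    show "0 < measure ?\<Omega> {\<omega> \<in> space ?\<Omega>. \<exists>m u. periodic_orbit (\<lambda>_. 1) (\<lambda>_. 2) d m u \<and>
             converges_onto (zeta d tb x0 j0 \<omega>) m u}"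
    proof (rule mono[OF A' converges_measurable], rule subsetI)
      fix \<omega> assume \<omega>: "\<omega> \<in> A'"
      obtain s x e n1 where t: "tracks d e s x" "\<forall>k. e k \<le> 1/2500" "e \<longlonglongrightarrow> 0"
        "\<bar>x 0 - 382/1000\<bar> \<le> 1/2500" "\<And>k. zeta d tb x0 j0 \<omega> (k + Suc n1) = side_point (s k) (x k)"
        using trk'[OF \<omega>] unfolding tracked_def by blast
      interpret cut_tracking D0 e s x
        by unfold_locales (use D0 t(1,2) in \<open>simp_all add: d_def\<close>)
      have x0: "381/1000 \<le> x 0" "x 0 \<le> 383/1000" using t(4) by linarith+
      have "\<exists>m u. periodic_orbit (\<lambda>_. 1) (\<lambda>_. 2) d m u \<and> converges_onto (zeta d tb x0 j0 \<omega>) m u"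
        unfolding d_def by (rule forward_region_converges[OF x0 t(3)]) (rule t(5)[unfolded d_def])
      then show "\<omega> \<in> {\<omega> \<in> space ?\<Omega>. \<exists>m u. periodic_orbit (\<lambda>_. 1) (\<lambda>_. 2) d m u \<and>
             converges_onto (zeta d tb x0 j0 \<omega>) m u}"
        using \<omega> sets.sets_into_space[OF A'(1)] by blast
    qed
  qed
  have "0 < d i" "d i < 1" for i using d[of i] by linarith+
  then show ?thesis
    using main by (intro exI[of _ "\<lambda>_. 1"] exI[of _ "\<lambda>_. 2"] exI[of _ d]) (simp add: sum_3)
qed

end
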